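(* Let $G_0$ be a group in which all elements of order $3$ are conjugate and all involutions are conjugate, and such that there exist an element $a\in G_0$ of order $3$ and an involution $t\in G_0$ with $\langle a,t\rangle\cong S_3$. Assume that $G_0$ acts (on the right) on a set $X_0$ in such a way that 1. the action is $3$-sharp; 2. the involution $t$ fixes a unique point $x_0\in X_0$; 3. $a$ has no fixed point in $X_0$; 4. $(x_0,x_0a,x_0a^2)=(x_0,x_0a,x_0at)$; 5. if $B=(x,y,z)$ is a triple of pairwise distinct elements of $X_0$ such that the setwise stabilizer of $B$ in $G_0$ is isomorphic to $S_3$, then there is some $g\in G_0$ with $Ag=B$, where $A=(x_0,x_0a,x_0a^2)=(x_0,x_0a,x_0at)$. Let $R,S,U$ be disjoint sets with $|R|=|S|=|U|=\max\{|G_0|,\aleph_0\}$, let $F(R),F(S),F(U)$ be the free groups on them, and let $$G=\Bigl((\langle a\rangle\times F(U))\ast_{\langle a\rangle}G_0\ast_{\langle t\rangle}(\langle t\rangle\times F(S))\Bigr)\ast F(R).$$ Then the action of $G_0$ on $X_0$ can be extended to a sharply $3$-transitive action of $G$ on a suitable set $Y\supset X_0$.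
   Context: Actions are right actions, and a group acts on triples coordinatewise: $(x,y,z)g=(xg,yg,zg)$. An involution is an element of order exactly $2$. An action of a group on a set is called $3$-sharp if the pointwise stabilizer of any three distinct points is trivial. An action on a set $Y$ is sharply $3$-transitive if for any two ordered triples $(y_1,y_2,y_3)$, $(z_1,z_2,z_3)$ of pairwise distinct points of $Y$ there is exactly one group element $g$ with $y_ig=z_i$ for $i=1,2,3$. That the action of $G$ on $Y$ extends that of $G_0$ on $X_0$ means that for $g\in G_0\le G$ and $x\in X_0$ the point $xg\in Y$ is the image of $x$ under $g$ in the given action of $G_0$ on $X_0$. The amalgamated products identify the copies of $\langle a\rangle$ in $\langle a\rangle\times F(U)$ and $G_0$, and the copies of $\langle t\rangle$ in $G_0$ and $\langle t\rangle\times F(S)$; equivalently, $G$ is the quotient of the free product $G_0\ast F(R\cup S\cup U)$ by the relations $ua=au$ ($u\in U$) and $st=ts$ ($s\in S$).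
   Formalization: The formal theorem additionally assumes |X_0| ≤ max{|G_0|, ℵ_0}; this is necessary, since a sharply 3-transitive action of G on Y ⊇ X_0 forces |X_0| ≤ |G| (counterexample otherwise: S_3 on {1,2,3} plus uncountably many regular orbits). *)

theory Defs
  imports "HOL-Algebra.Multiplicative_Group" "HOL-Algebra.Elementary_Groups" "HOL-Algebra.Sym_Groups"
begin

unbundle cardinal_syntax

section \<open>Right actions\<close>

text \<open>The library's \<open>group_action\<close> is a homomorphism into \<open>BijGroup\<close>, that is, a left action;
  hence a separate notion is needed for right actions.  Here \<open>act x g\<close> is the point
  written $xg$ on paper.\<close>

locale right_action = group G for G (structure) +
  fixes \<Omega> :: "'x set" and act :: "'x \<Rightarrow> 'a \<Rightarrow> 'x"
  assumes act_closed: "\<lbrakk>x \<in> \<Omega>; g \<in> carrier G\<rbrakk> \<Longrightarrow> act x g \<in> \<Omega>"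
    and act_one: "x \<in> \<Omega> \<Longrightarrow> act x \<one> = x"
    and act_mult: "\<lbrakk>x \<in> \<Omega>; g \<in> carrier G; h \<in> carrier G\<rbrakk> \<Longrightarrow> act x (g \<otimes> h) = act (act x g) h"

definition three_sharp :: "('a, 'm) monoid_scheme \<Rightarrow> 'x set \<Rightarrow> ('x \<Rightarrow> 'a \<Rightarrow> 'x) \<Rightarrow> bool" where
  "three_sharp G \<Omega> act \<longleftrightarrow>
     (\<forall>x\<in>\<Omega>. \<forall>y\<in>\<Omega>. \<forall>z\<in>\<Omega>. x \<noteq> y \<and> y \<noteq> z \<and> x \<noteq> z \<longrightarrow>
        {g \<in> carrier G. act x g = x \<and> act y g = y \<and> act z g = z} = {\<one>\<^bsub>G\<^esub>})"

definition sharply_three_transitive ::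
    "('a, 'm) monoid_scheme \<Rightarrow> 'x set \<Rightarrow> ('x \<Rightarrow> 'a \<Rightarrow> 'x) \<Rightarrow> bool" where
  "sharply_three_transitive G Y act \<longleftrightarrow>
     (\<forall>y1\<in>Y. \<forall>y2\<in>Y. \<forall>y3\<in>Y. \<forall>z1\<in>Y. \<forall>z2\<in>Y. \<forall>z3\<in>Y.
        y1 \<noteq> y2 \<and> y2 \<noteq> y3 \<and> y1 \<noteq> y3 \<longrightarrow>
        z1 \<noteq> z2 \<and> z2 \<noteq> z3 \<and> z1 \<noteq> z3 \<longrightarrow>
        (\<exists>!g. g \<in> carrier G \<and> act y1 g = z1 \<and> act y2 g = z2 \<and> act y3 g = z3))"

definition setwise_stabilizer ::
    "('a, 'm) monoid_scheme \<Rightarrow> ('x \<Rightarrow> 'a \<Rightarrow> 'x) \<Rightarrow> 'x set \<Rightarrow> 'a set" where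
  "setwise_stabilizer G act B = {g \<in> carrier G. (\<lambda>x. act x g) ` B = B}"

definition conjugate_in :: "('a, 'm) monoid_scheme \<Rightarrow> 'a \<Rightarrow> 'a \<Rightarrow> bool" where
  "conjugate_in G x y \<longleftrightarrow> (\<exists>g\<in>carrier G. y = inv\<^bsub>G\<^esub> g \<otimes>\<^bsub>G\<^esub> x \<otimes>\<^bsub>G\<^esub> g)"


section \<open>Monoids given by generators and relations\<close>

text \<open>The congruence on the words over the alphabet \<open>A\<close> generated by the pairs in \<open>E\<close>.\<close>

inductive word_cong :: "'l set \<Rightarrow> ('l list \<times> 'l list) set \<Rightarrow> 'l list \<Rightarrow> 'l list \<Rightarrow> bool"
  for A :: "'l set" and E :: "('l list \<times> 'l list) set" where
  step: "\<lbrakk>(u, v) \<in> E; u \<in> lists A; v \<in> lists A; p \<in> lists A; q \<in> lists A\<rbrakk>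
           \<Longrightarrow> word_cong A E (p @ u @ q) (p @ v @ q)"
| refl: "u \<in> lists A \<Longrightarrow> word_cong A E u u"
| sym: "word_cong A E u v \<Longrightarrow> word_cong A E v u"
| trans: "\<lbrakk>word_cong A E u v; word_cong A E v w\<rbrakk> \<Longrightarrow> word_cong A E u w"

definition word_class :: "'l set \<Rightarrow> ('l list \<times> 'l list) set \<Rightarrow> 'l list \<Rightarrow> 'l list set" where
  "word_class A E u = {v. word_cong A E u v}"

definition presented :: "'l set \<Rightarrow> ('l list \<times> 'l list) set \<Rightarrow> 'l list set monoid" where
  "presented A E =
     \<lparr>carrier = word_class A E ` lists A,
      monoid.mult = (\<lambda>P Q. {w. \<exists>u\<in>P. \<exists>v\<in>Q. word_cong A E (u @ v) w}),
      one = word_class A E []\<rparr>"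


section \<open>Free groups, amalgamated products, free products\<close>

text \<open>The letter \<open>(s, True)\<close> stands for $s$ and \<open>(s, False)\<close> for its inverse.\<close>

definition free_group :: "'b set \<Rightarrow> ('b \<times> bool) list set monoid" where
  "free_group S = presented (S \<times> UNIV) {([(s, e), (s, \<not> e)], []) | s e. s \<in> S}"

text \<open>The amalgamated product of \<open>G\<close> and \<open>H\<close> along the maps \<open>i\<close> and \<open>j\<close> from \<open>C\<close>: words in
  elements of \<open>G\<close> and of \<open>H\<close>, modulo the multiplication tables of \<open>G\<close> and \<open>H\<close> and the
  identifications \<open>i c = j c\<close>.\<close>

definition amalgam_rels :: "('a, 'm) monoid_scheme \<Rightarrow> ('b, 'n) monoid_scheme \<Rightarrow>
    'c set \<Rightarrow> ('c \<Rightarrow> 'a) \<Rightarrow> ('c \<Rightarrow> 'b) \<Rightarrow> (('a + 'b) list \<times> ('a + 'b) list) set" where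
  "amalgam_rels G H C i j =
     {([Inl x, Inl y], [Inl (x \<otimes>\<^bsub>G\<^esub> y)]) | x y. x \<in> carrier G \<and> y \<in> carrier G} \<union>
     {([Inr x, Inr y], [Inr (x \<otimes>\<^bsub>H\<^esub> y)]) | x y. x \<in> carrier H \<and> y \<in> carrier H} \<union>
     {([Inl \<one>\<^bsub>G\<^esub>], []), ([Inr \<one>\<^bsub>H\<^esub>], [])} \<union>
     {([Inl (i c)], [Inr (j c)]) | c. c \<in> C}"

definition amalgam :: "('a, 'm) monoid_scheme \<Rightarrow> ('b, 'n) monoid_scheme \<Rightarrow>
    'c set \<Rightarrow> ('c \<Rightarrow> 'a) \<Rightarrow> ('c \<Rightarrow> 'b) \<Rightarrow> ('a + 'b) list set monoid" where
  "amalgam G H C i j = presented (carrier G <+> carrier H) (amalgam_rels G H C i j)"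

definition amalgam_inl :: "('a, 'm) monoid_scheme \<Rightarrow> ('b, 'n) monoid_scheme \<Rightarrow>
    'c set \<Rightarrow> ('c \<Rightarrow> 'a) \<Rightarrow> ('c \<Rightarrow> 'b) \<Rightarrow> 'a \<Rightarrow> ('a + 'b) list set" where
  "amalgam_inl G H C i j x =
     word_class (carrier G <+> carrier H) (amalgam_rels G H C i j) [Inl x]"

definition amalgam_inr :: "('a, 'm) monoid_scheme \<Rightarrow> ('b, 'n) monoid_scheme \<Rightarrow>
    'c set \<Rightarrow> ('c \<Rightarrow> 'a) \<Rightarrow> ('c \<Rightarrow> 'b) \<Rightarrow> 'b \<Rightarrow> ('a + 'b) list set" where
  "amalgam_inr G H C i j y =
     word_class (carrier G <+> carrier H) (amalgam_rels G H C i j) [Inr y]"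

definition free_product :: "('a, 'm) monoid_scheme \<Rightarrow> ('b, 'n) monoid_scheme \<Rightarrow>
    ('a + 'b) list set monoid" where
  "free_product G H = amalgam G H {()} (\<lambda>_. \<one>\<^bsub>G\<^esub>) (\<lambda>_. \<one>\<^bsub>H\<^esub>)"

definition free_product_inl :: "('a, 'm) monoid_scheme \<Rightarrow> ('b, 'n) monoid_scheme \<Rightarrow>
    'a \<Rightarrow> ('a + 'b) list set" where
  "free_product_inl G H = amalgam_inl G H {()} (\<lambda>_. \<one>\<^bsub>G\<^esub>) (\<lambda>_. \<one>\<^bsub>H\<^esub>)"


section \<open>The group of the theorem\<close>

text \<open>$\langle x\rangle \times F(S)$\<close>

definition cyclic_times_free ::
    "('g, 'm) monoid_scheme \<Rightarrow> 'g \<Rightarrow> 'b set \<Rightarrow> ('g \<times> ('b \<times> bool) list set) monoid" where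
  "cyclic_times_free G0 x S = subgroup_generated G0 {x} \<times>\<times> free_group S"

type_synonym ('g, 'b) left_elt = "(('g \<times> ('b \<times> bool) list set) + 'g) list set"
type_synonym ('g, 'b) middle_elt =
  "(('g, 'b) left_elt + ('g \<times> ('b \<times> bool) list set)) list set"
type_synonym ('g, 'b) big_elt = "(('g, 'b) middle_elt + ('b \<times> bool) list set) list set"

text \<open>$(\langle a\rangle\times F(U)) \ast_{\langle a\rangle} G_0$, with the inclusion of $G_0$\<close>

definition left_group ::
    "('g, 'm) monoid_scheme \<Rightarrow> 'g \<Rightarrow> 'b set \<Rightarrow> ('g, 'b) left_elt monoid" where
  "left_group G0 a U =
     amalgam (cyclic_times_free G0 a U) G0 (carrier (subgroup_generated G0 {a}))
       (\<lambda>c. (c, \<one>\<^bsub>free_group U\<^esub>)) (\<lambda>c. c)"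

definition left_incl ::
    "('g, 'm) monoid_scheme \<Rightarrow> 'g \<Rightarrow> 'b set \<Rightarrow> 'g \<Rightarrow> ('g, 'b) left_elt" where
  "left_incl G0 a U =
     amalgam_inr (cyclic_times_free G0 a U) G0 (carrier (subgroup_generated G0 {a}))
       (\<lambda>c. (c, \<one>\<^bsub>free_group U\<^esub>)) (\<lambda>c. c)"

text \<open>$(\langle a\rangle\times F(U)) \ast_{\langle a\rangle} G_0 \ast_{\langle t\rangle}
  (\langle t\rangle\times F(S))$, with the inclusion of $G_0$\<close>

definition middle_group :: "('g, 'm) monoid_scheme \<Rightarrow> 'g \<Rightarrow> 'g \<Rightarrow> 'b set \<Rightarrow> 'b set \<Rightarrow>
    ('g, 'b) middle_elt monoid" where
  "middle_group G0 a t S U =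
     amalgam (left_group G0 a U) (cyclic_times_free G0 t S)
       (carrier (subgroup_generated G0 {t}))
       (left_incl G0 a U) (\<lambda>c. (c, \<one>\<^bsub>free_group S\<^esub>))"

definition middle_incl :: "('g, 'm) monoid_scheme \<Rightarrow> 'g \<Rightarrow> 'g \<Rightarrow> 'b set \<Rightarrow> 'b set \<Rightarrow>
    'g \<Rightarrow> ('g, 'b) middle_elt" where
  "middle_incl G0 a t S U g =
     amalgam_inl (left_group G0 a U) (cyclic_times_free G0 t S)
       (carrier (subgroup_generated G0 {t}))
       (left_incl G0 a U) (\<lambda>c. (c, \<one>\<^bsub>free_group S\<^esub>)) (left_incl G0 a U g)"

text \<open>$G$ itself, with the inclusion of $G_0$\<close>

definition big_group :: "('g, 'm) monoid_scheme \<Rightarrow> 'g \<Rightarrow> 'g \<Rightarrow> 'b set \<Rightarrow> 'b set \<Rightarrow> 'b set \<Rightarrow>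
    ('g, 'b) big_elt monoid" where
  "big_group G0 a t R S U = free_product (middle_group G0 a t S U) (free_group R)"

definition big_incl :: "('g, 'm) monoid_scheme \<Rightarrow> 'g \<Rightarrow> 'g \<Rightarrow> 'b set \<Rightarrow> 'b set \<Rightarrow> 'b set \<Rightarrow>
    'g \<Rightarrow> ('g, 'b) big_elt" where
  "big_incl G0 a t R S U g =
     free_product_inl (middle_group G0 a t S U) (free_group R) (middle_incl G0 a t S U g)"


section \<open>Cardinality\<close>

text \<open>$|R| = \max\{|A|, \aleph_0\}$.  The maximum is spelled out by cases because \<open>|A|\<close> and
  \<open>natLeq\<close> are relations over different types.\<close>

definition card_eq_max_aleph0 :: "'b set \<Rightarrow> 'a set \<Rightarrow> bool" where
  "card_eq_max_aleph0 R A \<longleftrightarrow> (if |A| \<le>o natLeq then |R| =o natLeq else |R| =o |A| )"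

text \<open>If $G$ acts sharply 3-transitively on $Y$ and $Y$ has at least three points, then
  the ordered triples of distinct points of $Y$ are in bijection with $G$, so
  $|Y| \le |G| = \max\{|G_0|,\aleph_0\}$.  Hence $X_0 \subseteq Y$ forces
  $|X_0| \le \max\{|G_0|,\aleph_0\}$, which does not follow from conditions on point
  stabilizers (regular orbits may be added to $X_0$ without affecting any of those), and the
  bound has to be assumed.  For the same reason every possible $Y$ is, up to renaming
  the points outside $X_0$, a subset of the disjoint sum of \<open>X0\<close> and the element type of $G$.\<close>

end

(*
Read G as G0 with extra generators: r free, s commuting with t, u commuting with a.  An action
of G extending one of G0 is then a family of permutations, one for each generator, where those
of s and u commute with t and a.  Let Y consist of X0 and |R| regular orbits of G0, and build
the permutations as a growing system of partial injections of Y.  Such a system moves triples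
of distinct points; a walk on triples carries an element of the group G.  Two invariants are
kept: every closed walk carries the identity, and every connected class contains a triple whose
connected rearrangements are all realized inside G0.  A generator is extended at a point by
sending the point into an untouched regular orbit, which only adds a dead end to the walks.  A
triple B is joined to A by an unused generator: by the second invariant B may be replaced by a
triple whose stabilizer lies in G0, and conjugacy in G0 makes that stabilizer trivial, <t>, <a>
or S_3; the first three cases use a generator from R, S and U, and in the last B is already a
translate of A.  Both steps preserve the invariants, so transfinite recursion of length |R|
makes all maps total and all triples connected: G is transitive on triples by the latter, and
free on them by the first invariant.  No normal form theorem for G is needed.
*)

theory Submission
  imports Defs
begin

section \<open>Groups given by presentations\<close>

text \<open>The obstacle is the bridge that a new letter e builds from A to B. A walk may cross it,
  move B to a rearrangement of itself and come back, so that it carries A to a rearrangement of A.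
  But G0 already realizes every rearrangement of A, and freeness demands that both ways carry the
  same element. They do if B was moved by an element of G0 that commutes with e. Hence all
  symmetries of B must be visible inside G0, and the factors <t> x F(S) and <a> x F(U) supply
  letters that commute with exactly these symmetries. By 3-sharpness the stabilizer of a triple
  embeds into S_3, so its nontrivial elements have order 2 or 3 and are conjugate to t or to a power
  of a. The price is that a letter of S, commuting with t, must fix x0. The recursion therefore
  starts from a system that is as large as S, and smallness refers to what has been added to it.
  Away from x0 nothing obstructs: a has no fixed point and t no other one, so a letter extends
  freely along the orbits of the subgroup it commutes with. At limit stages freeness survives
  because walks are finite, and the second invariant because S_3 is finite.\<close>

lemma word_cong_lists:
  assumes "word_cong A E u v"
  shows "u \<in> lists A" "v \<in> lists A"
  using assms by (induction rule: word_cong.induct) auto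

lemma word_cong_context:
  assumes "word_cong A E u v" "p \<in> lists A" "q \<in> lists A"
  shows "word_cong A E (p @ u @ q) (p @ v @ q)"
  using assms
proof (induction rule: word_cong.induct)
  case (step u v p' q')
  then show ?case using word_cong.step[of u v E A "p @ p'" "q' @ q"] by simp
next
  case (refl u)
  then show ?case by (intro word_cong.refl) simp
next
  case (sym u v)
  then show ?case using word_cong.sym by blast
next
  case (trans u v w)
  then show ?case using word_cong.trans by blast
qed

lemma word_cong_append:
  assumes "word_cong A E u u'" "word_cong A E v v'"
  shows "word_cong A E (u @ v) (u' @ v')"
proof -
  have "word_cong A E (u @ v) (u' @ v)"
    using word_cong_context[OF assms(1), of "[]" v] word_cong_lists[OF assms(2)] by simp
  moreover have "word_cong A E (u' @ v) (u' @ v')"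
    using word_cong_context[OF assms(2), of u' "[]"] word_cong_lists[OF assms(1)] by simp
  ultimately show ?thesis by (rule word_cong.trans)
qed

lemma word_cong_rel: "\<lbrakk>(u, v) \<in> E; u \<in> lists A; v \<in> lists A\<rbrakk> \<Longrightarrow> word_cong A E u v"
  using word_cong.step[of u v E A "[]" "[]"] by simp

lemma word_class_eqI: "word_cong A E u v \<Longrightarrow> word_class A E u = word_class A E v"
  unfolding word_class_def using word_cong.sym word_cong.trans by blast

lemma word_class_closed: "u \<in> lists A \<Longrightarrow> word_class A E u \<in> carrier (presented A E)"
  unfolding presented_def by simp

lemma word_class_mult:
  assumes "u \<in> lists A" "v \<in> lists A"
  shows "word_class A E u \<otimes>\<^bsub>presented A E\<^esub> word_class A E v = word_class A E (u @ v)"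
proof -
  have "word_cong A E (u @ v) w" if "word_cong A E u u'" "word_cong A E v v'" "word_cong A E (u' @ v') w" for u' v' w
    using word_cong.trans[OF word_cong_append[OF that(1,2)] that(3)] .
  then have "{w. \<exists>u'\<in>word_class A E u. \<exists>v'\<in>word_class A E v. word_cong A E (u' @ v') w} = word_class A E (u @ v)"
    using word_cong.refl[OF assms(1), of E] word_cong.refl[OF assms(2), of E]
    unfolding word_class_def by blast
  then show ?thesis unfolding presented_def by simp
qed

lemma presented_carrierE:
  assumes "x \<in> carrier (presented A E)"
  obtains u where "u \<in> lists A" "x = word_class A E u"
  using assms unfolding presented_def by auto

lemma presented_one: "\<one>\<^bsub>presented A E\<^esub> = word_class A E []"
  unfolding presented_def by simp

text \<open>Left inverses of letters suffice: a left inverse of a word is the concatenation, in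
  reverse order, of left inverses of its letters.\<close>

lemma presented_group:
  assumes inv: "\<And>l. l \<in> A \<Longrightarrow> \<exists>w\<in>lists A. word_cong A E (w @ [l]) []"
  shows "group (presented A E)"
proof (rule groupI)
  fix x y assume "x \<in> carrier (presented A E)" "y \<in> carrier (presented A E)"
  then obtain u v where "u \<in> lists A" "x = word_class A E u" "v \<in> lists A" "y = word_class A E v"
    by (metis presented_carrierE)
  then show "x \<otimes>\<^bsub>presented A E\<^esub> y \<in> carrier (presented A E)"
    by (simp add: word_class_mult word_class_closed)
next
  show "\<one>\<^bsub>presented A E\<^esub> \<in> carrier (presented A E)"
    by (simp add: presented_one word_class_closed)
next
  fix x y z assume "x \<in> carrier (presented A E)" "y \<in> carrier (presented A E)" "z \<in> carrier (presented A E)"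
  then obtain u v w where "u \<in> lists A" "x = word_class A E u" "v \<in> lists A" "y = word_class A E v"
    "w \<in> lists A" "z = word_class A E w"
    by (metis presented_carrierE)
  then show "x \<otimes>\<^bsub>presented A E\<^esub> y \<otimes>\<^bsub>presented A E\<^esub> z = x \<otimes>\<^bsub>presented A E\<^esub> (y \<otimes>\<^bsub>presented A E\<^esub> z)"
    by (simp add: word_class_mult)
next
  fix x assume "x \<in> carrier (presented A E)"
  then obtain u where "u \<in> lists A" "x = word_class A E u" by (metis presented_carrierE)
  then show "\<one>\<^bsub>presented A E\<^esub> \<otimes>\<^bsub>presented A E\<^esub> x = x"
    by (simp add: word_class_mult presented_one)
next
  fix x assume "x \<in> carrier (presented A E)"
  then obtain u where u: "u \<in> lists A" "x = word_class A E u" by (metis presented_carrierE)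
  from u(1) have "\<exists>w\<in>lists A. word_cong A E (w @ u) []"
  proof (induction u rule: list.induct)
    case Nil
    then show ?case using word_cong.refl[of "[]" A E] by (intro bexI[of _ "[]"]) auto
  next
    case (Cons l u)
    have lu: "l \<in> A" "u \<in> lists A" using Cons.prems by auto
    obtain w where w: "w \<in> lists A" "word_cong A E (w @ u) []" using Cons.IH[OF lu(2)] by blast
    from lu(1) obtain k where k: "k \<in> lists A" "word_cong A E (k @ [l]) []" by (meson inv)
    have "word_cong A E (w @ (k @ [l]) @ u) (w @ [] @ u)"
      by (rule word_cong_context[OF k(2) w(1) lu(2)])
    then have "word_cong A E ((w @ k) @ l # u) (w @ u)" by simp
    then have "word_cong A E ((w @ k) @ l # u) []" using w(2) by (rule word_cong.trans)
    then show ?case using w k by (intro bexI[of _ "w @ k"]) auto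
  qed
  then obtain w where "w \<in> lists A" "word_cong A E (w @ u) []" by blast
  then have "word_class A E w \<otimes>\<^bsub>presented A E\<^esub> x = \<one>\<^bsub>presented A E\<^esub>"
    "word_class A E w \<in> carrier (presented A E)"
    using u by (simp_all add: word_class_mult presented_one word_class_closed word_class_eqI)
  then show "\<exists>y\<in>carrier (presented A E). y \<otimes>\<^bsub>presented A E\<^esub> x = \<one>\<^bsub>presented A E\<^esub>" by blast
qed

section \<open>Generating sets, and actions of a presented group\<close>

definition generates :: "('a, 'm) monoid_scheme \<Rightarrow> 'a set \<Rightarrow> bool" where
  "generates G X \<longleftrightarrow> (\<forall>H. subgroup H G \<longrightarrow> X \<subseteq> H \<longrightarrow> carrier G \<subseteq> H)"

lemma generatesD: "\<lbrakk>generates G X; subgroup H G; X \<subseteq> H; x \<in> carrier G\<rbrakk> \<Longrightarrow> x \<in> H"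
  unfolding generates_def by blast

lemma generates_subset: "\<lbrakk>generates G X; subgroup H G; X \<subseteq> H\<rbrakk> \<Longrightarrow> carrier G \<subseteq> H"
  unfolding generates_def by blast

lemma presented_generates: "generates (presented A E) ((\<lambda>l. word_class A E [l]) ` A)"
  unfolding generates_def
proof (intro allI impI subsetI)
  fix H x assume H: "subgroup H (presented A E)" "(\<lambda>l. word_class A E [l]) ` A \<subseteq> H"
    and x: "x \<in> carrier (presented A E)"
  obtain u where u: "u \<in> lists A" "x = word_class A E u" using x by (rule presented_carrierE)
  from u(1) have "word_class A E u \<in> H"
  proof (induction u)
    case Nil
    then show ?case using subgroup.one_closed[OF H(1)] by (simp add: presented_one)
  next
    case (Cons l u)
    then show ?case
      using subgroup.m_closed[OF H(1), of "word_class A E [l]" "word_class A E u"] H(2)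
      by (auto simp: word_class_mult)
  qed
  then show "x \<in> H" using u by simp
qed

lemma subgroup_preimage:
  assumes "group G" "group K" "h \<in> hom G K" "subgroup H K"
  shows "subgroup {x \<in> carrier G. h x \<in> H} G"
proof -
  interpret group_hom G K h using assms by (simp add: group_hom_def group_hom_axioms_def)
  show ?thesis
  proof (rule G.subgroupI)
    have "\<one>\<^bsub>G\<^esub> \<in> {x \<in> carrier G. h x \<in> H}" using subgroup.one_closed[OF assms(4)] by simp
    then show "{x \<in> carrier G. h x \<in> H} \<noteq> {}" by blast
  qed (simp_all add: subset_eq subgroup.m_closed[OF assms(4)] subgroup.m_inv_closed[OF assms(4)])
qed

text \<open>The preimage of \<open>H\<close> is a subgroup. This carries membership from generators
  of an inner group outward through the tower of amalgams.\<close>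

lemma generates_image:
  assumes "group G" "group K" "h \<in> hom G K" "generates G X" "X \<subseteq> carrier G" "subgroup H K" "h ` X \<subseteq> H"
    and "x \<in> carrier G"
  shows "h x \<in> H"
  using generatesD[OF assms(4) subgroup_preimage[OF assms(1-3,6)] _ assms(8)] assms(5,7) by auto

text \<open>The universal property of a presentation in the form used here: self-maps of
  \<open>Y\<close> that respect the relations give an action. \<open>foldl\<close> applies the first
  letter first, as a right action must.\<close>

lemma presented_action:
  assumes grp: "group (presented A E)"
    and closed: "\<And>y l. y \<in> Y \<Longrightarrow> l \<in> A \<Longrightarrow> \<alpha> y l \<in> Y"
    and rels: "\<And>u v y. (u, v) \<in> E \<Longrightarrow> u \<in> lists A \<Longrightarrow> v \<in> lists A \<Longrightarrow> y \<in> Y \<Longrightarrow> foldl \<alpha> y u = foldl \<alpha> y v"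
  shows "\<exists>\<beta>. right_action (presented A E) Y \<beta> \<and> (\<forall>y\<in>Y. \<forall>l\<in>A. \<beta> y (word_class A E [l]) = \<alpha> y l)"
proof -
  have fold_closed: "foldl \<alpha> y u \<in> Y" if "y \<in> Y" "u \<in> lists A" for y u
    using that closed by (induction u arbitrary: y) auto
  have cong: "foldl \<alpha> y u = foldl \<alpha> y v" if "word_cong A E u v" "y \<in> Y" for y u v
    using that
  proof (induction arbitrary: y rule: word_cong.induct)
    case (step u v p q)
    then show ?case using rels[of u v "foldl \<alpha> y p"] fold_closed by simp
  qed auto
  \<comment> \<open>Any word of the class may be chosen, since \<open>cong\<close> makes equivalent
    words act alike.\<close>
  define \<beta> where "\<beta> y P = foldl \<alpha> y (SOME u. u \<in> P)" for y P
  have \<beta>: "\<beta> y (word_class A E u) = foldl \<alpha> y u" if "u \<in> lists A" "y \<in> Y" for y u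
  proof -
    have "u \<in> word_class A E u" using word_cong.refl[OF that(1)] unfolding word_class_def by simp
    then have "(SOME v. v \<in> word_class A E u) \<in> word_class A E u" by (rule someI)
    then have "word_cong A E u (SOME v. v \<in> word_class A E u)" unfolding word_class_def by simp
    then show ?thesis unfolding \<beta>_def using cong that by metis
  qed
  have "right_action (presented A E) Y \<beta>"
  proof (rule right_action.intro[OF grp], unfold_locales)
    fix x g assume "x \<in> Y" "g \<in> carrier (presented A E)"
    then show "\<beta> x g \<in> Y" using \<beta> fold_closed by (metis presented_carrierE)
  next
    fix x assume "x \<in> Y"
    then show "\<beta> x \<one>\<^bsub>presented A E\<^esub> = x" by (simp add: presented_one \<beta>)
  next
    fix x g h assume x: "x \<in> Y" and "g \<in> carrier (presented A E)" "h \<in> carrier (presented A E)"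
    then obtain u v where "u \<in> lists A" "g = word_class A E u" "v \<in> lists A" "h = word_class A E v"
      by (metis presented_carrierE)
    then show "\<beta> x (g \<otimes>\<^bsub>presented A E\<^esub> h) = \<beta> (\<beta> x g) h"
      using x fold_closed by (simp add: word_class_mult \<beta>)
  qed
  then show ?thesis using \<beta> by (intro exI[of _ \<beta>]) auto
qed

section \<open>Free groups\<close>

definition free_rels :: "'b set \<Rightarrow> (('b \<times> bool) list \<times> ('b \<times> bool) list) set" where
  "free_rels S = {([(s, e), (s, \<not> e)], []) | s e. s \<in> S}"

lemma free_group_eq: "free_group S = presented (S \<times> UNIV) (free_rels S)"
  unfolding free_group_def free_rels_def ..

definition free_gen :: "'b set \<Rightarrow> 'b \<Rightarrow> ('b \<times> bool) list set" where
  "free_gen S s = word_class (S \<times> UNIV) (free_rels S) [(s, True)]"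

lemma free_letter_inverse:
  assumes "s \<in> S"
  shows "word_cong (S \<times> UNIV) (free_rels S) [(s, e), (s, \<not> e)] []"
  by (rule word_cong_rel) (use assms in \<open>auto simp: free_rels_def\<close>)

lemma free_group_group: "group (free_group S)"
  unfolding free_group_eq
proof (rule presented_group)
  fix l :: "'a \<times> bool" assume l: "l \<in> S \<times> UNIV"
  obtain s e where s: "l = (s, e)" "s \<in> S" using l by auto
  then have "word_cong (S \<times> UNIV) (free_rels S) ([(s, \<not> e)] @ [l]) []"
    using free_letter_inverse[of s S "\<not> e"] by simp
  then show "\<exists>w\<in>lists (S \<times> UNIV). word_cong (S \<times> UNIV) (free_rels S) (w @ [l]) []"
    using s by (intro bexI[of _ "[(s, \<not> e)]"]) auto
qed

lemma free_gen_closed: "s \<in> S \<Longrightarrow> free_gen S s \<in> carrier (free_group S)"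
  unfolding free_gen_def free_group_eq by (intro word_class_closed) auto

text \<open>Besides the positive letters the presentation has the letters \<open>(s, False)\<close>.
  Each of them is the inverse of a positive one, so a subgroup that contains the latter contains it
  too.\<close>

lemma free_group_generates: "generates (free_group S) (free_gen S ` S)"
  unfolding generates_def
proof (intro allI impI)
  fix H assume H: "subgroup H (free_group S)" "free_gen S ` S \<subseteq> H"
  let ?c = "\<lambda>l. word_class (S \<times> UNIV) (free_rels S) [l]"
  interpret F: group "free_group S" by (rule free_group_group)
  have "?c (s, e) \<in> H" if s: "s \<in> S" for s e
  proof (cases e)
    case True
    then show ?thesis using H(2) s unfolding free_gen_def by auto
  next
    case False
    have "?c (s, False) \<otimes>\<^bsub>free_group S\<^esub> free_gen S s = \<one>\<^bsub>free_group S\<^esub>"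
      using s word_class_eqI[OF free_letter_inverse[OF s, of False]]
      by (simp add: free_group_eq free_gen_def word_class_mult presented_one)
    moreover have "?c (s, False) \<in> carrier (free_group S)"
      using s unfolding free_group_eq by (intro word_class_closed) auto
    ultimately have "?c (s, False) = inv\<^bsub>free_group S\<^esub> free_gen S s"
      using F.inv_equality free_gen_closed[OF s] by simp
    then show ?thesis using False subgroup.m_inv_closed[OF H(1)] H(2) s by auto
  qed
  then have "?c ` (S \<times> UNIV) \<subseteq> H" by auto
  then show "carrier (free_group S) \<subseteq> H"
    using presented_generates[of "S \<times> UNIV" "free_rels S"] H(1) unfolding generates_def free_group_eq by blast
qed

text \<open>Negative letters act by the inverse bijections, so a letter followed by its opposite
  acts trivially in either order.\<close>

lemma free_group_action:
  assumes bij: "\<forall>s\<in>S. bij_betw (\<phi> s) Y Y"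
  shows "\<exists>\<beta>. right_action (free_group S) Y \<beta> \<and> (\<forall>y\<in>Y. \<forall>s\<in>S. \<beta> y (free_gen S s) = \<phi> s y)"
proof -
  define \<alpha> where "\<alpha> y l = (if snd l then \<phi> (fst l) y else inv_into Y (\<phi> (fst l)) y)" for y l
  have "\<exists>\<beta>. right_action (presented (S \<times> UNIV) (free_rels S)) Y \<beta> \<and>
      (\<forall>y\<in>Y. \<forall>l\<in>S \<times> UNIV. \<beta> y (word_class (S \<times> UNIV) (free_rels S) [l]) = \<alpha> y l)"
  proof (rule presented_action)
    show "group (presented (S \<times> UNIV) (free_rels S))"
      using free_group_group[of S] unfolding free_group_eq .
  next
    fix y l assume y: "y \<in> Y" and "l \<in> S \<times> (UNIV :: bool set)"
    then have b: "bij_betw (\<phi> (fst l)) Y Y" using bij by auto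
    show "\<alpha> y l \<in> Y"
      using bij_betw_apply[OF b y] bij_betw_apply[OF bij_betw_inv_into[OF b] y] unfolding \<alpha>_def by simp
  next
    fix u v y assume uv: "(u, v) \<in> free_rels S" and y: "y \<in> Y"
    obtain s e where s: "s \<in> S" "u = [(s, e), (s, \<not> e)]" "v = []" using uv unfolding free_rels_def by blast
    have i: "inv_into Y (\<phi> s) (\<phi> s y) = y" "\<phi> s (inv_into Y (\<phi> s) y) = y"
      using bij_betw_inv_into_left[OF bspec[OF bij s(1)] y] bij_betw_inv_into_right[OF bspec[OF bij s(1)] y] .
    show "foldl \<alpha> y u = foldl \<alpha> y v"
      unfolding \<alpha>_def s(2,3) using i by (cases e) simp_all
  qed
  then obtain \<beta> where \<beta>: "right_action (free_group S) Y \<beta>"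
    "\<forall>y\<in>Y. \<forall>l\<in>S \<times> UNIV. \<beta> y (word_class (S \<times> UNIV) (free_rels S) [l]) = \<alpha> y l"
    unfolding free_group_eq by (elim exE conjE)
  have "\<beta> y (free_gen S s) = \<phi> s y" if "y \<in> Y" "s \<in> S" for y s
    using bspec[OF bspec[OF \<beta>(2) that(1)], of "(s, True)"] that unfolding free_gen_def \<alpha>_def by simp
  then show ?thesis using \<beta>(1) by blast
qed

section \<open>Amalgamated products\<close>

lemma amalgam_group:
  assumes "group G" "group H"
  shows "group (amalgam G H C i j)"
  unfolding amalgam_def
proof (rule presented_group)
  interpret G: group G by fact
  interpret H: group H by fact
  let ?A = "carrier G <+> carrier H" and ?E = "amalgam_rels G H C i j"
  fix l assume "l \<in> ?A"
  then show "\<exists>w\<in>lists ?A. word_cong ?A ?E (w @ [l]) []"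
  proof
    fix x assume x: "l = Inl x" "x \<in> carrier G"
    have "word_cong ?A ?E [Inl (inv\<^bsub>G\<^esub> x), Inl x] [Inl (inv\<^bsub>G\<^esub> x \<otimes>\<^bsub>G\<^esub> x)]"
      by (rule word_cong_rel) (use x in \<open>auto simp: amalgam_rels_def\<close>)
    moreover have "word_cong ?A ?E [Inl \<one>\<^bsub>G\<^esub>] []"
      by (rule word_cong_rel) (auto simp: amalgam_rels_def)
    ultimately have "word_cong ?A ?E ([Inl (inv\<^bsub>G\<^esub> x)] @ [l]) []"
      using x word_cong.trans by fastforce
    then show ?thesis using x by (intro bexI[of _ "[Inl (inv\<^bsub>G\<^esub> x)]"]) auto
  next
    fix x assume x: "l = Inr x" "x \<in> carrier H"
    have "word_cong ?A ?E [Inr (inv\<^bsub>H\<^esub> x), Inr x] [Inr (inv\<^bsub>H\<^esub> x \<otimes>\<^bsub>H\<^esub> x)]"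
      by (rule word_cong_rel) (use x in \<open>auto simp: amalgam_rels_def\<close>)
    moreover have "word_cong ?A ?E [Inr \<one>\<^bsub>H\<^esub>] []"
      by (rule word_cong_rel) (auto simp: amalgam_rels_def)
    ultimately have "word_cong ?A ?E ([Inr (inv\<^bsub>H\<^esub> x)] @ [l]) []"
      using x word_cong.trans by fastforce
    then show ?thesis using x by (intro bexI[of _ "[Inr (inv\<^bsub>H\<^esub> x)]"]) auto
  qed
qed

lemma amalgam_inl_hom:
  assumes "monoid G"
  shows "amalgam_inl G H C i j \<in> hom G (amalgam G H C i j)"
  unfolding amalgam_inl_def amalgam_def
proof (rule homI)
  let ?A = "carrier G <+> carrier H" and ?E = "amalgam_rels G H C i j"
  fix x y assume x: "x \<in> carrier G"
  then show "word_class ?A ?E [Inl x] \<in> carrier (presented ?A ?E)"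
    by (intro word_class_closed) auto
  assume y: "y \<in> carrier G"
  have "word_cong ?A ?E [Inl x, Inl y] [Inl (x \<otimes>\<^bsub>G\<^esub> y)]"
    by (rule word_cong_rel) (use x y in \<open>auto simp: amalgam_rels_def monoid.m_closed[OF assms]\<close>)
  from word_class_eqI[OF this]
  show "word_class ?A ?E [Inl (x \<otimes>\<^bsub>G\<^esub> y)] =
      word_class ?A ?E [Inl x] \<otimes>\<^bsub>presented ?A ?E\<^esub> word_class ?A ?E [Inl y]"
    using x y by (subst word_class_mult) auto
qed

lemma amalgam_inr_hom:
  assumes "monoid H"
  shows "amalgam_inr G H C i j \<in> hom H (amalgam G H C i j)"
  unfolding amalgam_inr_def amalgam_def
proof (rule homI)
  let ?A = "carrier G <+> carrier H" and ?E = "amalgam_rels G H C i j"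
  fix x y assume x: "x \<in> carrier H"
  then show "word_class ?A ?E [Inr x] \<in> carrier (presented ?A ?E)"
    by (intro word_class_closed) auto
  assume y: "y \<in> carrier H"
  have "word_cong ?A ?E [Inr x, Inr y] [Inr (x \<otimes>\<^bsub>H\<^esub> y)]"
    by (rule word_cong_rel) (use x y in \<open>auto simp: amalgam_rels_def monoid.m_closed[OF assms]\<close>)
  from word_class_eqI[OF this]
  show "word_class ?A ?E [Inr (x \<otimes>\<^bsub>H\<^esub> y)] =
      word_class ?A ?E [Inr x] \<otimes>\<^bsub>presented ?A ?E\<^esub> word_class ?A ?E [Inr y]"
    using x y by (subst word_class_mult) auto
qed

lemma amalgam_glue:
  assumes "c \<in> C" "i c \<in> carrier G" "j c \<in> carrier H"
  shows "amalgam_inl G H C i j (i c) = amalgam_inr G H C i j (j c)"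
  unfolding amalgam_inl_def amalgam_inr_def
  by (intro word_class_eqI word_cong_rel) (use assms in \<open>auto simp: amalgam_rels_def\<close>)

lemma amalgam_generates:
  assumes "group G" "group H" "generates G X" "generates H Z" "X \<subseteq> carrier G" "Z \<subseteq> carrier H"
  shows "generates (amalgam G H C i j) (amalgam_inl G H C i j ` X \<union> amalgam_inr G H C i j ` Z)"
  unfolding generates_def
proof (intro allI impI)
  let ?P = "amalgam G H C i j" and ?l = "amalgam_inl G H C i j" and ?r = "amalgam_inr G H C i j"
  fix K assume K: "subgroup K ?P" "?l ` X \<union> ?r ` Z \<subseteq> K"
  have grp: "group ?P" by (rule amalgam_group) fact+
  have "?l x \<in> K" if "x \<in> carrier G" for x
    by (rule generates_image[OF assms(1) grp amalgam_inl_hom assms(3,5) K(1) _ that])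
      (use K(2) assms(1) in \<open>auto simp: group.is_monoid\<close>)
  moreover have "?r x \<in> K" if "x \<in> carrier H" for x
    by (rule generates_image[OF assms(2) grp amalgam_inr_hom assms(4,6) K(1) _ that])
      (use K(2) assms(2) in \<open>auto simp: group.is_monoid\<close>)
  ultimately have "(\<lambda>l. word_class (carrier G <+> carrier H) (amalgam_rels G H C i j) [l]) `
      (carrier G <+> carrier H) \<subseteq> K"
    unfolding amalgam_inl_def amalgam_inr_def by auto
  then show "carrier ?P \<subseteq> K"
    using presented_generates K(1) unfolding generates_def amalgam_def by blast
qed

text \<open>Each family of relations holds by an action law of one factor or by \<open>glue\<close>.
  The action of the group of the theorem is assembled by three applications of this lemma.\<close>

lemma amalgam_action:
  assumes G: "right_action G Y \<alpha>" and H: "right_action H Y \<beta>"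
    and glue: "\<forall>c\<in>C. \<forall>y\<in>Y. \<alpha> y (i c) = \<beta> y (j c)"
  shows "\<exists>\<delta>. right_action (amalgam G H C i j) Y \<delta> \<and>
    (\<forall>y\<in>Y. \<forall>x\<in>carrier G. \<delta> y (amalgam_inl G H C i j x) = \<alpha> y x) \<and>
    (\<forall>y\<in>Y. \<forall>x\<in>carrier H. \<delta> y (amalgam_inr G H C i j x) = \<beta> y x)"
proof -
  interpret G: right_action G Y \<alpha> by fact
  interpret H: right_action H Y \<beta> by fact
  let ?A = "carrier G <+> carrier H" and ?E = "amalgam_rels G H C i j"
  define \<epsilon> where "\<epsilon> y l = (case l of Inl x \<Rightarrow> \<alpha> y x | Inr x \<Rightarrow> \<beta> y x)" for y l
  have "\<exists>\<delta>. right_action (amalgam G H C i j) Y \<delta> \<and>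
      (\<forall>y\<in>Y. \<forall>l\<in>?A. \<delta> y (word_class ?A ?E [l]) = \<epsilon> y l)"
    unfolding amalgam_def
  proof (rule presented_action)
    show "group (presented ?A ?E)"
      using amalgam_group[OF G.is_group H.is_group] unfolding amalgam_def .
  next
    fix y l assume "y \<in> Y" "l \<in> ?A"
    then show "\<epsilon> y l \<in> Y" unfolding \<epsilon>_def by (auto intro: G.act_closed H.act_closed)
  next
    fix u v y assume "(u, v) \<in> ?E" "y \<in> Y"
    then show "foldl \<epsilon> y u = foldl \<epsilon> y v"
      unfolding \<epsilon>_def amalgam_rels_def
      by (auto simp: G.act_mult H.act_mult G.act_one H.act_one glue)
  qed
  then obtain \<delta> where \<delta>: "right_action (amalgam G H C i j) Y \<delta>"
    "\<forall>y\<in>Y. \<forall>l\<in>?A. \<delta> y (word_class ?A ?E [l]) = \<epsilon> y l"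
    by (elim exE conjE)
  have "\<delta> y (amalgam_inl G H C i j x) = \<alpha> y x" if "y \<in> Y" "x \<in> carrier G" for y x
    using bspec[OF bspec[OF \<delta>(2) that(1)] InlI[OF that(2)]] unfolding amalgam_inl_def \<epsilon>_def by simp
  moreover have "\<delta> y (amalgam_inr G H C i j x) = \<beta> y x" if "y \<in> Y" "x \<in> carrier H" for y x
    using bspec[OF bspec[OF \<delta>(2) that(1)] InrI[OF that(2)]] unfolding amalgam_inr_def \<epsilon>_def by simp
  ultimately show ?thesis using \<delta>(1) by blast
qed

section \<open>The product of a cyclic group and a free group\<close>

lemma cyclic_times_free_group: "group G0 \<Longrightarrow> group (cyclic_times_free G0 x S)"
  unfolding cyclic_times_free_def
  by (intro DirProd_group group.group_subgroup_generated free_group_group)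

lemma cyclic_times_free_simps:
  "carrier (cyclic_times_free G0 x S) = carrier (subgroup_generated G0 {x}) \<times> carrier (free_group S)"
  "(c, w) \<otimes>\<^bsub>cyclic_times_free G0 x S\<^esub> (d, v) = (c \<otimes>\<^bsub>G0\<^esub> d, w \<otimes>\<^bsub>free_group S\<^esub> v)"
  "\<one>\<^bsub>cyclic_times_free G0 x S\<^esub> = (\<one>\<^bsub>G0\<^esub>, \<one>\<^bsub>free_group S\<^esub>)"
  unfolding cyclic_times_free_def by simp_all

lemma subgroup_generated_mem:
  assumes "group G0" "x \<in> carrier G0"
  shows "x \<in> carrier (subgroup_generated G0 {x})" "\<one>\<^bsub>G0\<^esub> \<in> carrier (subgroup_generated G0 {x})"
    "carrier (subgroup_generated G0 {x}) \<subseteq> carrier G0"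
  using assms by (auto simp: carrier_subgroup_generated intro: generate.incl generate.one
      dest: group.generate_in_carrier[rotated 2])

lemma cyclic_times_free_generates:
  assumes "group G0" "x \<in> carrier G0"
  shows "generates (cyclic_times_free G0 x S)
    ((\<lambda>c. (c, \<one>\<^bsub>free_group S\<^esub>)) ` carrier (subgroup_generated G0 {x}) \<union>
     (\<lambda>s. (\<one>\<^bsub>G0\<^esub>, free_gen S s)) ` S)"
  unfolding generates_def
proof (intro allI impI)
  let ?P = "cyclic_times_free G0 x S" and ?F = "free_group S" and ?C = "subgroup_generated G0 {x}"
  fix H assume H: "subgroup H ?P"
    "(\<lambda>c. (c, \<one>\<^bsub>?F\<^esub>)) ` carrier ?C \<union> (\<lambda>s. (\<one>\<^bsub>G0\<^esub>, free_gen S s)) ` S \<subseteq> H"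
  interpret G0: group G0 by fact
  interpret F: group ?F by (rule free_group_group)
  interpret C: group ?C by (rule G0.group_subgroup_generated)
  have one: "\<one>\<^bsub>G0\<^esub> \<in> carrier ?C" by (rule subgroup_generated_mem(2)[OF assms])
  have hom: "(\<lambda>w. (\<one>\<^bsub>G0\<^esub>, w)) \<in> hom ?F ?P"
    by (rule homI) (auto simp: cyclic_times_free_simps one)
  have w: "(\<one>\<^bsub>G0\<^esub>, w) \<in> H" if "w \<in> carrier ?F" for w
    by (rule generates_image[OF F.is_group cyclic_times_free_group[OF assms(1)] hom free_group_generates _ H(1) _ that])
      (use H(2) free_gen_closed in auto)
  show "carrier ?P \<subseteq> H"
  proof
    fix p assume "p \<in> carrier ?P"
    then obtain c w where p: "p = (c, w)" "c \<in> carrier ?C" "w \<in> carrier ?F"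
      by (auto simp: cyclic_times_free_simps)
    have "(c, \<one>\<^bsub>?F\<^esub>) \<otimes>\<^bsub>?P\<^esub> (\<one>\<^bsub>G0\<^esub>, w) \<in> H"
      using subgroup.m_closed[OF H(1)] H(2) p(2) w[OF p(3)] by blast
    moreover have "c \<in> carrier G0" using p subgroup_generated_mem(3)[OF assms] by blast
    ultimately show "p \<in> H" using p by (simp add: cyclic_times_free_simps)
  qed
qed

text \<open>This reduces commutation to generators. It is applied with \<open>f\<close> the action
  of the cyclic generator, and then again with \<open>f\<close> the action of a fixed word.\<close>

lemma commuting_subgroup:
  assumes "right_action G Y \<alpha>" "\<And>y. y \<in> Y \<Longrightarrow> f y \<in> Y"
  shows "subgroup {g \<in> carrier G. \<forall>y\<in>Y. \<alpha> (f y) g = f (\<alpha> y g)} G"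
proof -
  interpret right_action G Y \<alpha> by fact
  show ?thesis
  proof (rule subgroupI)
    fix g assume g: "g \<in> {g \<in> carrier G. \<forall>y\<in>Y. \<alpha> (f y) g = f (\<alpha> y g)}"
    have "\<alpha> (f y) (inv\<^bsub>G\<^esub> g) = f (\<alpha> y (inv\<^bsub>G\<^esub> g))" if y: "y \<in> Y" for y
    proof -
      \<comment> \<open>Commutation with \<open>g\<close> at the preimage \<open>?z\<close> of
        \<open>y\<close>, read backwards, is commutation with the inverse at
        \<open>y\<close>.\<close>
      let ?z = "\<alpha> y (inv\<^bsub>G\<^esub> g)"
      have z: "?z \<in> Y" "\<alpha> ?z g = y" using y g act_closed act_mult[of y "inv\<^bsub>G\<^esub> g" g] act_one by auto
      then have "\<alpha> (f ?z) g = f y" using g by auto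
      then have "\<alpha> (f y) (inv\<^bsub>G\<^esub> g) = \<alpha> (\<alpha> (f ?z) g) (inv\<^bsub>G\<^esub> g)" by simp
      also have "\<dots> = f ?z"
        using act_mult[of "f ?z" g "inv\<^bsub>G\<^esub> g"] act_one assms(2)[OF z(1)] g by auto
      finally show ?thesis .
    qed
    then show "inv\<^bsub>G\<^esub> g \<in> {g \<in> carrier G. \<forall>y\<in>Y. \<alpha> (f y) g = f (\<alpha> y g)}" using g by auto
  qed (use assms(2) in \<open>auto simp: act_mult act_one act_closed intro!: exI[of _ "\<one>\<^bsub>G\<^esub>"]\<close>)
qed

text \<open>The hypothesis speaks of single letters and of \<open>x\<close> only. Commutation
  spreads from the letters to all words, then from \<open>x\<close> to all of its powers; this is
  what makes the composite \<open>\<beta>\<close> multiplicative.\<close>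

lemma cyclic_times_free_action:
  assumes act: "right_action G0 Y \<alpha>" and x: "x \<in> carrier G0"
    and bij: "\<forall>s\<in>S. bij_betw (\<phi> s) Y Y"
    and comm: "\<forall>s\<in>S. \<forall>y\<in>Y. \<phi> s (\<alpha> y x) = \<alpha> (\<phi> s y) x"
  shows "\<exists>\<beta>. right_action (cyclic_times_free G0 x S) Y \<beta> \<and>
    (\<forall>y\<in>Y. \<forall>c\<in>carrier (subgroup_generated G0 {x}). \<beta> y (c, \<one>\<^bsub>free_group S\<^esub>) = \<alpha> y c) \<and>
    (\<forall>y\<in>Y. \<forall>s\<in>S. \<beta> y (\<one>\<^bsub>G0\<^esub>, free_gen S s) = \<phi> s y)"
proof -
  interpret right_action G0 Y \<alpha> by fact
  let ?P = "cyclic_times_free G0 x S" and ?F = "free_group S" and ?C = "subgroup_generated G0 {x}"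
  obtain \<delta> where \<delta>: "right_action ?F Y \<delta>" and gen: "\<forall>y\<in>Y. \<forall>s\<in>S. \<delta> y (free_gen S s) = \<phi> s y"
    using free_group_action[OF bij] by (elim exE conjE)
  interpret F: right_action ?F Y \<delta> by (rule \<delta>)
  have commute_x: "\<delta> (\<alpha> y x) w = \<alpha> (\<delta> y w) x" if "w \<in> carrier ?F" "y \<in> Y" for y w
  proof -
    have "w \<in> {w \<in> carrier ?F. \<forall>y\<in>Y. \<delta> (\<alpha> y x) w = \<alpha> (\<delta> y w) x}"
      by (rule generatesD[OF free_group_generates commuting_subgroup[OF \<delta>] _ that(1)])
        (use x act_closed comm gen free_gen_closed in auto)
    then show ?thesis using that by blast
  qed
  have C_sub: "c \<in> carrier G0" if "c \<in> carrier ?C" for c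
    using subgroup_generated_mem(3)[OF is_group x] that by blast
  have commute: "\<delta> (\<alpha> y c) w = \<alpha> (\<delta> y w) c" if "c \<in> carrier ?C" "w \<in> carrier ?F" "y \<in> Y" for c y w
  proof -
    have sg: "subgroup {c \<in> carrier G0. \<forall>y\<in>Y. \<alpha> (\<delta> y w) c = \<delta> (\<alpha> y c) w} G0"
      by (rule commuting_subgroup[OF act]) (rule F.act_closed[OF _ that(2)])
    have "generate G0 {x} \<subseteq> {c \<in> carrier G0. \<forall>y\<in>Y. \<alpha> (\<delta> y w) c = \<delta> (\<alpha> y c) w}"
      by (rule generate_subgroup_incl[OF _ sg]) (use x commute_x that(2) in auto)
    moreover have "carrier ?C = generate G0 {x}" using x by (simp add: carrier_subgroup_generated)
    ultimately show ?thesis using that by auto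
  qed
  define \<beta> where "\<beta> y p = \<delta> (\<alpha> y (fst p)) (snd p)" for y p
  have "right_action ?P Y \<beta>"
  proof (rule right_action.intro[OF cyclic_times_free_group[OF is_group]], unfold_locales)
    fix y p assume y: "y \<in> Y" and "p \<in> carrier ?P"
    then obtain c w where p: "p = (c, w)" "c \<in> carrier ?C" "w \<in> carrier ?F"
      unfolding cyclic_times_free_simps by auto
    show "\<beta> y p \<in> Y"
      unfolding \<beta>_def using F.act_closed[OF act_closed[OF y C_sub[OF p(2)]] p(3)] p(1) by simp
  next
    fix y assume "y \<in> Y"
    then show "\<beta> y \<one>\<^bsub>?P\<^esub> = y"
      unfolding \<beta>_def cyclic_times_free_simps by (simp add: act_one F.act_one)
  next
    fix y p q assume y: "y \<in> Y" and "p \<in> carrier ?P" "q \<in> carrier ?P"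
    then obtain c w d v where pq: "p = (c, w)" "q = (d, v)" "c \<in> carrier ?C" "w \<in> carrier ?F"
      "d \<in> carrier ?C" "v \<in> carrier ?F"
      unfolding cyclic_times_free_simps by auto
    then show "\<beta> y (p \<otimes>\<^bsub>?P\<^esub> q) = \<beta> (\<beta> y p) q"
      unfolding \<beta>_def pq cyclic_times_free_simps
      using y C_sub[OF pq(3)] C_sub[OF pq(5)]
      by (simp add: act_mult F.act_mult act_closed commute)
  qed
  moreover have "\<beta> y (c, \<one>\<^bsub>?F\<^esub>) = \<alpha> y c" if "y \<in> Y" "c \<in> carrier ?C" for y c
    unfolding \<beta>_def using that C_sub by (simp add: F.act_one act_closed)
  moreover have "\<beta> y (\<one>\<^bsub>G0\<^esub>, free_gen S s) = \<phi> s y" if "y \<in> Y" "s \<in> S" for y s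
    unfolding \<beta>_def using that gen by (simp add: act_one)
  ultimately show ?thesis by blast
qed

section \<open>Partial extensions of an action\<close>

text \<open>Triples are functions on this type: rearranging a triple is then composition with a
  bijection, and a condition on all three coordinates is a single quantifier.\<close>

datatype three = I1 | I2 | I3

lemma UNIV_three: "(UNIV :: three set) = {I1, I2, I3}"
  using three.exhaust by blast

instance three :: finite
  by standard (simp add: UNIV_three)

context right_action
begin

lemma act_inv [simp]:
  assumes "x \<in> \<Omega>" "g \<in> carrier G"
  shows "act (act x g) (inv g) = x" "act (act x (inv g)) g = x"
  using assms act_mult[of x g "inv g"] act_mult[of x "inv g" g] act_one by auto

lemma act_cancel:
  assumes "x \<in> \<Omega>" "y \<in> \<Omega>" "g \<in> carrier G" "act x g = act y g"
  shows "x = y"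
  by (metis act_inv(1)[OF assms(1,3)] act_inv(1)[OF assms(2,3)] assms(4))

end

text \<open>\<open>E\<close> is the set of letters, and \<open>C e\<close> is the subgroup of
  \<open>G0\<close> with which the letter \<open>e\<close> commutes, later trivial, <t> or <a>. Only
  the validity of these relations in \<open>G\<close> is assumed. That \<open>G\<close> has no
  others enters when permutations of \<open>Y\<close> are turned into an action of
  \<open>G\<close>.\<close>

locale partial_extension = right_action G0 Y act + G: group G
  for G0 :: "('g, 'm) monoid_scheme" (structure) and Y :: "'y set" and act
    and G :: "('h, 'n) monoid_scheme" (structure) +
  fixes \<iota> :: "'g \<Rightarrow> 'h" and \<gamma> :: "'e \<Rightarrow> 'h" and E :: "'e set" and C :: "'e \<Rightarrow> 'g set"
  assumes \<iota>_hom: "\<iota> \<in> hom G0 G"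
    and \<gamma>_closed: "e \<in> E \<Longrightarrow> \<gamma> e \<in> carrier G"
    and C_subgroup: "e \<in> E \<Longrightarrow> subgroup (C e) G0"
    and \<gamma>_comm: "\<lbrakk>e \<in> E; c \<in> C e\<rbrakk> \<Longrightarrow> \<iota> c \<otimes>\<^bsub>G\<^esub> \<gamma> e = \<gamma> e \<otimes>\<^bsub>G\<^esub> \<iota> c"
begin

lemma \<iota>_closed [simp]: "g \<in> carrier G0 \<Longrightarrow> \<iota> g \<in> carrier G"
  using \<iota>_hom by (rule hom_in_carrier)

lemma \<iota>_mult: "\<lbrakk>g \<in> carrier G0; h \<in> carrier G0\<rbrakk> \<Longrightarrow> \<iota> (g \<otimes> h) = \<iota> g \<otimes>\<^bsub>G\<^esub> \<iota> h"
  using \<iota>_hom by (rule hom_mult)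

lemma \<iota>_group_hom: "group_hom G0 G \<iota>"
  using \<iota>_hom by (simp add: group_hom_def group_hom_axioms_def is_group G.is_group)

lemma \<iota>_one [simp]: "\<iota> \<one> = \<one>\<^bsub>G\<^esub>"
  using group_hom.hom_one[OF \<iota>_group_hom] .

lemma \<iota>_inv: "g \<in> carrier G0 \<Longrightarrow> \<iota> (inv g) = inv\<^bsub>G\<^esub> \<iota> g"
  using group_hom.hom_inv[OF \<iota>_group_hom] .

lemma C_closed: "\<lbrakk>e \<in> E; c \<in> C e\<rbrakk> \<Longrightarrow> c \<in> carrier G0"
  by (rule subgroup.mem_carrier[OF C_subgroup])

declare \<gamma>_closed [simp]

section \<open>Triples, walks and the two invariants\<close>

definition triples :: "(three \<Rightarrow> 'y) set" where
  "triples = {\<tau>. inj \<tau> \<and> range \<tau> \<subseteq> Y}"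

definition tact :: "(three \<Rightarrow> 'y) \<Rightarrow> 'g \<Rightarrow> three \<Rightarrow> 'y" where
  "tact \<tau> g = (\<lambda>i. act (\<tau> i) g)"

definition edge :: "('e \<times> 'y \<times> 'y) set \<Rightarrow> 'e \<Rightarrow> (three \<Rightarrow> 'y) \<Rightarrow> (three \<Rightarrow> 'y) \<Rightarrow> bool" where
  "edge \<Phi> e \<tau> \<tau>' \<longleftrightarrow> (\<forall>i. (e, \<tau> i, \<tau>' i) \<in> \<Phi>)"

text \<open>The element \<open>g\<close> is the product of the steps, so in every action of
  \<open>G\<close> that extends the partial maps, \<open>g\<close> carries \<open>\<tau>\<close> to
  \<open>\<tau>'\<close>. A letter can be used only where its partial map is defined at all three
  points.\<close>

inductive path :: "('e \<times> 'y \<times> 'y) set \<Rightarrow> (three \<Rightarrow> 'y) \<Rightarrow> 'h \<Rightarrow> (three \<Rightarrow> 'y) \<Rightarrow> bool"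
  for \<Phi> \<tau> where
  start: "\<tau> \<in> triples \<Longrightarrow> path \<Phi> \<tau> \<one>\<^bsub>G\<^esub> \<tau>"
| base: "\<lbrakk>path \<Phi> \<tau> g \<tau>'; h \<in> carrier G0\<rbrakk> \<Longrightarrow> path \<Phi> \<tau> (g \<otimes>\<^bsub>G\<^esub> \<iota> h) (tact \<tau>' h)"
| fwd: "\<lbrakk>path \<Phi> \<tau> g \<tau>'; e \<in> E; edge \<Phi> e \<tau>' \<tau>''\<rbrakk> \<Longrightarrow> path \<Phi> \<tau> (g \<otimes>\<^bsub>G\<^esub> \<gamma> e) \<tau>''"
| bwd: "\<lbrakk>path \<Phi> \<tau> g \<tau>'; e \<in> E; edge \<Phi> e \<tau>'' \<tau>'\<rbrakk> \<Longrightarrow> path \<Phi> \<tau> (g \<otimes>\<^bsub>G\<^esub> inv\<^bsub>G\<^esub> \<gamma> e) \<tau>''"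

definition conn :: "('e \<times> 'y \<times> 'y) set \<Rightarrow> (three \<Rightarrow> 'y) \<Rightarrow> (three \<Rightarrow> 'y) \<Rightarrow> bool" where
  "conn \<Phi> \<tau> \<tau>' \<longleftrightarrow> (\<exists>g. path \<Phi> \<tau> g \<tau>')"

text \<open>One partial injection for each letter; the last clause is the trace left by the
  commutation relations of \<open>G\<close>.\<close>

definition partial_maps :: "('e \<times> 'y \<times> 'y) set \<Rightarrow> bool" where
  "partial_maps \<Phi> \<longleftrightarrow> \<Phi> \<subseteq> E \<times> Y \<times> Y \<and>
     (\<forall>e x y z. (e, x, y) \<in> \<Phi> \<longrightarrow> (e, x, z) \<in> \<Phi> \<longrightarrow> y = z) \<and>
     (\<forall>e x y z. (e, y, x) \<in> \<Phi> \<longrightarrow> (e, z, x) \<in> \<Phi> \<longrightarrow> y = z) \<and>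
     (\<forall>e x y c. (e, x, y) \<in> \<Phi> \<longrightarrow> c \<in> C e \<longrightarrow> (e, act x c, act y c) \<in> \<Phi>)"

definition free_on_triples :: "('e \<times> 'y \<times> 'y) set \<Rightarrow> bool" where
  "free_on_triples \<Phi> \<longleftrightarrow> (\<forall>\<tau> g. path \<Phi> \<tau> g \<tau> \<longrightarrow> g = \<one>\<^bsub>G\<^esub>)"

text \<open>If walks are free, the element carried from \<open>\<tau>\<close> to
  \<open>\<tau> \<circ> \<sigma>\<close> is unique. The condition then says that the setwise
  stabilizer of the triple, computed with all walks, comes from \<open>G0\<close>.\<close>

definition central :: "('e \<times> 'y \<times> 'y) set \<Rightarrow> (three \<Rightarrow> 'y) \<Rightarrow> bool" where
  "central \<Phi> \<tau> \<longleftrightarrow> (\<forall>\<sigma>. bij \<sigma> \<longrightarrow> conn \<Phi> \<tau> (\<tau> \<circ> \<sigma>) \<longrightarrow> (\<exists>h\<in>carrier G0. tact \<tau> h = \<tau> \<circ> \<sigma>))"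

definition good :: "('e \<times> 'y \<times> 'y) set \<Rightarrow> bool" where
  "good \<Phi> \<longleftrightarrow> partial_maps \<Phi> \<and> free_on_triples \<Phi> \<and>
     (\<forall>\<tau>\<in>triples. \<exists>\<tau>'. conn \<Phi> \<tau> \<tau>' \<and> central \<Phi> \<tau>')"

lemma partial_mapsD:
  assumes "partial_maps \<Phi>"
  shows "(e, x, y) \<in> \<Phi> \<Longrightarrow> e \<in> E \<and> x \<in> Y \<and> y \<in> Y"
    and "\<lbrakk>(e, x, y) \<in> \<Phi>; (e, x, z) \<in> \<Phi>\<rbrakk> \<Longrightarrow> y = z"
    and "\<lbrakk>(e, y, x) \<in> \<Phi>; (e, z, x) \<in> \<Phi>\<rbrakk> \<Longrightarrow> y = z"
    and "\<lbrakk>(e, x, y) \<in> \<Phi>; c \<in> C e\<rbrakk> \<Longrightarrow> (e, act x c, act y c) \<in> \<Phi>"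
  using assms unfolding partial_maps_def by blast+

lemma triplesD: "\<tau> \<in> triples \<Longrightarrow> \<tau> i \<in> Y"
  unfolding triples_def by auto

lemma triples_perm: "\<lbrakk>\<tau> \<in> triples; bij \<sigma>\<rbrakk> \<Longrightarrow> \<tau> \<circ> \<sigma> \<in> triples"
  unfolding triples_def by (auto intro: inj_compose bij_is_inj)

lemma tact_perm: "tact (\<tau> \<circ> \<sigma>) g = tact \<tau> g \<circ> \<sigma>"
  unfolding tact_def by auto

lemma tact_closed: "\<lbrakk>\<tau> \<in> triples; g \<in> carrier G0\<rbrakk> \<Longrightarrow> tact \<tau> g \<in> triples"
  unfolding triples_def tact_def
  by (auto simp: inj_def intro: act_closed) (metis act_cancel rangeI subsetD)

lemma tact_mult: "\<lbrakk>\<tau> \<in> triples; g \<in> carrier G0; h \<in> carrier G0\<rbrakk>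
    \<Longrightarrow> tact \<tau> (g \<otimes> h) = tact (tact \<tau> g) h"
  unfolding tact_def by (auto simp: act_mult triplesD)

lemma tact_one: "\<tau> \<in> triples \<Longrightarrow> tact \<tau> \<one> = \<tau>"
  unfolding tact_def by (auto simp: act_one triplesD)

lemma tact_inv: "\<lbrakk>\<tau> \<in> triples; g \<in> carrier G0\<rbrakk> \<Longrightarrow> tact (tact \<tau> g) (inv g) = \<tau>"
  unfolding tact_def by (auto simp: triplesD)

lemma edge_triples:
  assumes "partial_maps \<Phi>" "edge \<Phi> e \<tau> \<tau>'"
  shows "\<tau> \<in> triples \<longleftrightarrow> \<tau>' \<in> triples"
  using assms(2) partial_mapsD(1-3)[OF assms(1)] unfolding edge_def triples_def inj_def
  by (auto; metis)

lemma edge_perm: "edge \<Phi> e \<tau> \<tau>' \<Longrightarrow> edge \<Phi> e (\<tau> \<circ> \<sigma>) (\<tau>' \<circ> \<sigma>)"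
  unfolding edge_def by auto

lemma edge_tact:
  "\<lbrakk>partial_maps \<Phi>; edge \<Phi> e \<tau> \<tau>'; c \<in> C e\<rbrakk> \<Longrightarrow> edge \<Phi> e (tact \<tau> c) (tact \<tau>' c)"
  unfolding edge_def tact_def using partial_mapsD(4) by blast

lemma edge_inject: "\<lbrakk>partial_maps \<Phi>; edge \<Phi> e \<tau> \<upsilon>; edge \<Phi> e \<tau>' \<upsilon>\<rbrakk> \<Longrightarrow> \<tau> = \<tau>'"
  unfolding edge_def using partial_mapsD(3) by (metis ext)

lemma path_triples:
  assumes "path \<Phi> \<tau> g \<tau>'" "partial_maps \<Phi>"
  shows "\<tau> \<in> triples" "g \<in> carrier G" "\<tau>' \<in> triples"
  using assms
  by (induction rule: path.induct) (auto simp: tact_closed edge_triples)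

text \<open>Walks grow at their end, so the induction runs over the second walk, which for this
  reason is the first premise.\<close>

lemma path_trans:
  assumes "path \<Phi> \<tau>' g' \<tau>''" "path \<Phi> \<tau> g \<tau>'" "partial_maps \<Phi>"
  shows "path \<Phi> \<tau> (g \<otimes>\<^bsub>G\<^esub> g') \<tau>''"
  using assms
proof (induction rule: path.induct)
  case start
  then show ?case using path_triples(2)[OF start(2,3)] by simp
next
  case (base g' \<upsilon> h)
  then have "g \<in> carrier G" "g' \<in> carrier G" using path_triples(2) by blast+
  then show ?case
    using path.base[OF base.IH[OF base.prems] base.hyps(2)] base.hyps by (simp add: G.m_assoc)
next
  case (fwd g' \<upsilon> e)
  then have "g \<in> carrier G" "g' \<in> carrier G" using path_triples(2) by blast+
  then show ?case
    using path.fwd[OF fwd.IH[OF fwd.prems] fwd.hyps(2,3)] fwd.hyps by (simp add: G.m_assoc)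
next
  case (bwd g' \<upsilon> e)
  then have "g \<in> carrier G" "g' \<in> carrier G" using path_triples(2) by blast+
  then show ?case
    using path.bwd[OF bwd.IH[OF bwd.prems] bwd.hyps(2,3)] bwd.hyps by (simp add: G.m_assoc)
qed

lemma path_base: "\<lbrakk>\<tau> \<in> triples; h \<in> carrier G0\<rbrakk> \<Longrightarrow> path \<Phi> \<tau> (\<iota> h) (tact \<tau> h)"
  using path.base[OF path.start, of \<tau> h \<Phi>] by simp

lemma path_fwd: "\<lbrakk>\<tau> \<in> triples; e \<in> E; edge \<Phi> e \<tau> \<tau>'\<rbrakk> \<Longrightarrow> path \<Phi> \<tau> (\<gamma> e) \<tau>'"
  using path.fwd[OF path.start, of \<tau> e \<Phi>] by simp

lemma path_bwd: "\<lbrakk>\<tau> \<in> triples; e \<in> E; edge \<Phi> e \<tau>' \<tau>\<rbrakk> \<Longrightarrow> path \<Phi> \<tau> (inv\<^bsub>G\<^esub> \<gamma> e) \<tau>'"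
  using path.bwd[OF path.start, of \<tau> e \<Phi>] by simp

lemma path_sym:
  assumes "path \<Phi> \<tau> g \<tau>'" "partial_maps \<Phi>"
  shows "path \<Phi> \<tau>' (inv\<^bsub>G\<^esub> g) \<tau>"
  using assms
proof (induction rule: path.induct)
  case start
  then show ?case by (simp add: path.start)
next
  case (base g \<tau>' h)
  have t: "\<tau>' \<in> triples" "g \<in> carrier G" using path_triples base by blast+
  have "path \<Phi> (tact \<tau>' h) (\<iota> (inv h)) \<tau>'"
    using path_base[OF tact_closed inv_closed, of \<tau>' h h \<Phi>] t base(2) by (simp add: tact_inv)
  from path_trans[OF base.IH[OF base.prems] this base.prems] show ?case
    using base(2) t by (simp add: \<iota>_inv G.inv_mult_group)
next
  case (fwd g \<tau>' e \<tau>'')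
  have t: "\<tau>' \<in> triples" "g \<in> carrier G" using path_triples fwd by blast+
  then have t': "\<tau>'' \<in> triples" using edge_triples fwd by blast
  have "path \<Phi> \<tau>'' (inv\<^bsub>G\<^esub> \<gamma> e) \<tau>'" using path_bwd fwd t' by blast
  from path_trans[OF fwd.IH[OF fwd.prems] this fwd.prems] show ?case
    using fwd(2) t by (simp add: G.inv_mult_group)
next
  case (bwd g \<tau>' e \<tau>'')
  have t: "\<tau>' \<in> triples" "g \<in> carrier G" using path_triples bwd by blast+
  then have t': "\<tau>'' \<in> triples" using edge_triples bwd by blast
  have "path \<Phi> \<tau>'' (\<gamma> e) \<tau>'" using path_fwd bwd t' by blast
  from path_trans[OF bwd.IH[OF bwd.prems] this bwd.prems] show ?case
    using bwd(2) t by (simp add: G.inv_mult_group)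
qed

text \<open>Steps act on each coordinate separately, so a rearranged triple can follow the same walk
  with the same group element.\<close>

lemma path_perm: "path \<Phi> \<tau> g \<tau>' \<Longrightarrow> bij \<sigma> \<Longrightarrow> path \<Phi> (\<tau> \<circ> \<sigma>) g (\<tau>' \<circ> \<sigma>)"
proof (induction rule: path.induct)
  case start
  then show ?case using path.start triples_perm by blast
next
  case (base g \<tau>' h)
  show ?case using path.base[OF base.IH[OF base.prems] base.hyps(2)] unfolding tact_perm .
next
  case (fwd g \<tau>' e \<tau>'')
  show ?case using path.fwd[OF fwd.IH[OF fwd.prems] fwd.hyps(2) edge_perm[OF fwd.hyps(3)]] .
next
  case (bwd g \<tau>' e \<tau>'')
  show ?case using path.bwd[OF bwd.IH[OF bwd.prems] bwd.hyps(2) edge_perm[OF bwd.hyps(3)]] .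
qed

lemma path_mono: "path \<Phi> \<tau> g \<tau>' \<Longrightarrow> \<Phi> \<subseteq> \<Psi> \<Longrightarrow> path \<Psi> \<tau> g \<tau>'"
proof (induction rule: path.induct)
  case (fwd g \<tau>' e \<tau>'')
  then show ?case using path.fwd[of \<Psi> \<tau> g \<tau>' e \<tau>''] unfolding edge_def by blast
next
  case (bwd g \<tau>' e \<tau>'')
  then show ?case using path.bwd[of \<Psi> \<tau> g \<tau>' e \<tau>''] unfolding edge_def by blast
qed (auto intro: path.intros)

lemma conn_trans: "\<lbrakk>conn \<Phi> \<tau> \<tau>'; conn \<Phi> \<tau>' \<tau>''; partial_maps \<Phi>\<rbrakk> \<Longrightarrow> conn \<Phi> \<tau> \<tau>''"
  unfolding conn_def using path_trans by blast

lemma conn_sym: "\<lbrakk>conn \<Phi> \<tau> \<tau>'; partial_maps \<Phi>\<rbrakk> \<Longrightarrow> conn \<Phi> \<tau>' \<tau>"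
  unfolding conn_def using path_sym by blast

lemma conn_perm: "\<lbrakk>conn \<Phi> \<tau> \<tau>'; bij \<sigma>\<rbrakk> \<Longrightarrow> conn \<Phi> (\<tau> \<circ> \<sigma>) (\<tau>' \<circ> \<sigma>)"
  unfolding conn_def using path_perm by blast

lemma conn_mono: "\<lbrakk>conn \<Phi> \<tau> \<tau>'; \<Phi> \<subseteq> \<Psi>\<rbrakk> \<Longrightarrow> conn \<Psi> \<tau> \<tau>'"
  unfolding conn_def using path_mono by blast

lemma conn_refl: "\<tau> \<in> triples \<Longrightarrow> conn \<Phi> \<tau> \<tau>"
  unfolding conn_def using path.start by blast

lemma conn_tact: "\<lbrakk>\<tau> \<in> triples; h \<in> carrier G0\<rbrakk> \<Longrightarrow> conn \<Phi> \<tau> (tact \<tau> h)"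
  unfolding conn_def using path_base by blast

lemma conn_triples:
  assumes "conn \<Phi> \<tau> \<tau>'" "partial_maps \<Phi>"
  shows "\<tau> \<in> triples" "\<tau>' \<in> triples"
  using assms path_triples unfolding conn_def by blast+

lemma path_unique:
  assumes "partial_maps \<Phi>" "free_on_triples \<Phi>" "path \<Phi> \<tau> g \<tau>'" "path \<Phi> \<tau> g' \<tau>'"
  shows "g = g'"
proof -
  have "path \<Phi> \<tau> (g \<otimes>\<^bsub>G\<^esub> inv\<^bsub>G\<^esub> g') \<tau>"
    by (rule path_trans[OF path_sym[OF assms(4,1)] assms(3,1)])
  then have "g \<otimes>\<^bsub>G\<^esub> inv\<^bsub>G\<^esub> g' = \<one>\<^bsub>G\<^esub>" using assms(2) unfolding free_on_triples_def by blast
  then show ?thesis using assms path_triples(2) by (metis G.inv_equality G.inv_inv G.inv_closed)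
qed

text \<open>Loops at connected triples are conjugate, so freeness has to be checked at one triple of
  each class only.\<close>

lemma loop_transport:
  assumes "partial_maps \<Phi>" "path \<Phi> \<tau> g \<tau>" "conn \<Phi> \<tau>0 \<tau>"
    and "\<And>g. path \<Phi> \<tau>0 g \<tau>0 \<Longrightarrow> g = \<one>\<^bsub>G\<^esub>"
  shows "g = \<one>\<^bsub>G\<^esub>"
proof -
  obtain k where k: "path \<Phi> \<tau>0 k \<tau>" using assms unfolding conn_def by blast
  have c: "k \<in> carrier G" "g \<in> carrier G" using k assms path_triples by blast+
  have "path \<Phi> \<tau>0 (k \<otimes>\<^bsub>G\<^esub> g \<otimes>\<^bsub>G\<^esub> inv\<^bsub>G\<^esub> k) \<tau>0"
    by (rule path_trans[OF path_sym[OF k assms(1)] path_trans[OF assms(2) k assms(1)] assms(1)])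
  then have "k \<otimes>\<^bsub>G\<^esub> g \<otimes>\<^bsub>G\<^esub> inv\<^bsub>G\<^esub> k = \<one>\<^bsub>G\<^esub>" using assms by blast
  then have "k \<otimes>\<^bsub>G\<^esub> g = k" using c by (metis G.inv_equality G.inv_inv G.inv_closed G.m_closed)
  then show ?thesis using c by simp
qed

text \<open>Defining \<open>e\<close> at \<open>x\<close> forces its values on the whole orbit of
  \<open>x\<close> under \<open>C e\<close>; freeness of this orbit makes the values well defined,
  and regularity of the orbit of \<open>b\<close> makes them distinct. Since nothing else touches
  the orbit of \<open>b\<close>, a walk that enters it must leave it backwards along
  \<open>e\<close>. In between it can only have applied an element of \<open>C e\<close>, which
  commutes with \<open>\<gamma> e\<close>, so the excursion can be cut out.\<close>

lemma good_pendant: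
  assumes good: "good \<Phi>" and e: "e \<in> E" and x: "x \<in> Y" and b: "b \<in> Y"
    and new: "\<And>y. (e, x, y) \<notin> \<Phi>"
    and x_free: "\<And>c. c \<in> C e \<Longrightarrow> act x c = x \<Longrightarrow> c = \<one>"
    and b_free: "\<And>g. g \<in> carrier G0 \<Longrightarrow> act b g = b \<Longrightarrow> g = \<one>"
    and untouched: "\<And>g e' y. g \<in> carrier G0 \<Longrightarrow> (e', act b g, y) \<notin> \<Phi> \<and> (e', y, act b g) \<notin> \<Phi>"
    and xb: "\<And>g. g \<in> carrier G0 \<Longrightarrow> act b g \<noteq> x"
  defines "\<Psi> \<equiv> \<Phi> \<union> {(e, act x c, act b c) | c. c \<in> C e}"
  shows "good \<Psi>"
proof -
  let ?N = "(\<lambda>g. act b g) ` carrier G0"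
  have pm: "partial_maps \<Phi>" and free: "free_on_triples \<Phi>" using good unfolding good_def by auto
  have Cc: "c \<in> carrier G0" if "c \<in> C e" for c using C_closed e that by blast
  have Cinv: "inv c \<in> C e" if "c \<in> C e" for c by (rule subgroup.m_inv_closed[OF C_subgroup[OF e] that])
  have Cmult: "c \<otimes> d \<in> C e" if "c \<in> C e" "d \<in> C e" for c d
    by (rule subgroup.m_closed[OF C_subgroup[OF e] that])
  have b_eq: "g = h" if "g \<in> carrier G0" "h \<in> carrier G0" "act b g = act b h" for g h
  proof -
    have "act b (g \<otimes> inv h) = b" using that b by (simp add: act_mult)
    then have "g \<otimes> inv h = \<one>" using b_free that by simp
    then show ?thesis using that by (metis inv_equality inv_inv inv_closed)
  qed
  have x_eq: "g = h" if "g \<in> C e" "h \<in> C e" "act x g = act x h" for g h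
  proof -
    have "act x (g \<otimes> inv h) = x" using that x Cc by (simp add: act_mult)
    then have "g \<otimes> inv h = \<one>" using x_free that Cmult Cinv by simp
    then show ?thesis using that Cc by (metis inv_equality inv_inv inv_closed)
  qed
  have new': "(e, act x c, y) \<notin> \<Phi>" if "c \<in> C e" for c y
  proof
    assume "(e, act x c, y) \<in> \<Phi>"
    then have "(e, act (act x c) (inv c), act y (inv c)) \<in> \<Phi>" 
      using partial_mapsD(4)[OF pm] Cinv that by blast
    then show False using new Cc x that by simp
  qed
  have xN: "act x c \<notin> ?N" if "c \<in> C e" for c
  proof
    assume "act x c \<in> ?N"
    then obtain g where g: "g \<in> carrier G0" "act x c = act b g" by auto
    then have "act b (g \<otimes> inv c) = x" using x b Cc that by (simp add: act_mult flip: g(2))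
    then show False using xb g that Cc by simp
  qed
  have old: "z \<notin> ?N \<and> y \<notin> ?N" if "(e', z, y) \<in> \<Phi>" for e' z y
    using that untouched by blast
  have \<Psi>_cases: "(e', z, y) \<in> \<Phi> \<or> e' = e \<and> (\<exists>c\<in>C e. z = act x c \<and> y = act b c)"
    if "(e', z, y) \<in> \<Psi>" for e' z y
    using that unfolding \<Psi>_def by blast
  have dom: "z \<notin> ?N" if "(e', z, y) \<in> \<Psi>" for e' z y
    using \<Psi>_cases[OF that] old[of e' z y] xN by metis
  have img: "(e', z, y) \<in> \<Phi>" if "(e', z, y) \<in> \<Psi>" "y \<notin> ?N" for e' z y
    using \<Psi>_cases[OF that(1)] that(2) Cc by blast
  have imgN: "e' = e \<and> (\<exists>c\<in>C e. z = act x c \<and> y = act b c)" if "(e', z, y) \<in> \<Psi>" "y \<in> ?N" for e' z y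
    using \<Psi>_cases[OF that(1)] that(2) old[of e' z y] by blast
  have pm': "partial_maps \<Psi>"
    unfolding partial_maps_def
  proof (intro conjI allI impI)
    show "\<Psi> \<subseteq> E \<times> Y \<times> Y"
      using partial_mapsD(1)[OF pm] Cc e x b act_closed unfolding \<Psi>_def by auto
  next
    fix e' z y y' assume "(e', z, y) \<in> \<Psi>" "(e', z, y') \<in> \<Psi>"
    then show "y = y'"
      by (metis partial_mapsD(2)[OF pm] new' x_eq \<Psi>_cases)
  next
    fix e' z y y' assume a: "(e', y, z) \<in> \<Psi>" "(e', y', z) \<in> \<Psi>"
    show "y = y'"
    proof (cases "z \<in> ?N")
      case True
      then show ?thesis using imgN a b_eq Cc by metis
    next
      case False
      then show ?thesis using img a partial_mapsD(3)[OF pm] by metis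
    qed
  next
    fix e' z y c assume a: "(e', z, y) \<in> \<Psi>" "c \<in> C e'"
    show "(e', act z c, act y c) \<in> \<Psi>"
    proof (cases "(e', z, y) \<in> \<Phi>")
      case True
      then show ?thesis using a partial_mapsD(4)[OF pm] unfolding \<Psi>_def by blast
    next
      case False
      then obtain d where d: "e' = e" "d \<in> C e" "z = act x d" "y = act b d"
        using a unfolding \<Psi>_def by auto
      then have "act z c = act x (d \<otimes> c)" "act y c = act b (d \<otimes> c)"
        using a x b Cc by (auto simp: act_mult)
      then show ?thesis using Cmult a d unfolding \<Psi>_def by blast
    qed
  qed
  have NI: "act y h \<in> ?N" if "y \<in> ?N" "h \<in> carrier G0" for y h
    using that b by (auto simp flip: act_mult)
  define clean where "clean \<tau> \<longleftrightarrow> range \<tau> \<inter> ?N = {}" for \<tau> :: "three \<Rightarrow> 'y"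
  have clean_tact: "clean (tact \<tau> h) \<longleftrightarrow> clean \<tau>" if "\<tau> \<in> triples" "h \<in> carrier G0" for \<tau> h
  proof -
    have "act (\<tau> i) h \<in> ?N \<longleftrightarrow> \<tau> i \<in> ?N" for i
      using NI[OF _ inv_closed[OF that(2)], of "act (\<tau> i) h"] NI[OF _ that(2), of "\<tau> i"]
        act_inv(1)[OF triplesD[OF that(1)] that(2)] by auto
    then show ?thesis unfolding clean_def tact_def by blast
  qed
  \<comment> \<open>No point of \<open>?N\<close> is a source, so a triple that meets
    \<open>?N\<close> can be left only through \<open>G0\<close> or backwards along a letter, which
    by \<open>img_dirty\<close> is \<open>e\<close>.\<close>
  have dom_clean: "clean \<tau>" if "edge \<Psi> e' \<tau> \<tau>'" for e' \<tau> \<tau>'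
    using that dom unfolding clean_def edge_def by blast
  have img_clean: "edge \<Phi> e' \<tau> \<tau>'" if "edge \<Psi> e' \<tau> \<tau>'" "clean \<tau>'" for e' \<tau> \<tau>'
    using img that unfolding clean_def edge_def by (metis disjoint_iff rangeI)
  have img_dirty: "e' = e" if ed: "edge \<Psi> e' \<tau> \<tau>'" and nc: "\<not> clean \<tau>'" for e' \<tau> \<tau>'
  proof -
    obtain i where "\<tau>' i \<in> ?N" using nc unfolding clean_def by auto
    then show ?thesis using imgN ed unfolding edge_def by blast
  qed
  \<comment> \<open>A walk that is inside the dead end: an old walk to \<open>\<tau>0\<close>, one
    crossing of \<open>e\<close> to \<open>\<tau>1\<close>, and then a single element
    \<open>h\<close> of \<open>G0\<close>.\<close>
  define pend where "pend \<tau> g \<tau>' \<longleftrightarrow> (\<exists>g0 \<tau>0 \<tau>1 h. path \<Phi> \<tau> g0 \<tau>0 \<and> edge \<Psi> e \<tau>0 \<tau>1 \<and> \<not> clean \<tau>1 \<and>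
      h \<in> carrier G0 \<and> \<tau>' = tact \<tau>1 h \<and> g = g0 \<otimes>\<^bsub>G\<^esub> \<gamma> e \<otimes>\<^bsub>G\<^esub> \<iota> h)" for \<tau> g \<tau>'
  \<comment> \<open>Hence between clean triples the enlarged system carries no element that old
    walks did not carry.\<close>
  have conserv: "(clean \<tau>' \<and> path \<Phi> \<tau> g \<tau>') \<or> (\<not> clean \<tau>' \<and> pend \<tau> g \<tau>')"
    if "path \<Psi> \<tau> g \<tau>'" "clean \<tau>" for \<tau> g \<tau>'
    using that
  proof (induction rule: path.induct)
    case start
    then show ?case by (simp add: path.start)
  next
    case (base g \<tau>' h)
    have t: "\<tau>' \<in> triples" using base path_triples pm' by blast
    show ?case
    proof (cases "clean \<tau>'")
      case True
      then show ?thesis using base t clean_tact path.base by simp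
    next
      case False
      then have "pend \<tau> g \<tau>'" using base by blast
      then obtain g0 \<tau>0 \<tau>1 k where q: "path \<Phi> \<tau> g0 \<tau>0" "edge \<Psi> e \<tau>0 \<tau>1" "\<not> clean \<tau>1"
         "k \<in> carrier G0" "\<tau>' = tact \<tau>1 k" "g = g0 \<otimes>\<^bsub>G\<^esub> \<gamma> e \<otimes>\<^bsub>G\<^esub> \<iota> k"
        unfolding pend_def by blast
      have "\<tau>1 \<in> triples" "g0 \<in> carrier G"
        using q edge_triples[OF pm'] path_triples pm by blast+
      then have "tact \<tau>' h = tact \<tau>1 (k \<otimes> h)" "g \<otimes>\<^bsub>G\<^esub> \<iota> h = g0 \<otimes>\<^bsub>G\<^esub> \<gamma> e \<otimes>\<^bsub>G\<^esub> \<iota> (k \<otimes> h)"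
        using q base e by (auto simp: tact_mult \<iota>_mult G.m_assoc)
      then have "pend \<tau> (g \<otimes>\<^bsub>G\<^esub> \<iota> h) (tact \<tau>' h)"
        unfolding pend_def using q base by (metis m_closed)
      then show ?thesis using False clean_tact t base by simp
    qed
  next
    case (fwd g \<tau>' e' \<tau>'')
    have cl: "clean \<tau>'" and p: "path \<Phi> \<tau> g \<tau>'" using dom_clean fwd by blast+
    have g: "g \<in> carrier G" and t'': "\<tau>'' \<in> triples"
      using p path_triples pm fwd edge_triples[OF pm'] by blast+
    show ?case
    proof (cases "clean \<tau>''")
      case True
      then show ?thesis using img_clean fwd p path.fwd by blast
    next
      case False
      then have "e' = e" using img_dirty fwd by blast
      then have "pend \<tau> (g \<otimes>\<^bsub>G\<^esub> \<gamma> e') \<tau>''"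
        unfolding pend_def using fwd p False g e tact_one[OF t'']
        by (intro exI[of _ g] exI[of _ \<tau>'] exI[of _ \<tau>''] exI[of _ \<one>]) auto
      then show ?thesis using False by blast
    qed
  next
    case (bwd g \<tau>' e' \<tau>'')
    have cl: "clean \<tau>''" using dom_clean bwd by blast
    show ?case
    proof (cases "clean \<tau>'")
      case True
      then show ?thesis using img_clean bwd cl path.bwd by blast
    next
      case False
      then have e': "e' = e" and "pend \<tau> g \<tau>'" using img_dirty bwd by blast+
      then obtain g0 \<tau>0 \<tau>1 h where q: "path \<Phi> \<tau> g0 \<tau>0" "edge \<Psi> e \<tau>0 \<tau>1" "\<not> clean \<tau>1"
         "h \<in> carrier G0" "\<tau>' = tact \<tau>1 h" "g = g0 \<otimes>\<^bsub>G\<^esub> \<gamma> e \<otimes>\<^bsub>G\<^esub> \<iota> h"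
        unfolding pend_def by blast
      \<comment> \<open>Some coordinate entered the orbit at \<open>act b c\<close> and is about to
        leave it at \<open>act b d\<close>. Regularity gives \<open>c \<otimes> h = d\<close>, so
        \<open>h\<close> lies in \<open>C e\<close>, and the two crossings of \<open>e\<close>
        cancel.\<close>
      obtain i where i: "\<tau>1 i \<in> ?N" using q unfolding clean_def by blast
      then obtain c where c: "c \<in> C e" "\<tau>1 i = act b c"
        using imgN q unfolding edge_def by blast
      have "\<tau>' i = act b (c \<otimes> h)" using q c b Cc by (simp add: tact_def act_mult)
      moreover have "\<tau>' i \<in> ?N" using calculation c Cc q by auto
      then obtain d where d: "d \<in> C e" "\<tau>' i = act b d"
        using imgN bwd e' unfolding edge_def by blast
      ultimately have "c \<otimes> h = d" using b_eq c d Cc q by simp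
      then have "h = inv c \<otimes> d" using c d Cc q by (metis inv_solve_left)
      then have h: "h \<in> C e" using Cmult Cinv c d by simp
      have "edge \<Psi> e (tact \<tau>0 h) \<tau>'" using edge_tact[OF pm'] q h by blast
      then have t: "\<tau>'' = tact \<tau>0 h" using edge_inject[OF pm'] bwd e' by blast
      have g0: "g0 \<in> carrier G" using q pm path_triples by blast
      have "g = g0 \<otimes>\<^bsub>G\<^esub> (\<iota> h \<otimes>\<^bsub>G\<^esub> \<gamma> e)" using q \<gamma>_comm[OF e h] e g0 by (simp add: G.m_assoc)
      then have "g \<otimes>\<^bsub>G\<^esub> inv\<^bsub>G\<^esub> \<gamma> e = g0 \<otimes>\<^bsub>G\<^esub> \<iota> h" using e g0 q by (simp add: G.m_assoc)
      then show ?thesis using path.base[OF q(1,4)] cl e' t by simp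
    qed
  qed
  have to_clean: "\<exists>\<tau>0. clean \<tau>0 \<and> conn \<Psi> \<tau>0 \<tau>" 
    if "\<tau> \<in> triples" "clean \<tau> \<or> (\<exists>\<tau>' g. path \<Psi> \<tau> g \<tau>' \<and> (clean \<tau>' ))" for \<tau>
    using that conn_refl conn_sym[OF _ pm'] unfolding conn_def by blast
  \<comment> \<open>Every step by a letter has a clean triple at its source, so in a class without
    clean triples only \<open>G0\<close> acts.\<close>
  have isolated: "\<exists>h\<in>carrier G0. \<tau>' = tact \<tau> h \<and> g = \<iota> h" 
    if "path \<Psi> \<tau> g \<tau>'" "\<And>\<tau>' g. path \<Psi> \<tau> g \<tau>' \<Longrightarrow> \<not> clean \<tau>'" for \<tau> g \<tau>'
    using that
  proof (induction rule: path.induct)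
    case start
    then show ?case by (intro bexI[of _ \<one>]) (auto simp: tact_one)
  next
    case (base g \<tau>' h)
    then obtain k where k: "k \<in> carrier G0" "\<tau>' = tact \<tau> k" "g = \<iota> k" by blast
    then have "tact \<tau>' h = tact \<tau> (k \<otimes> h)" "g \<otimes>\<^bsub>G\<^esub> \<iota> h = \<iota> (k \<otimes> h)"
      using base path_triples[OF base(1) pm'] by (auto simp: tact_mult \<iota>_mult)
    then show ?case using k base by blast
  next
    case (fwd g \<tau>' e' \<tau>'')
    then show ?case using dom_clean by blast
  next
    case (bwd g \<tau>' e' \<tau>'')
    then have "path \<Psi> \<tau> (g \<otimes>\<^bsub>G\<^esub> inv\<^bsub>G\<^esub> \<gamma> e') \<tau>''" using path.bwd by blast
    then show ?case using dom_clean bwd by blast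
  qed
  have free': "free_on_triples \<Psi>"
    unfolding free_on_triples_def
  proof (intro allI impI)
    fix \<tau> g assume p: "path \<Psi> \<tau> g \<tau>"
    show "g = \<one>\<^bsub>G\<^esub>"
    proof (cases "\<exists>\<tau>' g. path \<Psi> \<tau> g \<tau>' \<and> clean \<tau>'")
      case True
      then obtain \<tau>0 where t: "clean \<tau>0" "conn \<Psi> \<tau>0 \<tau>" using to_clean path_triples[OF p pm'] by blast
      show ?thesis
        using loop_transport[OF pm' p t(2)] conserv[OF _ t(1)] t(1) free
        unfolding free_on_triples_def by blast
    next
      case False
      \<comment> \<open>The loop consists of an element of \<open>G0\<close> that fixes the triple,
        hence it was a loop already in the old system.\<close>
      then obtain h where h: "h \<in> carrier G0" "\<tau> = tact \<tau> h" "g = \<iota> h" using isolated p by blast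
      then have "path \<Phi> \<tau> (\<iota> h) \<tau>" using path_base[of \<tau> h \<Phi>] path_triples[OF p pm'] by simp
      then show ?thesis using free h unfolding free_on_triples_def by blast
    qed
  qed
  have "\<exists>\<tau>'. conn \<Psi> \<tau> \<tau>' \<and> central \<Psi> \<tau>'" if t: "\<tau> \<in> triples" for \<tau>
  proof (cases "\<exists>\<tau>' g. path \<Psi> \<tau> g \<tau>' \<and> clean \<tau>'")
    case True
    then obtain \<tau>0 where t0: "clean \<tau>0" "conn \<Psi> \<tau> \<tau>0" unfolding conn_def by blast
    then obtain \<tau>' where t': "conn \<Phi> \<tau>0 \<tau>'" "central \<Phi> \<tau>'"
      using good conn_triples[OF _ pm'] unfolding good_def by blast
    have sub: "\<Phi> \<subseteq> \<Psi>" unfolding \<Psi>_def by blast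
    have c1: "conn \<Psi> \<tau>0 \<tau>'" using conn_mono[OF t'(1) sub] .
    \<comment> \<open>Old edges avoid \<open>?N\<close> and \<open>G0\<close> preserves it, so old
      walks from a clean triple stay clean. The old central triple and its rearrangements are
      therefore subject to \<open>conserv\<close>.\<close>
    have "clean \<tau>'"
    proof -
      have "\<exists>g. path \<Phi> \<tau>0 g \<tau>'" using t' unfolding conn_def by blast
      then obtain g where "path \<Phi> \<tau>0 g \<tau>'" by blast
      then show ?thesis using t0(1)
      proof (induction rule: path.induct)
        case (base g \<tau>' h)
        then show ?case using clean_tact path_triples[OF base(1) pm] by blast
      next
        case (fwd g \<tau>' e' \<tau>'')
        have "\<tau>'' i \<notin> ?N" for i using old fwd.hyps(3) unfolding edge_def by blast
        then show ?case unfolding clean_def by auto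
      next
        case (bwd g \<tau>' e' \<tau>'')
        have "\<tau>'' i \<notin> ?N" for i using old bwd.hyps(3) unfolding edge_def by blast
        then show ?case unfolding clean_def by auto
      qed
    qed
    then have "central \<Psi> \<tau>'"
      using t'(2) conserv[of \<tau>'] unfolding central_def conn_def clean_def
      by (metis (no_types, lifting) bij_is_surj image_comp)
    then show ?thesis using conn_trans[OF t0(2) c1 pm'] by blast
  next
    case False
    then have "central \<Psi> \<tau>" using isolated unfolding central_def conn_def by metis
    then show ?thesis using conn_refl t by blast
  qed
  then show ?thesis using pm' free' unfolding good_def by blast
qed

text \<open>Reversing all partial maps while replacing each letter by its inverse in
  \<open>G\<close> leaves the walks unchanged. By this symmetry, adding a preimage reduces to adding
  an image.\<close>

definition flip :: "('e \<times> 'y \<times> 'y) set \<Rightarrow> ('e \<times> 'y \<times> 'y) set" where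
  "flip \<Phi> = (\<lambda>(e, x, y). (e, y, x)) ` \<Phi>"

lemma in_flip [simp]: "(e, x, y) \<in> flip \<Phi> \<longleftrightarrow> (e, y, x) \<in> \<Phi>"
  unfolding flip_def by force

lemma partial_extension_flip: "partial_extension G0 Y act G \<iota> (\<lambda>e. inv\<^bsub>G\<^esub> \<gamma> e) E C"
proof (intro partial_extension.intro partial_extension_axioms.intro)
  fix e c assume e: "e \<in> E" "c \<in> C e"
  then have "\<iota> c \<in> carrier G" "\<gamma> e \<in> carrier G" using C_closed by auto
  then show "\<iota> c \<otimes>\<^bsub>G\<^esub> inv\<^bsub>G\<^esub> \<gamma> e = inv\<^bsub>G\<^esub> \<gamma> e \<otimes>\<^bsub>G\<^esub> \<iota> c"
    using \<gamma>_comm[OF e] by (metis G.inv_closed G.inv_solve_left G.inv_solve_right G.m_assoc G.m_closed)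
qed (auto intro: right_action_axioms G.is_group \<iota>_hom C_subgroup)

interpretation flip: partial_extension G0 Y act G \<iota> "\<lambda>e. inv\<^bsub>G\<^esub> \<gamma> e" E C
  by (rule partial_extension_flip)

lemma flip_flip: "flip (flip \<Phi>) = \<Phi>"
  unfolding flip_def by force

lemma edge_flip: "edge (flip \<Phi>) e \<tau> \<tau>' \<longleftrightarrow> edge \<Phi> e \<tau>' \<tau>"
  unfolding edge_def by simp

lemma path_flip1: "path \<Phi> \<tau> g \<tau>' \<Longrightarrow> flip.path (flip \<Phi>) \<tau> g \<tau>'"
proof (induction rule: path.induct)
  case (fwd g \<tau>' e \<tau>'')
  then show ?case using flip.path.bwd[OF fwd.IH fwd.hyps(2), of \<tau>''] by (simp add: edge_flip)
next
  case (bwd g \<tau>' e \<tau>'')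
  then show ?case using flip.path.fwd[OF bwd.IH bwd.hyps(2), of \<tau>''] by (simp add: edge_flip)
qed (rule flip.path.start flip.path.base; assumption)+

lemma path_flip2: "flip.path \<Phi> \<tau> g \<tau>' \<Longrightarrow> path (flip \<Phi>) \<tau> g \<tau>'"
proof (induction rule: flip.path.induct)
  case (fwd g \<tau>' e \<tau>'')
  then show ?case using path.bwd[OF fwd.IH fwd.hyps(2), of \<tau>''] by (simp add: edge_flip)
next
  case (bwd g \<tau>' e \<tau>'')
  then show ?case using path.fwd[OF bwd.IH bwd.hyps(2), of \<tau>''] by (simp add: edge_flip)
qed (rule path.start path.base; assumption)+

lemma path_flip: "flip.path (flip \<Phi>) \<tau> g \<tau>' \<longleftrightarrow> path \<Phi> \<tau> g \<tau>'"
  using path_flip1[of \<Phi>] path_flip2[of "flip \<Phi>"] flip_flip by auto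

lemma partial_maps_flip: "partial_maps (flip \<Phi>) \<longleftrightarrow> partial_maps \<Phi>"
proof -
  have 1: "partial_maps (flip \<Phi>)" if pm: "partial_maps \<Phi>" for \<Phi>
    unfolding partial_maps_def
  proof (intro conjI allI impI)
    show "flip \<Phi> \<subseteq> E \<times> Y \<times> Y" using partial_mapsD(1)[OF pm] by (auto simp: flip_def)
  next
    fix e x y z assume "(e, x, y) \<in> flip \<Phi>" "(e, x, z) \<in> flip \<Phi>"
    then show "y = z" unfolding in_flip by (rule partial_mapsD(3)[OF pm])
  next
    fix e x y z assume "(e, y, x) \<in> flip \<Phi>" "(e, z, x) \<in> flip \<Phi>"
    then show "y = z" unfolding in_flip by (rule partial_mapsD(2)[OF pm])
  next
    fix e x y c assume "(e, x, y) \<in> flip \<Phi>" "c \<in> C e"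
    then show "(e, act x c, act y c) \<in> flip \<Phi>" unfolding in_flip by (rule partial_mapsD(4)[OF pm])
  qed
  show ?thesis using 1[of \<Phi>] 1[of "flip \<Phi>"] unfolding flip_flip by blast
qed

lemma good_flip: "flip.good (flip \<Phi>) \<longleftrightarrow> good \<Phi>"
  unfolding good_def flip.good_def free_on_triples_def flip.free_on_triples_def
    conn_def flip.conn_def central_def flip.central_def path_flip partial_maps_flip ..

lemma good_pendant_backward:
  assumes good: "good \<Phi>" and e: "e \<in> E" and x: "x \<in> Y" and b: "b \<in> Y"
    and new: "\<And>y. (e, y, x) \<notin> \<Phi>"
    and x_free: "\<And>c. c \<in> C e \<Longrightarrow> act x c = x \<Longrightarrow> c = \<one>"
    and b_free: "\<And>g. g \<in> carrier G0 \<Longrightarrow> act b g = b \<Longrightarrow> g = \<one>"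
    and untouched: "\<And>g e' y. g \<in> carrier G0 \<Longrightarrow> (e', act b g, y) \<notin> \<Phi> \<and> (e', y, act b g) \<notin> \<Phi>"
    and xb: "\<And>g. g \<in> carrier G0 \<Longrightarrow> act b g \<noteq> x"
  shows "good (\<Phi> \<union> {(e, act b c, act x c) | c. c \<in> C e})"
proof -
  have "flip.good (flip \<Phi> \<union> {(e, act x c, act b c) | c. c \<in> C e})"
    using assms by (intro flip.good_pendant) (auto simp: good_flip)
  also have "flip \<Phi> \<union> {(e, act x c, act b c) | c. c \<in> C e} =
      flip (\<Phi> \<union> {(e, act b c, act x c) | c. c \<in> C e})"
    unfolding flip_def by force
  finally show ?thesis by (simp add: good_flip)
qed

end

section \<open>Joining two classes of triples, and unions of chains\<close>

context partial_extension
begin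

text \<open>The letter \<open>e\<close> becomes a bridge between two separate classes, with one edge
  from \<open>A \<circ> \<sigma>\<close> to \<open>B \<circ> \<sigma>\<close> for each permutation.
  A walk that crosses at \<open>\<sigma>'\<close> and returns at \<open>\<sigma>\<close> has moved
  \<open>B \<circ> \<sigma>'\<close> to \<open>B \<circ> \<sigma>\<close> by an old walk. By
  \<open>B_stab\<close> some \<open>c\<close> in \<open>C e\<close> does the same, and moves
  \<open>A\<close> alike; it commutes with the letter, so the excursion amounts to \<open>c\<close>.
  The premise \<open>fresh\<close> tolerates pairs that the bridge contains anyway, because a letter
  of \<open>S\<close> already sends x0 to x0.\<close>

lemma good_join:
  assumes good: "good \<Phi>" and e: "e \<in> E" and A: "A \<in> triples" and B: "B \<in> triples"
    and AB: "\<not> conn \<Phi> A B"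
    and A_sym: "\<And>\<sigma>. bij \<sigma> \<Longrightarrow> \<exists>h\<in>carrier G0. tact A h = A \<circ> \<sigma>"
    and fresh: "\<And>x y. (e, x, y) \<in> \<Phi> \<Longrightarrow> \<exists>i. x = A i \<and> y = B i"
    and B_stab: "\<And>\<sigma>. bij \<sigma> \<Longrightarrow> conn \<Phi> B (B \<circ> \<sigma>) \<Longrightarrow> \<exists>c\<in>C e. tact A c = A \<circ> \<sigma> \<and> tact B c = B \<circ> \<sigma>"
    and C_perm: "\<And>c. c \<in> C e \<Longrightarrow> \<exists>\<sigma>. bij \<sigma> \<and> tact A c = A \<circ> \<sigma> \<and> tact B c = B \<circ> \<sigma>"
  defines "\<Psi> \<equiv> \<Phi> \<union> range (\<lambda>i. (e, A i, B i))"
  shows "good \<Psi>" "conn \<Psi> A B"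
proof -
  have pm: "partial_maps \<Phi>" and free: "free_on_triples \<Phi>" using good unfolding good_def by auto
  have inj: "inj A" "inj B" and AY: "\<And>i. A i \<in> Y" "\<And>i. B i \<in> Y"
    using A B triplesD unfolding triples_def by auto
  have \<Psi>_e: "(e, x, y) \<in> \<Psi> \<longleftrightarrow> (\<exists>i. x = A i \<and> y = B i)" for x y
    using fresh unfolding \<Psi>_def by blast
  have \<Psi>_other: "(e', x, y) \<in> \<Psi> \<longleftrightarrow> (e', x, y) \<in> \<Phi>" if "e' \<noteq> e" for e' x y
    using that unfolding \<Psi>_def by blast
  have sub: "\<Phi> \<subseteq> \<Psi>" unfolding \<Psi>_def by blast
  have pm': "partial_maps \<Psi>"
    unfolding partial_maps_def
  proof (intro conjI allI impI)
    show "\<Psi> \<subseteq> E \<times> Y \<times> Y"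
      by (auto simp: \<Psi>_def e AY dest: partial_mapsD(1)[OF pm])
  next
    fix e' x y z assume "(e', x, y) \<in> \<Psi>" "(e', x, z) \<in> \<Psi>"
    then show "y = z"
      using \<Psi>_e \<Psi>_other partial_mapsD(2)[OF pm] injD[OF inj(1)] by (cases "e' = e") metis+
  next
    fix e' x y z assume "(e', y, x) \<in> \<Psi>" "(e', z, x) \<in> \<Psi>"
    then show "y = z"
      using \<Psi>_e \<Psi>_other partial_mapsD(3)[OF pm] injD[OF inj(2)] by (cases "e' = e") metis+
  next
    fix e' x y c assume a: "(e', x, y) \<in> \<Psi>" "c \<in> C e'"
    show "(e', act x c, act y c) \<in> \<Psi>"
    proof (cases "e' = e")
      case True
      then obtain i where i: "x = A i" "y = B i" using \<Psi>_e a by blast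
      obtain \<sigma> where s: "tact A c = A \<circ> \<sigma>" "tact B c = B \<circ> \<sigma>" using C_perm a True by blast
      have "act x c = A (\<sigma> i)" "act y c = B (\<sigma> i)"
        using i fun_cong[OF s(1), of i] fun_cong[OF s(2), of i] by (auto simp: tact_def)
      then show ?thesis using \<Psi>_e True by blast
    next
      case False
      then show ?thesis using \<Psi>_other a partial_mapsD(4)[OF pm] by metis
    qed
  qed
  \<comment> \<open>The pairs of \<open>e\<close> are exactly those of the bridge, and three
    distinct points use all three of them.\<close>
  have edge_cases: "edge \<Phi> e' \<tau> \<tau>' \<or> (e' = e \<and> (\<exists>\<sigma>. bij \<sigma> \<and> \<tau> = A \<circ> \<sigma> \<and> \<tau>' = B \<circ> \<sigma>))"
    if ed: "edge \<Psi> e' \<tau> \<tau>'" and t: "\<tau> \<in> triples" for e' \<tau> \<tau>'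
  proof (cases "e' = e")
    case True
    have "\<forall>i. \<exists>j. \<tau> i = A j \<and> \<tau>' i = B j" using ed True \<Psi>_e unfolding edge_def by blast
    then obtain \<sigma> where s: "\<And>i. \<tau> i = A (\<sigma> i) \<and> \<tau>' i = B (\<sigma> i)" by metis
    have "inj \<tau>" using t unfolding triples_def by blast
    then have "inj \<sigma>" by (intro injI) (metis s injD)
    then have "bij \<sigma>" using finite_UNIV_inj_surj[of \<sigma>] by (auto simp: bij_def)
    then show ?thesis using s True by (auto simp: fun_eq_iff)
  next
    case False
    then show ?thesis using ed \<Psi>_other unfolding edge_def by blast
  qed
  have edgeAB: "edge \<Psi> e A B" unfolding edge_def \<Psi>_def by blast
  show AB': "conn \<Psi> A B" using path_fwd[OF A e edgeAB] unfolding conn_def by blast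
  have A_conn: "conn \<Phi> A (A \<circ> \<sigma>)" if "bij \<sigma>" for \<sigma>
    using A_sym[OF that] conn_tact[OF A, of _ \<Phi>] by metis
  have B_conn: "conn \<Psi> A (B \<circ> \<sigma>)" if "bij \<sigma>" for \<sigma>
    using conn_trans[OF conn_mono[OF A_conn[OF that] sub] conn_perm[OF AB' that] pm'] .
  \<comment> \<open>Undoing \<open>\<sigma>\<close> on both sides rearranges \<open>A\<close>, which
    \<open>G0\<close> can repair; so a connection to a rearrangement of \<open>B\<close> would give
    one to \<open>B\<close>.\<close>
  have nAB: "\<not> conn \<Phi> A (B \<circ> \<sigma>)" if s: "bij \<sigma>" for \<sigma>
  proof
    assume "conn \<Phi> A (B \<circ> \<sigma>)"
    then have "conn \<Phi> (A \<circ> inv_into UNIV \<sigma>) (B \<circ> \<sigma> \<circ> inv_into UNIV \<sigma>)"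
      using conn_perm bij_imp_bij_inv[OF s] by blast
    moreover have "B \<circ> \<sigma> \<circ> inv_into UNIV \<sigma> = B"
      using s by (simp add: comp_assoc surj_iff[THEN iffD1, OF bij_is_surj[OF s]])
    ultimately show False
      using AB conn_trans[OF A_conn[OF bij_imp_bij_inv[OF s]] _ pm] by metis
  qed
  \<comment> \<open>A walk from \<open>A\<close> that is now beyond the bridge: \<open>h\<close>
    turns \<open>A\<close> into the rearrangement at which it crosses, and \<open>k\<close> is an
    old walk on the far side.\<close>
  define side where "side g \<tau> \<longleftrightarrow> (\<exists>\<sigma> h k. bij \<sigma> \<and> h \<in> carrier G0 \<and> tact A h = A \<circ> \<sigma> \<and>
      path \<Phi> (B \<circ> \<sigma>) k \<tau> \<and> g = \<iota> h \<otimes>\<^bsub>G\<^esub> \<gamma> e \<otimes>\<^bsub>G\<^esub> k)" for g \<tau>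
  have B\<sigma>: "B \<circ> \<sigma> \<in> triples" "A \<circ> \<sigma> \<in> triples" if "bij \<sigma>" for \<sigma>
    using triples_perm A B that by blast+
  have step_side: "side (g \<otimes>\<^bsub>G\<^esub> l) \<tau>'" if "side g \<tau>" "path \<Phi> \<tau> l \<tau>'" for g l \<tau> \<tau>'
  proof -
    obtain \<sigma> h k where s: "bij \<sigma>" "h \<in> carrier G0" "tact A h = A \<circ> \<sigma>"
      "path \<Phi> (B \<circ> \<sigma>) k \<tau>" "g = \<iota> h \<otimes>\<^bsub>G\<^esub> \<gamma> e \<otimes>\<^bsub>G\<^esub> k"
      using \<open>side g \<tau>\<close> unfolding side_def by blast
    have c: "k \<in> carrier G" "l \<in> carrier G"
      using path_triples(2)[OF s(4) pm] path_triples(2)[OF that(2) pm] .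
    have "path \<Phi> (B \<circ> \<sigma>) (k \<otimes>\<^bsub>G\<^esub> l) \<tau>'" by (rule path_trans[OF that(2) s(4) pm])
    moreover have "g \<otimes>\<^bsub>G\<^esub> l = \<iota> h \<otimes>\<^bsub>G\<^esub> \<gamma> e \<otimes>\<^bsub>G\<^esub> (k \<otimes>\<^bsub>G\<^esub> l)"
      using s c e by (simp add: G.m_assoc)
    ultimately show ?thesis unfolding side_def using s(1-3) by blast
  qed
  have reach: "path \<Phi> A g \<tau> \<or> side g \<tau>" if "path \<Psi> A g \<tau>" for g \<tau>
    using that
  proof (induction rule: path.induct)
    case start
    then show ?case using path.start by blast
  next
    case (base g \<tau> h)
    have "path \<Phi> \<tau> (\<iota> h) (tact \<tau> h)"
      using path_base base.hyps(2) path_triples(3)[OF base.hyps(1) pm'] by blast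
    then show ?case using step_side base.IH path.base[OF _ base.hyps(2)] by blast
  next
    case (fwd g \<tau> e' \<tau>')
    have t: "\<tau> \<in> triples" using path_triples(3)[OF fwd.hyps(1) pm'] .
    from edge_cases[OF fwd.hyps(3) t] show ?case
    proof (elim disjE conjE exE)
      assume "edge \<Phi> e' \<tau> \<tau>'"
      then show ?thesis using fwd.IH step_side path_fwd[OF t fwd.hyps(2)] path.fwd[OF _ fwd.hyps(2)] by blast
    next
      fix \<sigma> assume s: "e' = e" "bij \<sigma>" "\<tau> = A \<circ> \<sigma>" "\<tau>' = B \<circ> \<sigma>"
      obtain h where h: "h \<in> carrier G0" "tact A h = A \<circ> \<sigma>" using A_sym s by blast
      \<comment> \<open>An old walk from the far side to a rearrangement of \<open>A\<close> would
        have connected the two classes before.\<close>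
      have "\<not> side g \<tau>"
      proof
        assume "side g \<tau>"
        then obtain \<sigma>' where s': "bij \<sigma>'" "conn \<Phi> (B \<circ> \<sigma>') (A \<circ> \<sigma>)"
          unfolding side_def conn_def s by blast
        then show False
          using conn_trans[OF A_conn[OF s(2)] conn_sym[OF s'(2) pm] pm] nAB by blast
      qed
      then have "path \<Phi> A g (A \<circ> \<sigma>)" using fwd.IH s by blast
      then have "g = \<iota> h" using path_unique[OF pm free] path_base[OF A h(1), of \<Phi>] h(2) by simp
      then have "g \<otimes>\<^bsub>G\<^esub> \<gamma> e' = \<iota> h \<otimes>\<^bsub>G\<^esub> \<gamma> e \<otimes>\<^bsub>G\<^esub> \<one>\<^bsub>G\<^esub>"
        using s e h by simp
      then have "side (g \<otimes>\<^bsub>G\<^esub> \<gamma> e') \<tau>'"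
        unfolding side_def using s h path.start[OF B\<sigma>(1)[OF s(2)]] by blast
      then show ?thesis ..
    qed
  next
    case (bwd g \<tau> e' \<tau>')
    have t: "\<tau> \<in> triples" "\<tau>' \<in> triples"
      using path_triples(3)[OF bwd.hyps(1) pm'] edge_triples[OF pm' bwd.hyps(3)] by auto
    from edge_cases[OF bwd.hyps(3) t(2)] show ?case
    proof (elim disjE conjE exE)
      assume "edge \<Phi> e' \<tau>' \<tau>"
      then show ?thesis using bwd.IH step_side path_bwd[OF t(1) bwd.hyps(2)] path.bwd[OF _ bwd.hyps(2)] by blast
    next
      fix \<sigma> assume s: "e' = e" "bij \<sigma>" "\<tau>' = A \<circ> \<sigma>" "\<tau> = B \<circ> \<sigma>"
      have "\<not> path \<Phi> A g \<tau>" using nAB[OF s(2)] s(4) unfolding conn_def by blast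
      then obtain \<sigma>' h k where q: "bij \<sigma>'" "h \<in> carrier G0" "tact A h = A \<circ> \<sigma>'"
        "path \<Phi> (B \<circ> \<sigma>') k (B \<circ> \<sigma>)" "g = \<iota> h \<otimes>\<^bsub>G\<^esub> \<gamma> e \<otimes>\<^bsub>G\<^esub> k"
        using bwd.IH s(4) unfolding side_def by blast
      \<comment> \<open>Undoing the rearrangement at the entrance turns the walk on the far side
        into one that starts at \<open>B\<close> itself, to which \<open>B_stab\<close>
        applies.\<close>
      define \<sigma>i where "\<sigma>i = inv_into UNIV \<sigma>'"
      have i: "bij \<sigma>i" "\<sigma>' \<circ> \<sigma>i = id" "\<sigma>i \<circ> \<sigma>' = id"
        using q(1) bij_imp_bij_inv unfolding \<sigma>i_def
        by (auto simp: surj_iff[symmetric] inj_iff[symmetric] bij_def intro: surj_imp_inj_inv inj_imp_surj_inv)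
      have "path \<Phi> (B \<circ> \<sigma>' \<circ> \<sigma>i) k (B \<circ> \<sigma> \<circ> \<sigma>i)" using path_perm[OF q(4) i(1)] .
      then have "conn \<Phi> B (B \<circ> (\<sigma> \<circ> \<sigma>i))" unfolding conn_def by (auto simp: comp_assoc i(2))
      moreover have "bij (\<sigma> \<circ> \<sigma>i)" using i(1) s(2) by (rule bij_comp)
      ultimately obtain c where c: "c \<in> C e" "tact A c = A \<circ> (\<sigma> \<circ> \<sigma>i)" "tact B c = B \<circ> (\<sigma> \<circ> \<sigma>i)"
        using B_stab by blast
      have cc: "c \<in> carrier G0" using C_closed e c by blast
      have "tact (B \<circ> \<sigma>') c = B \<circ> \<sigma>" "tact (A \<circ> \<sigma>') c = A \<circ> \<sigma>"
        unfolding tact_perm c(2,3) comp_assoc i(3) by simp_all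
      then have "path \<Phi> (B \<circ> \<sigma>') (\<iota> c) (B \<circ> \<sigma>)" and pA: "path \<Phi> (A \<circ> \<sigma>') (\<iota> c) (A \<circ> \<sigma>)"
        using path_base[OF B\<sigma>(1)[OF q(1)] cc, of \<Phi>] path_base[OF B\<sigma>(2)[OF q(1)] cc, of \<Phi>] by auto
      then have k: "k = \<iota> c" using path_unique[OF pm free q(4)] by blast
      \<comment> \<open>Moving \<open>\<iota> c\<close> past \<open>\<gamma> e\<close> lets the two
        crossings cancel; what is left is an element of \<open>G0\<close> that carries
        \<open>A\<close> to \<open>A \<circ> \<sigma>\<close>.\<close>
      have "g = \<iota> h \<otimes>\<^bsub>G\<^esub> (\<iota> c \<otimes>\<^bsub>G\<^esub> \<gamma> e)"
        using q k cc e \<gamma>_comm[OF e c(1)] by (simp add: G.m_assoc)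
      then have "g \<otimes>\<^bsub>G\<^esub> inv\<^bsub>G\<^esub> \<gamma> e' = \<iota> h \<otimes>\<^bsub>G\<^esub> \<iota> c"
        using s q cc e by (simp add: G.m_assoc)
      moreover have "path \<Phi> A (\<iota> h \<otimes>\<^bsub>G\<^esub> \<iota> c) (A \<circ> \<sigma>)"
        using path_trans[OF pA _ pm] path_base[OF A q(2), of \<Phi>] q(3) by simp
      ultimately have "path \<Phi> A (g \<otimes>\<^bsub>G\<^esub> inv\<^bsub>G\<^esub> \<gamma> e') \<tau>'" by (simp only: s(3))
      then show ?thesis ..
    qed
  qed
  have loopA: "g = \<one>\<^bsub>G\<^esub>" if "path \<Psi> A g A" for g
  proof -
    have "\<not> side g A"
    proof
      assume "side g A"
      then obtain \<sigma>' where s': "bij \<sigma>'" "conn \<Phi> (B \<circ> \<sigma>') A"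
        unfolding side_def conn_def by blast
      then show False using conn_sym[OF s'(2) pm] nAB by blast
    qed
    then show ?thesis using reach[OF that] free unfolding free_on_triples_def by blast
  qed
  \<comment> \<open>Both ends of every new edge are connected to \<open>A\<close>, so the remaining
    classes gain no walks.\<close>
  have away: "path \<Phi> \<tau> g \<tau>'" if "path \<Psi> \<tau> g \<tau>'" "\<not> conn \<Psi> A \<tau>" for \<tau> g \<tau>'
    using that
  proof (induction rule: path.induct)
    case start
    then show ?case using path.start by blast
  next
    case (base g \<tau>' h)
    then show ?case using path.base by blast
  next
    case (fwd g \<tau>' e' \<tau>'')
    have t: "\<tau>' \<in> triples" using path_triples(3)[OF fwd.hyps(1) pm'] .
    have n: "\<not> conn \<Psi> A \<tau>'"
    proof
      assume a: "conn \<Psi> A \<tau>'"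
      have "conn \<Psi> \<tau>' \<tau>" using path_sym[OF fwd.hyps(1) pm'] unfolding conn_def by blast
      then show False using conn_trans[OF a _ pm'] fwd.prems by blast
    qed
    have "edge \<Phi> e' \<tau>' \<tau>''"
      using edge_cases[OF fwd.hyps(3) t] n conn_mono[OF A_conn sub] by blast
    then show ?case using fwd path.fwd by blast
  next
    case (bwd g \<tau>' e' \<tau>'')
    have t: "\<tau>'' \<in> triples"
      using path_triples(3)[OF bwd.hyps(1) pm'] edge_triples[OF pm' bwd.hyps(3)] by auto
    have n: "\<not> conn \<Psi> A \<tau>'"
    proof
      assume a: "conn \<Psi> A \<tau>'"
      have "conn \<Psi> \<tau>' \<tau>" using path_sym[OF bwd.hyps(1) pm'] unfolding conn_def by blast
      then show False using conn_trans[OF a _ pm'] bwd.prems by blast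
    qed
    have "edge \<Phi> e' \<tau>'' \<tau>'"
      using edge_cases[OF bwd.hyps(3) t] n B_conn by blast
    then show ?case using bwd path.bwd by blast
  qed
  have free': "free_on_triples \<Psi>"
    unfolding free_on_triples_def
  proof (intro allI impI)
    fix \<tau> g assume p: "path \<Psi> \<tau> g \<tau>"
    show "g = \<one>\<^bsub>G\<^esub>"
    proof (cases "conn \<Psi> A \<tau>")
      case True
      show ?thesis by (rule loop_transport[OF pm' p True loopA])
    next
      case False
      then show ?thesis using away[OF p] free unfolding free_on_triples_def by blast
    qed
  qed
  have "\<exists>\<tau>'. conn \<Psi> \<tau> \<tau>' \<and> central \<Psi> \<tau>'" if t: "\<tau> \<in> triples" for \<tau>
  proof (cases "conn \<Psi> A \<tau>")
    case True
    \<comment> \<open>All rearrangements of \<open>A\<close> come from \<open>G0\<close>, so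
      \<open>A\<close> serves the joined class whatever has become reachable.\<close>
    have "central \<Psi> A" unfolding central_def using A_sym by blast
    then show ?thesis using conn_sym[OF True pm'] by blast
  next
    case False
    obtain \<tau>' where t': "conn \<Phi> \<tau> \<tau>'" "central \<Phi> \<tau>'"
      using good t unfolding good_def by blast
    have c: "conn \<Psi> \<tau> \<tau>'" using conn_mono[OF t'(1) sub] .
    have "\<not> conn \<Psi> A \<tau>'" using conn_trans[OF _ conn_sym[OF c pm'] pm'] False by blast
    then have "central \<Psi> \<tau>'"
      using t'(2) away unfolding central_def conn_def[of \<Phi>] conn_def[of \<Psi> \<tau>'] by blast
    then show ?thesis using c by blast
  qed
  then show "good \<Psi>" using pm' free' unfolding good_def by blast
qed

text \<open>A walk uses finitely many pairs, and finitely many elements of the union of a chain lie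
  in a common member.\<close>

lemma path_Union_chain:
  assumes "path (\<Union>\<C>) \<tau> g \<tau>'" "subset.chain UNIV \<C>" "\<C> \<noteq> {}"
  shows "\<exists>\<Phi>\<in>\<C>. path \<Phi> \<tau> g \<tau>'"
proof -
  have common: "\<exists>\<Phi>\<in>\<C>. path \<Phi> \<tau> g \<tau>' \<and> edge \<Phi> e \<upsilon> \<upsilon>'"
    if ex: "\<exists>\<Phi>\<in>\<C>. path \<Phi> \<tau> g \<tau>'" and ed: "edge (\<Union>\<C>) e \<upsilon> \<upsilon>'" for g \<tau>' e \<upsilon> \<upsilon>'
  proof -
    obtain \<Phi> where \<Phi>: "\<Phi> \<in> \<C>" "path \<Phi> \<tau> g \<tau>'" using ex by blast
    have "range (\<lambda>i. (e, \<upsilon> i, \<upsilon>' i)) \<subseteq> \<Union>\<C>" using ed unfolding edge_def by blast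
    then obtain \<Phi>' where \<Phi>': "\<Phi>' \<in> \<C>" "range (\<lambda>i. (e, \<upsilon> i, \<upsilon>' i)) \<subseteq> \<Phi>'"
      using finite_subset_Union_chain[of "range (\<lambda>i. (e, \<upsilon> i, \<upsilon>' i))" \<C>] assms(2,3) by auto
    then have ed': "edge \<Phi>' e \<upsilon> \<upsilon>'" unfolding edge_def by blast
    have "\<Phi> \<subseteq> \<Phi>' \<or> \<Phi>' \<subseteq> \<Phi>" using assms(2) \<Phi> \<Phi>' unfolding subset_chain_def by blast
    then show ?thesis
    proof
      assume "\<Phi> \<subseteq> \<Phi>'"
      then show ?thesis using path_mono[OF \<Phi>(2)] ed' \<Phi>'(1) by blast
    next
      assume "\<Phi>' \<subseteq> \<Phi>"
      then have "edge \<Phi> e \<upsilon> \<upsilon>'" using ed' unfolding edge_def by blast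
      then show ?thesis using \<Phi> by blast
    qed
  qed
  show ?thesis
    using assms(1)
  proof (induction rule: path.induct)
    case start
    then show ?case using path.start assms(3) by blast
  next
    case (base g \<tau>' h)
    then show ?case using path.base by blast
  next
    case (fwd g \<tau>' e \<tau>'')
    then show ?case using common[OF fwd.IH fwd.hyps(3)] path.fwd by blast
  next
    case (bwd g \<tau>' e \<tau>'')
    then show ?case using common[OF bwd.IH bwd.hyps(3)] path.bwd by blast
  qed
qed

text \<open>The set of reachable rearrangements is the same throughout a class, so it can be
  computed at any triple of the class.\<close>

lemma conn_perm_iff:
  assumes "conn \<Phi> \<tau> \<tau>'" "bij \<sigma>" "partial_maps \<Phi>"
  shows "conn \<Phi> \<tau> (\<tau> \<circ> \<sigma>) \<longleftrightarrow> conn \<Phi> \<tau>' (\<tau>' \<circ> \<sigma>)"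
proof -
  have p: "conn \<Phi> (\<tau> \<circ> \<sigma>) (\<tau>' \<circ> \<sigma>)" using conn_perm assms by blast
  show ?thesis
    using conn_trans[OF conn_sym[OF assms(1,3)] conn_trans[OF _ p assms(3)] assms(3)]
      conn_trans[OF assms(1) conn_trans[OF _ conn_sym[OF p assms(3)] assms(3)] assms(3)] by blast
qed

text \<open>Freeness concerns one finite walk at a time. Centrality does not: a triple may lose it
  when further rearrangements become reachable. As there are finitely many permutations, the set of
  reachable ones is largest at some member of the chain, and a triple that is central there remains
  so in the union.\<close>

lemma good_Union_chain:
  assumes chain: "subset.chain UNIV \<C>" and ne: "\<C> \<noteq> {}" and good: "\<And>\<Phi>. \<Phi> \<in> \<C> \<Longrightarrow> good \<Phi>"
  shows "good (\<Union>\<C>)"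
proof -
  have pm: "partial_maps \<Phi>" if "\<Phi> \<in> \<C>" for \<Phi> using good that unfolding good_def by blast
  have lin: "\<Phi> \<subseteq> \<Psi> \<or> \<Psi> \<subseteq> \<Phi>" if "\<Phi> \<in> \<C>" "\<Psi> \<in> \<C>" for \<Phi> \<Psi>
    using chain that unfolding subset.chain_def subset_chain_def by blast
  have two: "\<exists>\<Phi>\<in>\<C>. p \<in> \<Phi> \<and> q \<in> \<Phi>" if "p \<in> \<Union>\<C>" "q \<in> \<Union>\<C>" for p q
    using that lin by blast
  have pm': "partial_maps (\<Union>\<C>)"
    unfolding partial_maps_def
  proof (intro conjI allI impI)
    show "\<Union>\<C> \<subseteq> E \<times> Y \<times> Y" using pm unfolding partial_maps_def by blast
  next
    fix e x y z assume "(e, x, y) \<in> \<Union>\<C>" "(e, x, z) \<in> \<Union>\<C>"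
    then show "y = z" using two partial_mapsD(2)[OF pm] by metis
  next
    fix e x y z assume "(e, y, x) \<in> \<Union>\<C>" "(e, z, x) \<in> \<Union>\<C>"
    then show "y = z" using two partial_mapsD(3)[OF pm] by metis
  next
    fix e x y c assume "(e, x, y) \<in> \<Union>\<C>" "c \<in> C e"
    then show "(e, act x c, act y c) \<in> \<Union>\<C>" using partial_mapsD(4)[OF pm] by blast
  qed
  have free': "free_on_triples (\<Union>\<C>)"
    unfolding free_on_triples_def
  proof (intro allI impI)
    fix \<tau> g assume "path (\<Union>\<C>) \<tau> g \<tau>"
    then obtain \<Phi> where "\<Phi> \<in> \<C>" "path \<Phi> \<tau> g \<tau>" using path_Union_chain chain ne by blast
    then show "g = \<one>\<^bsub>G\<^esub>" using good unfolding good_def free_on_triples_def by blast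
  qed
  have conn_Union: "\<exists>\<Phi>\<in>\<C>. conn \<Phi> \<tau> \<tau>'" if "conn (\<Union>\<C>) \<tau> \<tau>'" for \<tau> \<tau>'
    using that path_Union_chain chain ne unfolding conn_def by blast
  have "\<exists>\<tau>'. conn (\<Union>\<C>) \<tau> \<tau>' \<and> central (\<Union>\<C>) \<tau>'" if t: "\<tau> \<in> triples" for \<tau>
  proof -
    define H where "H \<Phi> = {\<sigma>. bij \<sigma> \<and> conn \<Phi> \<tau> (\<tau> \<circ> \<sigma>)}" for \<Phi>
    have finH: "finite (H \<Phi>)" for \<Phi> by simp
    have fin: "finite ((\<lambda>\<Phi>. card (H \<Phi>)) ` \<C>)"
      by (rule finite_subset[of _ "{..card (UNIV :: (three \<Rightarrow> three) set)}"])
        (auto intro: card_mono)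
    then obtain \<Phi> where \<Phi>: "\<Phi> \<in> \<C>" "card (H \<Phi>) = Max ((\<lambda>\<Phi>. card (H \<Phi>)) ` \<C>)"
      using Max_in[OF fin] ne by (metis (no_types, lifting) imageE image_is_empty)
    have max: "card (H \<Psi>) \<le> card (H \<Phi>)" if "\<Psi> \<in> \<C>" for \<Psi>
      using \<Phi>(2) Max_ge[OF fin] that by simp
    have H_sub: "H \<Psi> \<subseteq> H \<Phi>" if "\<Psi> \<in> \<C>" for \<Psi>
    proof (cases "\<Psi> \<subseteq> \<Phi>")
      case True
      then show ?thesis unfolding H_def using conn_mono by blast
    next
      case False
      then have "H \<Phi> \<subseteq> H \<Psi>" using lin[OF \<Phi>(1) that] conn_mono unfolding H_def by blast
      then have "H \<Phi> = H \<Psi>" using card_seteq[OF finH] max[OF that] by blast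
      then show ?thesis by blast
    qed
    obtain \<tau>' where t': "conn \<Phi> \<tau> \<tau>'" "central \<Phi> \<tau>'"
      using good[OF \<Phi>(1)] t unfolding good_def by blast
    have c: "conn (\<Union>\<C>) \<tau> \<tau>'" using conn_mono[OF t'(1)] \<Phi>(1) by blast
    have "central (\<Union>\<C>) \<tau>'"
      unfolding central_def
    proof (intro allI impI)
      fix \<sigma> :: "three \<Rightarrow> three" assume s: "bij \<sigma>" "conn (\<Union>\<C>) \<tau>' (\<tau>' \<circ> \<sigma>)"
      then have "conn (\<Union>\<C>) \<tau> (\<tau> \<circ> \<sigma>)" using conn_perm_iff[OF c s(1) pm'] by blast
      then have "\<sigma> \<in> H \<Phi>" using conn_Union H_sub s(1) unfolding H_def by blast
      then have "conn \<Phi> \<tau>' (\<tau>' \<circ> \<sigma>)"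
        using conn_perm_iff[OF t'(1) s(1) pm[OF \<Phi>(1)]] unfolding H_def by blast
      then show "\<exists>h\<in>carrier G0. tact \<tau>' h = \<tau>' \<circ> \<sigma>" using t'(2) s(1) unfolding central_def by blast
    qed
    then show ?thesis using c by blast
  qed
  then show ?thesis using pm' free' unfolding good_def by blast
qed

end

section \<open>The transfinite construction\<close>

lemma finite_less_infinite: "\<lbrakk>finite A; infinite B\<rbrakk> \<Longrightarrow> |A| <o |B|"
  by (intro finite_ordLess_infinite) (auto simp: card_of_well_order_on Field_card_of)

text \<open>The tasks are well-ordered by the cardinal of \<open>T\<close>, so fewer than |K| of
  them precede any given one. Each adds finitely many elements, and what has been added to
  \<open>\<Phi>0\<close> stays smaller than \<open>K\<close> at every stage. The set
  \<open>\<Phi>0\<close> itself may be as large as \<open>K\<close>.\<close>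

lemma transfinite_tasks:
  fixes P :: "'p set \<Rightarrow> bool" and D :: "'t \<Rightarrow> 'p set \<Rightarrow> bool" and K :: "'k set"
  assumes P0: "P \<Phi>0"
    and chain: "\<And>\<C>. subset.chain UNIV \<C> \<Longrightarrow> \<C> \<noteq> {} \<Longrightarrow> (\<And>\<Phi>. \<Phi> \<in> \<C> \<Longrightarrow> P \<Phi>) \<Longrightarrow> P (\<Union>\<C>)"
    and step: "\<And>\<Phi> \<tau>. P \<Phi> \<Longrightarrow> \<Phi>0 \<subseteq> \<Phi> \<Longrightarrow> |\<Phi> - \<Phi>0| <o |K| \<Longrightarrow> \<tau> \<in> T \<Longrightarrow>
        \<exists>\<Psi>. P \<Psi> \<and> \<Phi> \<subseteq> \<Psi> \<and> finite (\<Psi> - \<Phi>) \<and> D \<tau> \<Psi>"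
    and mono: "\<And>\<Phi> \<Psi> \<tau>. D \<tau> \<Phi> \<Longrightarrow> \<Phi> \<subseteq> \<Psi> \<Longrightarrow> D \<tau> \<Psi>"
    and K: "infinite K" and TK: "|T| \<le>o |K|"
  shows "\<exists>\<Phi>. P \<Phi> \<and> \<Phi>0 \<subseteq> \<Phi> \<and> (\<forall>\<tau>\<in>T. D \<tau> \<Phi>)"
proof -
  define r where "r = |T|"
  have wo: "wo_rel r" unfolding r_def wo_rel_def by (rule card_of_Well_order)
  have Fr: "Field r = T" unfolding r_def by (rule Field_card_of)
  define ext where "ext \<tau> \<Phi> = (SOME \<Psi>. P \<Psi> \<and> \<Phi> \<subseteq> \<Psi> \<and> finite (\<Psi> - \<Phi>) \<and> D \<tau> \<Psi>)" for \<tau> \<Phi>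
  define H where "H F \<tau> = ext \<tau> (\<Phi>0 \<union> \<Union>(F ` underS r \<tau>))" for F \<tau>
  define F where "F = wo_rel.worec r H"
  define pre where "pre \<tau> = \<Phi>0 \<union> \<Union>(F ` underS r \<tau>)" for \<tau>
  \<comment> \<open>The recursion at \<open>\<tau>\<close> consults \<open>F\<close> only at
    strictly smaller tasks.\<close>
  have adm: "wo_rel.adm_wo r H"
    unfolding wo_rel.adm_wo_def[OF wo] H_def by (intro allI impI arg_cong[where f = "ext _"]) auto
  have F: "F \<tau> = ext \<tau> (pre \<tau>)" for \<tau>
    using fun_cong[OF wo_rel.worec_fixpoint[OF wo adm], of \<tau>] unfolding F_def pre_def H_def by simp
  define Q where "Q \<tau> \<longleftrightarrow> P (F \<tau>) \<and> pre \<tau> \<subseteq> F \<tau> \<and> finite (F \<tau> - pre \<tau>) \<and> D \<tau> (F \<tau>)" for \<tau>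
  have lin: "y \<in> underS r z \<or> z \<in> underS r y \<or> y = z" if "y \<in> T" "z \<in> T" for y z
    using wo_rel.TOTALS[OF wo] that unfolding Fr underS_def by blast
  have chainF: "P (\<Phi>0 \<union> \<Union>(F ` I))" if I: "I \<subseteq> T" "\<And>y. y \<in> I \<Longrightarrow> Q y" for I
  proof -
    have up: "F y \<subseteq> F z" if "y \<in> underS r z" "z \<in> I" for y z
      using I(2)[OF that(2)] that(1) unfolding Q_def pre_def by blast
    have "F y \<subseteq> F z \<or> F z \<subseteq> F y" if "y \<in> I" "z \<in> I" for y z
      using lin[of y z] up[of y z] up[of z y] that I(1) by blast
    moreover have "\<Phi>0 \<subseteq> F y" if "y \<in> I" for y using I(2)[OF that] unfolding Q_def pre_def by blast
    ultimately have "subset.chain UNIV (insert \<Phi>0 (F ` I))"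
      unfolding subset_chain_def by blast
    then have "P (\<Union>(insert \<Phi>0 (F ` I)))"
      by (rule chain) (use P0 I(2) in \<open>auto simp: Q_def\<close>)
    then show ?thesis by simp
  qed
  have "\<tau> \<in> T \<longrightarrow> Q \<tau>" for \<tau>
  proof (induction \<tau> rule: wo_rel.well_order_induct[OF wo])
    case (1 \<tau>)
    have T_under: "y \<in> T" if "y \<in> underS r z" for y z
      using that unfolding Fr[symmetric] underS_def Field_def by blast
    have IH: "Q y" if "y \<in> underS r \<tau>" for y
      using 1 T_under[OF that] that unfolding underS_def by blast
    show ?case
    proof
      assume \<tau>: "\<tau> \<in> T"
      have "P (pre \<tau>)" unfolding pre_def using chainF T_under IH by blast
      \<comment> \<open>An element beyond \<open>\<Phi>0\<close> is charged to the least task whose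
        result contains it: it was added there.\<close>
      have sub: "pre \<tau> - \<Phi>0 \<subseteq> (\<Union>y\<in>underS r \<tau>. F y - pre y)"
      proof
        fix p assume p: "p \<in> pre \<tau> - \<Phi>0"
        then obtain y where y: "y \<in> {y \<in> underS r \<tau>. p \<in> F y}" unfolding pre_def by blast
        obtain z where z: "z \<in> {y \<in> underS r \<tau>. p \<in> F y}"
          "\<And>w. (w, z) \<in> r - Id \<Longrightarrow> w \<notin> {y \<in> underS r \<tau>. p \<in> F y}"
          using wfE_min[OF wo_rel.WF[OF wo] y] by blast
        have "p \<notin> F w" if "w \<in> underS r z" for w
        proof -
          have wz: "(w, z) \<in> r - Id" using that unfolding underS_def by blast
          have "(z, \<tau>) \<in> r" "z \<noteq> \<tau>" using z(1) unfolding underS_def by auto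
          then have "w \<in> underS r \<tau>"
            using wz wo_rel.TRANS[OF wo] wo_rel.ANTISYM[OF wo] unfolding underS_def
            by (auto dest: transD antisymD)
          then show ?thesis using z(2)[OF wz] by blast
        qed
        then have "p \<notin> pre z" using p unfolding pre_def by blast
        then show "p \<in> (\<Union>y\<in>underS r \<tau>. F y - pre y)" using z(1) by blast
      qed
      have fin: "finite (F y - pre y)" if "y \<in> underS r \<tau>" for y using IH[OF that] unfolding Q_def by blast
      have less: "|underS r \<tau>| <o |K|"
        using card_of_underS[of r \<tau>] \<tau> Fr ordLess_ordLeq_trans TK unfolding r_def
        by (metis card_of_Card_order)
      \<comment> \<open>With finitely many earlier tasks the additions may outnumber the tasks, but
        they are finite and \<open>K\<close> is infinite. Otherwise a union of finite sets is no
        larger than its index set.\<close>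
      have "|pre \<tau> - \<Phi>0| <o |K|"
      proof (cases "finite (underS r \<tau>)")
        case True
        then have "finite (pre \<tau> - \<Phi>0)" using finite_subset[OF sub] fin by blast
        then show ?thesis using finite_less_infinite K by blast
      next
        case False
        have "|\<Union>y\<in>underS r \<tau>. F y - pre y| \<le>o |underS r \<tau>|"
          by (rule card_of_UNION_ordLeq_infinite[OF False card_of_mono1[OF subset_refl]])
            (use fin False finite_less_infinite ordLess_imp_ordLeq in blast)
        then show ?thesis using ordLeq_ordLess_trans[OF card_of_mono1[OF sub]] less
            ordLeq_ordLess_trans by blast
      qed
      then have "\<exists>\<Psi>. P \<Psi> \<and> pre \<tau> \<subseteq> \<Psi> \<and> finite (\<Psi> - pre \<tau>) \<and> D \<tau> \<Psi>"
        using step[OF \<open>P (pre \<tau>)\<close> _ _ \<tau>] unfolding pre_def by blast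
      from someI_ex[OF this] show "Q \<tau>" unfolding Q_def F ext_def .
    qed
  qed
  then have Q: "Q \<tau>" if "\<tau> \<in> T" for \<tau> using that by blast
  have "P (\<Phi>0 \<union> \<Union>(F ` T))" using chainF[OF subset_refl] Q by blast
  moreover have "D \<tau> (\<Phi>0 \<union> \<Union>(F ` T))" if "\<tau> \<in> T" for \<tau>
  proof (rule mono)
    show "D \<tau> (F \<tau>)" using Q[OF that] unfolding Q_def by blast
    show "F \<tau> \<subseteq> \<Phi>0 \<union> \<Union>(F ` T)" using that by blast
  qed
  ultimately show ?thesis by blast
qed

section \<open>Permutations of three positions\<close>

fun rot :: "three \<Rightarrow> three" where
  "rot I1 = I2" | "rot I2 = I3" | "rot I3 = I1"

fun swap23 :: "three \<Rightarrow> three" where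
  "swap23 I1 = I1" | "swap23 I2 = I3" | "swap23 I3 = I2"

lemma all_three: "(\<forall>i. P i) \<longleftrightarrow> P I1 \<and> P I2 \<and> P I3"
  using three.exhaust by metis

lemma ex_three: "(\<exists>i. P i) \<longleftrightarrow> P I1 \<or> P I2 \<or> P I3"
  using three.exhaust by metis

lemma bij_three: "inj (\<sigma> :: three \<Rightarrow> three) \<Longrightarrow> bij \<sigma>"
  using finite_UNIV_inj_surj[OF finite] by (simp add: bij_def)

lemma inj_three: "inj \<tau> \<longleftrightarrow> \<tau> I1 \<noteq> \<tau> I2 \<and> \<tau> I2 \<noteq> \<tau> I3 \<and> \<tau> I1 \<noteq> \<tau> I3"
  unfolding inj_def all_three by auto

lemma bij_rot: "bij rot" and bij_swap23: "bij swap23"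
  by (auto intro!: bij_three simp: inj_three)

lemma rot3: "rot \<circ> rot \<circ> rot = id" and swap23_2: "swap23 \<circ> swap23 = id"
  by (auto simp: fun_eq_iff all_three)

lemma bij_three_cases:
  assumes "bij (\<sigma> :: three \<Rightarrow> three)"
  shows "\<sigma> \<in> {id, rot, rot \<circ> rot, swap23, rot \<circ> swap23, rot \<circ> rot \<circ> swap23}"
proof -
  have "inj \<sigma>" using assms bij_is_inj by blast
  then show ?thesis
    by (cases "\<sigma> I1"; cases "\<sigma> I2"; cases "\<sigma> I3") (auto simp: fun_eq_iff all_three inj_three)
qed

locale extension_setup = partial_extension G0 Y act G \<iota> \<gamma> "R \<union> S \<union> U" C
  for G0 :: "('g, 'm) monoid_scheme" (structure) and Y :: "'y set" and act
    and G :: "('h, 'n) monoid_scheme" (structure)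
    and \<iota> :: "'g \<Rightarrow> 'h" and \<gamma> :: "'e \<Rightarrow> 'h" and R S U :: "'e set" and C +
  fixes a t :: 'g and x0 :: 'y and b :: "'e \<Rightarrow> 'y"
  assumes disj: "R \<inter> S = {}" "R \<inter> U = {}" "S \<inter> U = {}"
    and C_R: "e \<in> R \<Longrightarrow> C e = {\<one>}"
    and C_S: "e \<in> S \<Longrightarrow> C e = {\<one>, t}"
    and C_U: "e \<in> U \<Longrightarrow> C e = {\<one>, a, a \<otimes> a}"
    and a: "a \<in> carrier G0" "a \<otimes> a \<otimes> a = \<one>"
    and t: "t \<in> carrier G0" "t \<otimes> t = \<one>" "t \<noteq> \<one>"
    and conj_t: "\<And>g. g \<in> carrier G0 \<Longrightarrow> g \<noteq> \<one> \<Longrightarrow> g \<otimes> g = \<one> \<Longrightarrow> \<exists>h\<in>carrier G0. g = inv h \<otimes> t \<otimes> h"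
    and conj_a: "\<And>g. g \<in> carrier G0 \<Longrightarrow> g \<noteq> \<one> \<Longrightarrow> g \<otimes> g \<otimes> g = \<one> \<Longrightarrow> \<exists>h\<in>carrier G0. g = inv h \<otimes> a \<otimes> h"
    and x0: "x0 \<in> Y" "act x0 t = x0"
    and x0_unique: "\<And>x. x \<in> Y \<Longrightarrow> act x t = x \<Longrightarrow> x = x0"
    and a_no_fix: "\<And>x. x \<in> Y \<Longrightarrow> act x a \<noteq> x"
    and x0at: "act (act x0 a) t = act (act x0 a) a"
    and sharp: "\<And>\<tau> g. \<tau> \<in> triples \<Longrightarrow> g \<in> carrier G0 \<Longrightarrow> tact \<tau> g = \<tau> \<Longrightarrow> g = \<one>"
    and full_stabilizer: "\<And>\<tau>. \<tau> \<in> triples \<Longrightarrow> (\<And>\<sigma>. bij \<sigma> \<Longrightarrow> \<exists>g\<in>carrier G0. tact \<tau> g = \<tau> \<circ> \<sigma>) \<Longrightarrow>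
        \<exists>g\<in>carrier G0. tact (case_three x0 (act x0 a) (act (act x0 a) a)) g = \<tau>"
    and b_closed: "\<And>r. r \<in> R \<Longrightarrow> b r \<in> Y"
    and b_free: "\<And>r r' g g'. r \<in> R \<Longrightarrow> r' \<in> R \<Longrightarrow> g \<in> carrier G0 \<Longrightarrow> g' \<in> carrier G0 \<Longrightarrow>
        act (b r) g = act (b r') g' \<Longrightarrow> r = r' \<and> g = g'"
    and R_inf: "infinite R" and card_S: "|R| \<le>o |S|" "|S| \<le>o |R|" and card_U: "|R| \<le>o |U|" "|U| \<le>o |R|"
    and card_Y: "|Y| \<le>o |R|"
begin

abbreviation "E \<equiv> R \<union> S \<union> U"

definition A :: "three \<Rightarrow> 'y" where "A = case_three x0 (act x0 a) (act (act x0 a) a)"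

lemma A_simps [simp]: "A I1 = x0" "A I2 = act x0 a" "A I3 = act (act x0 a) a"
  unfolding A_def by simp_all

lemma act_aaa: "x \<in> Y \<Longrightarrow> act (act (act x a) a) a = x"
  using a act_mult[of x a a] act_mult[of x "a \<otimes> a" a] act_one by simp

lemma act_tt: "x \<in> Y \<Longrightarrow> act (act x t) t = x"
  using t act_mult[of x t t] act_one by simp

lemma aa_no_fix: "x \<in> Y \<Longrightarrow> act (act x a) a \<noteq> x"
  using act_aaa a_no_fix by metis

lemma orbit_a_triple:
  assumes "x \<in> Y"
  shows "case_three x (act x a) (act (act x a) a) \<in> triples"
  using assms a_no_fix[OF assms] a_no_fix[of "act x a"] aa_no_fix[OF assms] act_closed[OF _ a(1)]
  unfolding triples_def by (fastforce simp: inj_three split: three.splits)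

lemma A_triple: "A \<in> triples"
  unfolding A_def using orbit_a_triple x0 by blast

lemma tact_A_a: "tact A a = A \<circ> rot"
  by (simp add: fun_eq_iff all_three tact_def act_aaa x0)

lemma tact_A_t: "tact A t = A \<circ> swap23"
  using act_tt[of "act x0 a"] x0 a act_closed x0at by (simp add: fun_eq_iff all_three tact_def)

definition realized :: "(three \<Rightarrow> 'y) \<Rightarrow> (three \<Rightarrow> three) \<Rightarrow> bool" where
  "realized \<tau> \<sigma> \<longleftrightarrow> (\<exists>g\<in>carrier G0. tact \<tau> g = \<tau> \<circ> \<sigma>)"

text \<open>Group elements act on points and permutations on positions, so the order of the factors
  is reversed.\<close>

lemma realized_comp:
  assumes "\<tau> \<in> triples" "realized \<tau> \<sigma>" "realized \<tau> \<rho>"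
  shows "realized \<tau> (\<sigma> \<circ> \<rho>)"
proof -
  obtain g h where "g \<in> carrier G0" "tact \<tau> g = \<tau> \<circ> \<sigma>" "h \<in> carrier G0" "tact \<tau> h = \<tau> \<circ> \<rho>"
    using assms unfolding realized_def by blast
  then have "tact \<tau> (h \<otimes> g) = \<tau> \<circ> (\<sigma> \<circ> \<rho>)"
    using assms(1) by (simp add: tact_mult tact_perm comp_assoc)
  then show ?thesis unfolding realized_def using \<open>g \<in> carrier G0\<close> \<open>h \<in> carrier G0\<close> by blast
qed

lemma realized_id: "\<tau> \<in> triples \<Longrightarrow> realized \<tau> id"
  unfolding realized_def using tact_one by (intro bexI[of _ \<one>]) auto

lemma realized_all:
  assumes "\<tau> \<in> triples" "realized \<tau> rot" "realized \<tau> swap23" "bij \<sigma>"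
  shows "realized \<tau> \<sigma>"
proof -
  have "realized \<tau> (rot \<circ> rot)" using realized_comp assms by blast
  then show ?thesis
    using bij_three_cases[OF assms(4)] realized_comp[OF assms(1)] realized_id[OF assms(1)] assms(2,3)
    by (elim insertE) auto
qed

text \<open>The element \<open>a\<close> rotates \<open>A\<close>. By the assumed equality of the
  two triples, \<open>t\<close> fixes its first point and exchanges the other two. Together these
  give all six permutations.\<close>

lemma A_sym: "bij \<sigma> \<Longrightarrow> \<exists>h\<in>carrier G0. tact A h = A \<circ> \<sigma>"
  using realized_all[OF A_triple, of \<sigma>] tact_A_a tact_A_t a(1) t(1) unfolding realized_def by blast

text \<open>Since \<open>A\<close> has every symmetry, a triple needs to be joined to it only up to
  rearrangement.\<close>

lemma conn_A_perm:
  assumes "conn \<Phi> A (\<tau> \<circ> \<sigma>)" "bij \<sigma>" "partial_maps \<Phi>"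
  shows "conn \<Phi> A \<tau>"
proof -
  define \<rho> where "\<rho> = inv_into UNIV \<sigma>"
  have \<rho>: "bij \<rho>" "\<sigma> \<circ> \<rho> = id"
    using assms(2) unfolding \<rho>_def by (auto intro: bij_imp_bij_inv simp: bij_is_surj surj_iff[symmetric])
  have "conn \<Phi> (A \<circ> \<rho>) (\<tau> \<circ> \<sigma> \<circ> \<rho>)" using conn_perm assms(1) \<rho>(1) by blast
  then have 1: "conn \<Phi> (A \<circ> \<rho>) \<tau>" by (simp add: comp_assoc \<rho>(2))
  obtain h where h: "h \<in> carrier G0" "tact A h = A \<circ> \<rho>" using A_sym \<rho>(1) by blast
  have "conn \<Phi> A (A \<circ> \<rho>)" using conn_tact[OF A_triple h(1), of \<Phi>] h(2) by simp
  then show ?thesis using conn_trans 1 assms(3) by blast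
qed

text \<open>The normal forms below move a triple by \<open>G0\<close> and rearrange it; centrality
  has to survive both. Here the witness is conjugated by \<open>h\<close>.\<close>

lemma central_tact:
  assumes "central \<Phi> \<tau>" "\<tau> \<in> triples" "h \<in> carrier G0" "partial_maps \<Phi>"
  shows "central \<Phi> (tact \<tau> h)"
  unfolding central_def
proof (intro allI impI)
  fix \<sigma> :: "three \<Rightarrow> three" assume s: "bij \<sigma>" "conn \<Phi> (tact \<tau> h) (tact \<tau> h \<circ> \<sigma>)"
  have c: "conn \<Phi> \<tau> (tact \<tau> h)" using conn_tact assms by blast
  have "conn \<Phi> \<tau> (\<tau> \<circ> \<sigma>)" using conn_perm_iff[OF c s(1) assms(4)] s(2) by blast
  then obtain k where k: "k \<in> carrier G0" "tact \<tau> k = \<tau> \<circ> \<sigma>" using assms(1) s(1) unfolding central_def by blast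
  have "tact (tact \<tau> h) (inv h \<otimes> k \<otimes> h) = tact \<tau> h \<circ> \<sigma>"
    using assms k by (simp add: tact_mult tact_closed tact_inv tact_perm m_assoc)
  then show "\<exists>k\<in>carrier G0. tact (tact \<tau> h) k = tact \<tau> h \<circ> \<sigma>" using assms k by blast
qed

lemma central_perm:
  assumes "central \<Phi> \<tau>" "bij \<pi>"
  shows "central \<Phi> (\<tau> \<circ> \<pi>)"
  unfolding central_def
proof (intro allI impI)
  fix \<sigma> :: "three \<Rightarrow> three" assume s: "bij \<sigma>" "conn \<Phi> (\<tau> \<circ> \<pi>) (\<tau> \<circ> \<pi> \<circ> \<sigma>)"
  define \<rho> where "\<rho> = inv_into UNIV \<pi>"
  have \<rho>: "bij \<rho>" "\<pi> \<circ> \<rho> = id" "\<rho> \<circ> \<pi> = id"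
    using assms(2) unfolding \<rho>_def
    by (auto intro: bij_imp_bij_inv simp: bij_is_surj bij_is_inj surj_iff[symmetric])
  have "conn \<Phi> (\<tau> \<circ> \<pi> \<circ> \<rho>) (\<tau> \<circ> \<pi> \<circ> \<sigma> \<circ> \<rho>)" using conn_perm s(2) \<rho>(1) by blast
  then have "conn \<Phi> \<tau> (\<tau> \<circ> (\<pi> \<circ> \<sigma> \<circ> \<rho>))" by (simp add: comp_assoc \<rho>(2))
  moreover have "bij (\<pi> \<circ> \<sigma> \<circ> \<rho>)" using assms(2) s(1) \<rho>(1) bij_comp by blast
  ultimately obtain k where k: "k \<in> carrier G0" "tact \<tau> k = \<tau> \<circ> (\<pi> \<circ> \<sigma> \<circ> \<rho>)"
    using assms(1) unfolding central_def by blast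
  have "tact (\<tau> \<circ> \<pi>) k = \<tau> \<circ> \<pi> \<circ> \<sigma>"
    unfolding tact_perm k(2) comp_assoc \<rho>(3) by simp
  then show "\<exists>k\<in>carrier G0. tact (\<tau> \<circ> \<pi>) k = \<tau> \<circ> \<pi> \<circ> \<sigma>" using k by blast
qed

lemma triple_perm:
  assumes "\<tau> \<in> triples" "\<tau>' \<in> triples" "range \<tau>' \<subseteq> range \<tau>"
  shows "\<exists>\<pi>. bij \<pi> \<and> \<tau>' = \<tau> \<circ> \<pi>"
proof -
  have "\<forall>i. \<exists>j. \<tau>' i = \<tau> j" using assms(3) by blast
  then obtain \<pi> where p: "\<And>i. \<tau>' i = \<tau> (\<pi> i)" by metis
  have "inj \<tau>'" using assms(2) unfolding triples_def by blast
  then have "inj \<pi>" by (intro injI) (metis p injD)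
  then show ?thesis using bij_three p by (auto simp: fun_eq_iff)
qed

text \<open>As \<^term>\<open>x0\<close> is the only fixed point of \<^term>\<open>t\<close>, it must be fixed by every letter of \<^term>\<open>S\<close>.\<close>

definition \<Phi>0 :: "('e \<times> 'y \<times> 'y) set" where "\<Phi>0 = (\<lambda>s. (s, x0, x0)) ` S"

text \<open>The only point that \<open>\<Phi>0\<close> mentions is \<open>x0\<close>, so no letter
  can move three distinct points. All walks are made by \<open>G0\<close>, where freeness is
  3-sharpness and every triple is central.\<close>

lemma good_\<Phi>0: "good \<Phi>0"
proof -
  have pm: "partial_maps \<Phi>0"
    unfolding partial_maps_def \<Phi>0_def using x0 C_S act_one by auto
  have p: "\<exists>h\<in>carrier G0. g = \<iota> h \<and> \<tau>' = tact \<tau> h" if "path \<Phi>0 \<tau> g \<tau>'" for \<tau> g \<tau>'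
    using that
  proof (induction rule: path.induct)
    case start
    then show ?case using tact_one by (intro bexI[of _ \<one>]) auto
  next
    case (base g \<tau>' h)
    then obtain k where k: "k \<in> carrier G0" "g = \<iota> k" "\<tau>' = tact \<tau> k" by blast
    have "\<tau> \<in> triples" using path_triples[OF base.hyps(1) pm] by blast
    then have "g \<otimes>\<^bsub>G\<^esub> \<iota> h = \<iota> (k \<otimes> h)" "tact \<tau>' h = tact \<tau> (k \<otimes> h)"
      using k base.hyps(2) by (auto simp: \<iota>_mult tact_mult)
    then show ?case using k base.hyps(2) by blast
  next
    case (fwd g \<tau>' e \<tau>'')
    \<comment> \<open>Every pair of \<open>\<Phi>0\<close> is \<open>x0\<close> with itself, so two
      coordinates would coincide.\<close>
    then have "\<tau>' I1 = x0" "\<tau>' I2 = x0" unfolding edge_def \<Phi>0_def by blast+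
    moreover have "inj \<tau>'" using path_triples(3)[OF fwd.hyps(1) pm] unfolding triples_def by blast
    ultimately show ?case by (simp add: inj_three)
  next
    case (bwd g \<tau>' e \<tau>'')
    then have "\<tau>' I1 = x0" "\<tau>' I2 = x0" unfolding edge_def \<Phi>0_def by blast+
    moreover have "inj \<tau>'" using path_triples(3)[OF bwd.hyps(1) pm] unfolding triples_def by blast
    ultimately show ?case by (simp add: inj_three)
  qed
  have "free_on_triples \<Phi>0"
    unfolding free_on_triples_def
  proof (intro allI impI)
    fix \<tau> g assume q: "path \<Phi>0 \<tau> g \<tau>"
    then obtain h where "h \<in> carrier G0" "g = \<iota> h" "\<tau> = tact \<tau> h" using p by blast
    moreover have "\<tau> \<in> triples" using path_triples[OF q pm] by blast
    ultimately show "g = \<one>\<^bsub>G\<^esub>" using sharp by force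
  qed
  moreover have "central \<Phi>0 \<tau>" for \<tau> unfolding central_def conn_def using p by metis
  ultimately show ?thesis using pm conn_refl unfolding good_def by blast
qed

lemma fresh_letter:
  assumes "|\<Phi> - \<Phi>0| <o |R|" "|R| \<le>o |L|"
  shows "\<exists>e\<in>L. \<forall>x y. (e, x, y) \<in> \<Phi> \<longrightarrow> (e, x, y) \<in> \<Phi>0"
proof (rule ccontr)
  assume "\<not> ?thesis"
  \<comment> \<open>Every letter that fails to be fresh is named by some added element.\<close>
  then have "L \<subseteq> fst ` (\<Phi> - \<Phi>0)" by force
  then have "|L| \<le>o |\<Phi> - \<Phi>0|" using card_of_mono1 card_of_image ordLeq_transitive by blast
  then have "|R| <o |R|" using assms ordLeq_ordLess_trans ordLeq_transitive by blast
  then show False using ordLess_irreflexive by blast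
qed

text \<open>A point fixed by \<open>t\<close> lies in no regular orbit; in particular
  \<open>\<Phi>0\<close> touches none of them, large as it is.\<close>

lemma x0_not_free: "r \<in> R \<Longrightarrow> g \<in> carrier G0 \<Longrightarrow> act (b r) g \<noteq> x0"
proof
  assume r: "r \<in> R" "g \<in> carrier G0" "act (b r) g = x0"
  then have "act (b r) (g \<otimes> t) = act (b r) g" using x0 b_closed t act_mult by metis
  then have "g \<otimes> t = g" using b_free[of r r "g \<otimes> t" g] r t by simp
  then show False using r t by simp
qed

text \<open>Each point lies in at most one of the |R| orbits, and fewer than |R| points have been
  touched since \<open>\<Phi>0\<close>.\<close>

lemma fresh_orbit:
  assumes small: "|\<Phi> - \<Phi>0| <o |R|"
  shows "\<exists>r\<in>R. \<forall>g\<in>carrier G0. act (b r) g \<noteq> y \<and>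
    (\<forall>e z. (e, act (b r) g, z) \<notin> \<Phi> \<and> (e, z, act (b r) g) \<notin> \<Phi>)"
proof (rule ccontr)
  assume n: "\<not> ?thesis"
  let ?M = "\<Phi> - \<Phi>0"
  define Z where "Z = {y} \<union> ((\<lambda>p. fst (snd p)) ` ?M \<union> (\<lambda>p. snd (snd p)) ` ?M)"
  \<comment> \<open>The index of the orbit that contains \<open>z\<close>; at points outside these
    orbits the value is irrelevant.\<close>
  define q where "q z = (SOME r. r \<in> R \<and> (\<exists>g\<in>carrier G0. z = act (b r) g))" for z
  have q: "q (act (b r) g) = r" if "r \<in> R" "g \<in> carrier G0" for r g
    unfolding q_def by (rule some_equality) (use that b_free in blast)+
  have "R \<subseteq> q ` Z"
  proof
    fix r assume r: "r \<in> R"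
    then obtain g where g: "g \<in> carrier G0" and
      "act (b r) g = y \<or> (\<exists>e z. (e, act (b r) g, z) \<in> \<Phi> \<or> (e, z, act (b r) g) \<in> \<Phi>)"
      using n by blast
    then have "act (b r) g = y \<or> (\<exists>e z. (e, act (b r) g, z) \<in> ?M \<or> (e, z, act (b r) g) \<in> ?M)"
      using x0_not_free[OF r g] unfolding \<Phi>0_def by blast
    then have "act (b r) g \<in> Z" unfolding Z_def by force
    then show "r \<in> q ` Z" using q[OF r g] by force
  qed
  then have "|R| \<le>o |Z|" using card_of_mono1 card_of_image ordLeq_transitive by blast
  moreover have "|Z| <o |R|"
    unfolding Z_def
    by (intro card_of_Un_ordLess_infinite[OF R_inf] finite_less_infinite[OF _ R_inf]
        ordLeq_ordLess_trans[OF card_of_image small]) simp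
  ultimately show False using ordLeq_ordLess_trans ordLess_irreflexive by blast
qed

text \<open>Neither \<open>a\<close> nor its square fixes a point, and \<open>t\<close> fixes only
  \<open>x0\<close>. So the sole obstruction to extending a letter freely is a letter of
  \<open>S\<close> at \<open>x0\<close>, where \<open>\<Phi>0\<close> has settled its value.\<close>

lemma C_free:
  assumes "e \<in> E" "x \<in> Y" "e \<in> S \<Longrightarrow> x \<noteq> x0" "c \<in> C e" "act x c = x"
  shows "c = \<one>"
  using assms C_R[of e] C_S[of e] C_U[of e] x0_unique a_no_fix aa_no_fix a(1) act_mult[of x a a] by auto

lemma C_finite: "e \<in> E \<Longrightarrow> finite (C e)"
  using C_R[of e] C_S[of e] C_U[of e] by auto

lemma C_one: "e \<in> E \<Longrightarrow> \<one> \<in> C e"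
  using C_R[of e] C_S[of e] C_U[of e] by auto

lemma extend_forward:
  assumes good: "good \<Phi>" and sub: "\<Phi>0 \<subseteq> \<Phi>" and small: "|\<Phi> - \<Phi>0| <o |R|" and e: "e \<in> E" and x: "x \<in> Y"
  shows "\<exists>\<Psi>. good \<Psi> \<and> \<Phi> \<subseteq> \<Psi> \<and> finite (\<Psi> - \<Phi>) \<and> (\<exists>z. (e, x, z) \<in> \<Psi>)"
proof (cases "\<exists>z. (e, x, z) \<in> \<Phi>")
  case True
  then show ?thesis using good by (intro exI[of _ \<Phi>]) auto
next
  case False
  obtain r where r: "r \<in> R" "\<forall>g\<in>carrier G0. act (b r) g \<noteq> x \<and>
    (\<forall>e z. (e, act (b r) g, z) \<notin> \<Phi> \<and> (e, z, act (b r) g) \<notin> \<Phi>)"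
    using fresh_orbit[OF small] by blast
  let ?N = "{(e, act x c, act (b r) c) | c. c \<in> C e}"
  have "good (\<Phi> \<union> ?N)"
  proof (rule good_pendant[OF good e x b_closed[OF r(1)]])
    \<comment> \<open>For a letter of \<open>S\<close> the point \<open>x\<close> is not
      \<open>x0\<close>, since \<open>\<Phi>0\<close> defines the letter there and it is undefined
      at \<open>x\<close>.\<close>
    show "act x c = x \<Longrightarrow> c = \<one>" if "c \<in> C e" for c
      using C_free[OF e x _ that] False sub unfolding \<Phi>0_def by blast
    show "act (b r) g = b r \<Longrightarrow> g = \<one>" if "g \<in> carrier G0" for g
      using b_free[OF r(1) r(1) that one_closed] act_one[OF b_closed[OF r(1)]] by simp
  qed (use False r in blast)+
  moreover have "finite ?N" using C_finite[OF e] by simp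
  then have "finite (\<Phi> \<union> ?N - \<Phi>)" by (simp add: Un_Diff)
  moreover have "(e, x, b r) \<in> ?N" using C_one[OF e] act_one x b_closed[OF r(1)] by force
  ultimately show ?thesis by blast
qed

lemma extend_backward:
  assumes good: "good \<Phi>" and sub: "\<Phi>0 \<subseteq> \<Phi>" and small: "|\<Phi> - \<Phi>0| <o |R|" and e: "e \<in> E" and x: "x \<in> Y"
  shows "\<exists>\<Psi>. good \<Psi> \<and> \<Phi> \<subseteq> \<Psi> \<and> finite (\<Psi> - \<Phi>) \<and> (\<exists>z. (e, z, x) \<in> \<Psi>)"
proof (cases "\<exists>z. (e, z, x) \<in> \<Phi>")
  case True
  then show ?thesis using good by (intro exI[of _ \<Phi>]) auto
next
  case False
  obtain r where r: "r \<in> R" "\<forall>g\<in>carrier G0. act (b r) g \<noteq> x \<and>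
    (\<forall>e z. (e, act (b r) g, z) \<notin> \<Phi> \<and> (e, z, act (b r) g) \<notin> \<Phi>)"
    using fresh_orbit[OF small] by blast
  let ?N = "{(e, act (b r) c, act x c) | c. c \<in> C e}"
  have "good (\<Phi> \<union> ?N)"
  proof (rule good_pendant_backward[OF good e x b_closed[OF r(1)]])
    \<comment> \<open>As in the forward case: \<open>\<Phi>0\<close> makes \<open>x0\<close> an
      image of every letter of \<open>S\<close>, and \<open>x\<close> is not an image.\<close>
    show "act x c = x \<Longrightarrow> c = \<one>" if "c \<in> C e" for c
      using C_free[OF e x _ that] False sub unfolding \<Phi>0_def by blast
    show "act (b r) g = b r \<Longrightarrow> g = \<one>" if "g \<in> carrier G0" for g
      using b_free[OF r(1) r(1) that one_closed] act_one[OF b_closed[OF r(1)]] by simp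
  qed (use False r in blast)+
  moreover have "finite ?N" using C_finite[OF e] by simp
  then have "finite (\<Phi> \<union> ?N - \<Phi>)" by (simp add: Un_Diff)
  moreover have "(e, b r, x) \<in> ?N" using C_one[OF e] act_one x b_closed[OF r(1)] by force
  ultimately show ?thesis by blast
qed

section \<open>Setwise stabilizers of triples and their normal forms\<close>

definition stabilizes :: "(three \<Rightarrow> 'y) \<Rightarrow> 'g \<Rightarrow> bool" where
  "stabilizes \<tau> g \<longleftrightarrow> g \<in> carrier G0 \<and> (\<exists>\<sigma>. bij \<sigma> \<and> tact \<tau> g = \<tau> \<circ> \<sigma>)"

lemma stabilizes_iff:
  assumes "\<tau> \<in> triples" "g \<in> carrier G0"
  shows "stabilizes \<tau> g \<longleftrightarrow> range (tact \<tau> g) \<subseteq> range \<tau>"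
proof
  assume "stabilizes \<tau> g"
  then show "range (tact \<tau> g) \<subseteq> range \<tau>" unfolding stabilizes_def by (metis image_comp image_mono subset_UNIV)
next
  assume "range (tact \<tau> g) \<subseteq> range \<tau>"
  then show "stabilizes \<tau> g"
    using triple_perm[OF assms(1) tact_closed[OF assms]] assms(2) unfolding stabilizes_def by blast
qed

lemma stabilizes_perm:
  assumes "\<tau> \<in> triples" "bij \<pi>"
  shows "stabilizes (\<tau> \<circ> \<pi>) g \<longleftrightarrow> stabilizes \<tau> g"
proof (cases "g \<in> carrier G0")
  case True
  have "range (f \<circ> \<pi>) = range f" for f :: "three \<Rightarrow> 'y"
    using bij_is_surj[OF assms(2)] by (metis image_comp)
  then show ?thesis
    using stabilizes_iff[OF assms(1) True] stabilizes_iff[OF triples_perm[OF assms] True]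
    by (simp add: tact_perm)
next
  case False
  then show ?thesis unfolding stabilizes_def by blast
qed

lemma stabilizes_tact:
  assumes "\<tau> \<in> triples" "h \<in> carrier G0" "stabilizes (tact \<tau> h) g"
  shows "stabilizes \<tau> (h \<otimes> g \<otimes> inv h)"
proof -
  obtain \<sigma> where g: "g \<in> carrier G0" "bij \<sigma>" "tact (tact \<tau> h) g = tact \<tau> h \<circ> \<sigma>"
    using assms(3) unfolding stabilizes_def by blast
  have "tact \<tau> (h \<otimes> g \<otimes> inv h) = tact (tact (tact \<tau> h) g) (inv h)"
    using assms g by (simp add: tact_mult tact_closed m_assoc)
  also have "\<dots> = \<tau> \<circ> \<sigma>" unfolding g(3) tact_perm using assms by (simp add: tact_inv)
  finally show ?thesis using g assms unfolding stabilizes_def by blast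
qed

lemma stabilizes_conj:
  assumes "\<tau> \<in> triples" "h \<in> carrier G0" "k \<in> carrier G0" "stabilizes \<tau> (inv h \<otimes> k \<otimes> h)"
  shows "stabilizes (tact \<tau> (inv h)) k"
proof -
  obtain \<sigma> where g: "bij \<sigma>" "tact \<tau> (inv h \<otimes> k \<otimes> h) = \<tau> \<circ> \<sigma>"
    using assms(4) unfolding stabilizes_def by blast
  have "tact (tact \<tau> (inv h)) k = tact (tact \<tau> (inv h \<otimes> k \<otimes> h)) (inv h)"
    using assms by (simp add: tact_mult tact_inv tact_closed)
  also have "\<dots> = tact \<tau> (inv h) \<circ> \<sigma>" unfolding g(2) tact_perm ..
  finally show ?thesis using g assms unfolding stabilizes_def by blast
qed

definition has_order3 :: "(three \<Rightarrow> 'y) \<Rightarrow> bool" where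
  "has_order3 \<tau> \<longleftrightarrow> (\<exists>g. stabilizes \<tau> g \<and> g \<noteq> \<one> \<and> g \<otimes> g \<otimes> g = \<one>)"

lemma has_order3_perm: "\<lbrakk>\<tau> \<in> triples; bij \<pi>; has_order3 (\<tau> \<circ> \<pi>)\<rbrakk> \<Longrightarrow> has_order3 \<tau>"
  unfolding has_order3_def using stabilizes_perm by blast

lemma has_order3_tact:
  assumes "\<tau> \<in> triples" "h \<in> carrier G0" "has_order3 (tact \<tau> h)"
  shows "has_order3 \<tau>"
proof -
  obtain g where g: "stabilizes (tact \<tau> h) g" "g \<noteq> \<one>" "g \<otimes> g \<otimes> g = \<one>"
    using assms unfolding has_order3_def by blast
  have c: "g \<in> carrier G0" using g unfolding stabilizes_def by blast
  have "(h \<otimes> g \<otimes> inv h) \<otimes> (h \<otimes> g \<otimes> inv h) \<otimes> (h \<otimes> g \<otimes> inv h) = h \<otimes> (g \<otimes> g \<otimes> g) \<otimes> inv h"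
    using c assms by (simp add: m_assoc inv_solve_left')
  then have 3: "(h \<otimes> g \<otimes> inv h) \<otimes> (h \<otimes> g \<otimes> inv h) \<otimes> (h \<otimes> g \<otimes> inv h) = \<one>"
    using g assms by simp
  have "h \<otimes> g \<otimes> inv h \<noteq> \<one>"
  proof
    assume "h \<otimes> g \<otimes> inv h = \<one>"
    then have "h \<otimes> g = h" using c assms by (metis inv_closed inv_equality inv_inv m_closed)
    then show False using g(2) c assms by simp
  qed
  then show ?thesis using stabilizes_tact[OF assms(1,2) g(1)] 3 unfolding has_order3_def by blast
qed

text \<open>By 3-sharpness an element of \<open>G0\<close> that induces the identity on a triple is
  trivial, so the order of the permutation is the order of the element. The same holds for order two
  below.\<close>

lemma realized_order3:
  assumes "\<tau> \<in> triples" "realized \<tau> \<sigma>" "bij \<sigma>" "\<sigma> \<circ> \<sigma> \<circ> \<sigma> = id" "\<sigma> \<noteq> id"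
  shows "has_order3 \<tau>"
proof -
  obtain g where g: "g \<in> carrier G0" "tact \<tau> g = \<tau> \<circ> \<sigma>" using assms unfolding realized_def by blast
  have "tact \<tau> (g \<otimes> g \<otimes> g) = \<tau> \<circ> (\<sigma> \<circ> \<sigma> \<circ> \<sigma>)"
    using assms(1) g by (simp add: tact_mult tact_perm comp_assoc)
  then have "g \<otimes> g \<otimes> g = \<one>" using sharp assms g by simp
  moreover have "g \<noteq> \<one>"
  proof
    assume "g = \<one>"
    then have "\<tau> \<circ> \<sigma> = \<tau>" using g tact_one assms by simp
    then have "\<sigma> = id" using assms(1) unfolding triples_def by (auto simp: fun_eq_iff inj_eq)
    then show False using assms by blast
  qed
  ultimately show ?thesis using g assms unfolding has_order3_def stabilizes_def by blast
qed

definition has_order2 :: "(three \<Rightarrow> 'y) \<Rightarrow> bool" where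
  "has_order2 \<tau> \<longleftrightarrow> (\<exists>g. stabilizes \<tau> g \<and> g \<noteq> \<one> \<and> g \<otimes> g = \<one>)"

lemma realized_order2:
  assumes "\<tau> \<in> triples" "realized \<tau> \<sigma>" "bij \<sigma>" "\<sigma> \<circ> \<sigma> = id" "\<sigma> \<noteq> id"
  shows "has_order2 \<tau>"
proof -
  obtain g where g: "g \<in> carrier G0" "tact \<tau> g = \<tau> \<circ> \<sigma>" using assms unfolding realized_def by blast
  have "tact \<tau> (g \<otimes> g) = \<tau> \<circ> (\<sigma> \<circ> \<sigma>)"
    using assms(1) g by (simp add: tact_mult tact_perm comp_assoc)
  then have "g \<otimes> g = \<one>" using sharp assms g by simp
  moreover have "g \<noteq> \<one>"
  proof
    assume "g = \<one>"
    then have "\<tau> \<circ> \<sigma> = \<tau>" using g tact_one assms by simp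
    then have "\<sigma> = id" using assms(1) unfolding triples_def by (auto simp: fun_eq_iff inj_eq)
    then show False using assms by blast
  qed
  ultimately show ?thesis using g assms unfolding has_order2_def stabilizes_def by blast
qed

lemma rot_swap23_relations:
  "rot \<circ> rot \<circ> (rot \<circ> rot) \<circ> (rot \<circ> rot) = id" "rot \<circ> rot \<noteq> id" "rot \<noteq> id" "swap23 \<noteq> id"
  "(rot \<circ> swap23) \<circ> (rot \<circ> swap23) = id" "rot \<circ> swap23 \<noteq> id"
  "(rot \<circ> rot \<circ> swap23) \<circ> (rot \<circ> rot \<circ> swap23) = id" "rot \<circ> rot \<circ> swap23 \<noteq> id"
  "(rot \<circ> rot) \<circ> (rot \<circ> swap23) = swap23" "rot \<circ> (rot \<circ> rot \<circ> swap23) = swap23"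
  "rot \<circ> swap23 \<circ> swap23 = rot" "rot \<circ> rot \<circ> swap23 \<circ> swap23 = rot \<circ> rot"
  by (auto simp: fun_eq_iff all_three)

lemma bij_rot_rot: "bij (rot \<circ> rot)" "bij (rot \<circ> swap23)" "bij (rot \<circ> rot \<circ> swap23)"
  using bij_rot bij_swap23 bij_comp by blast+

text \<open>After conjugation the triple is invariant under \<open>a\<close>. As \<open>a\<close>
  moves every point of \<open>Y\<close>, the triple is a single orbit of \<open>a\<close>, and
  listing it as such makes \<open>a\<close> act by \<open>rot\<close>, just as on
  \<open>A\<close>.\<close>

lemma order3_normal_form:
  assumes \<tau>: "\<tau> \<in> triples" and 3: "has_order3 \<tau>"
  shows "\<exists>h\<in>carrier G0. \<exists>\<pi>. bij \<pi> \<and> tact (tact \<tau> h \<circ> \<pi>) a = tact \<tau> h \<circ> \<pi> \<circ> rot"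
proof -
  obtain g where g: "stabilizes \<tau> g" "g \<noteq> \<one>" "g \<otimes> g \<otimes> g = \<one>"
    using 3 unfolding has_order3_def by blast
  then obtain k where k: "k \<in> carrier G0" "g = inv k \<otimes> a \<otimes> k"
    using conj_a unfolding stabilizes_def by blast
  define \<tau>1 where "\<tau>1 = tact \<tau> (inv k)"
  have t1: "\<tau>1 \<in> triples" unfolding \<tau>1_def using \<tau> k tact_closed by simp
  have "stabilizes \<tau>1 a" unfolding \<tau>1_def using stabilizes_conj[OF \<tau> k(1) a(1)] g k by simp
  then obtain \<sigma> where s: "tact \<tau>1 a = \<tau>1 \<circ> \<sigma>" unfolding stabilizes_def by blast
  have s': "act (\<tau>1 i) a = \<tau>1 (\<sigma> i)" for i using fun_cong[OF s, of i] by (simp add: tact_def)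
  define x where "x = \<tau>1 I1"
  have x: "x \<in> Y" unfolding x_def using triplesD t1 by blast
  define \<tau>2 where "\<tau>2 = case_three x (act x a) (act (act x a) a)"
  have t2: "\<tau>2 \<in> triples" unfolding \<tau>2_def using orbit_a_triple x by blast
  \<comment> \<open>The triple is closed under \<open>a\<close>, so it contains the orbit of its
    first point, which has three elements.\<close>
  have "range \<tau>2 \<subseteq> range \<tau>1"
    unfolding \<tau>2_def x_def s' by (auto split: three.splits)
  then obtain \<pi> where p: "bij \<pi>" "\<tau>2 = \<tau>1 \<circ> \<pi>" using triple_perm[OF t1 t2] by blast
  have "tact \<tau>2 a = \<tau>2 \<circ> rot"
    unfolding \<tau>2_def using x by (simp add: fun_eq_iff all_three tact_def act_aaa)
  then show ?thesis using k p unfolding \<tau>1_def by (metis inv_closed)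
qed

text \<open>After conjugation \<open>t\<close> permutes the triple. An involution of three positions
  has a fixed one, whose point must be \<open>x0\<close>. Putting it first aligns it with the first
  point of \<open>A\<close>, so that the joining letter of \<open>S\<close> sends \<open>x0\<close>
  to \<open>x0\<close>, as it is forced to.\<close>

lemma order2_normal_form:
  assumes \<tau>: "\<tau> \<in> triples" and 2: "has_order2 \<tau>"
  shows "\<exists>h\<in>carrier G0. \<exists>\<pi>. bij \<pi> \<and> (tact \<tau> h \<circ> \<pi>) I1 = x0 \<and>
    tact (tact \<tau> h \<circ> \<pi>) t = tact \<tau> h \<circ> \<pi> \<circ> swap23"
proof -
  obtain g where g: "stabilizes \<tau> g" "g \<noteq> \<one>" "g \<otimes> g = \<one>"
    using 2 unfolding has_order2_def by blast
  then obtain k where k: "k \<in> carrier G0" "g = inv k \<otimes> t \<otimes> k"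
    using conj_t unfolding stabilizes_def by blast
  define \<tau>1 where "\<tau>1 = tact \<tau> (inv k)"
  have t1: "\<tau>1 \<in> triples" unfolding \<tau>1_def using \<tau> k tact_closed by simp
  have inj: "\<tau>1 i = \<tau>1 j \<longleftrightarrow> i = j" for i j using t1 unfolding triples_def by (auto simp: inj_eq)
  have "stabilizes \<tau>1 t" unfolding \<tau>1_def using stabilizes_conj[OF \<tau> k(1) t(1)] g k by simp
  then obtain \<sigma> where s: "tact \<tau>1 t = \<tau>1 \<circ> \<sigma>" unfolding stabilizes_def by blast
  have s': "act (\<tau>1 i) t = \<tau>1 (\<sigma> i)" for i using fun_cong[OF s, of i] by (simp add: tact_def)
  have "\<tau>1 (\<sigma> (\<sigma> i)) = \<tau>1 i" for i using act_tt[OF triplesD[OF t1, of i]] s' by simp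
  then have ss: "\<sigma> (\<sigma> i) = i" for i using inj by blast
  have "\<exists>i. \<sigma> i = i"
    using ss[of I1] ss[of I2] ss[of I3] unfolding ex_three
    by (cases "\<sigma> I1"; cases "\<sigma> I2"; cases "\<sigma> I3") auto
  then obtain i where i: "\<sigma> i = i" by blast
  \<comment> \<open>As \<open>x0\<close> occurs only once in the triple, every position other than
    \<open>i\<close> is moved; so \<open>j\<close> and its image are the two exchanged
    positions.\<close>
  have fixpt: "\<tau>1 j = x0 \<longleftrightarrow> \<sigma> j = j" for j
    using x0_unique[OF triplesD[OF t1, of j]] s'[of j] x0(2) inj by metis
  have xi: "\<tau>1 i = x0" using fixpt i by blast
  obtain j where j: "j \<noteq> i" using three.distinct by metis
  have "\<tau>1 j \<noteq> x0" using j xi inj by metis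
  then have "\<sigma> j \<noteq> j" using fixpt by blast
  moreover have "\<sigma> j \<noteq> i" using ss[of j] i j by metis
  ultimately have "inj (case_three i j (\<sigma> j))" using j by (auto simp: inj_three)
  then have p: "bij (case_three i j (\<sigma> j))" by (rule bij_three)
  have "tact (\<tau>1 \<circ> case_three i j (\<sigma> j)) t = \<tau>1 \<circ> case_three i j (\<sigma> j) \<circ> swap23"
    using s' i ss by (simp add: fun_eq_iff all_three tact_def)
  then show ?thesis using k p xi unfolding \<tau>1_def by (metis comp_apply inv_closed three.case(1))
qed

text \<open>Centrality turns connections from \<open>B\<close> to its rearrangements into elements
  of \<open>G0\<close>, so only the stabilizer in \<open>G0\<close> has to be matched with
  \<open>C e\<close>.\<close>

lemma join_central:
  assumes good: "good \<Phi>" and B: "B \<in> triples" and central: "central \<Phi> B" and n: "\<not> conn \<Phi> A B"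
    and e: "e \<in> E" and fresh: "\<And>x y. (e, x, y) \<in> \<Phi> \<Longrightarrow> \<exists>i. x = A i \<and> y = B i"
    and real: "\<And>\<sigma>. bij \<sigma> \<Longrightarrow> realized B \<sigma> \<Longrightarrow> \<exists>c\<in>C e. tact A c = A \<circ> \<sigma> \<and> tact B c = B \<circ> \<sigma>"
    and C_perm: "\<And>c. c \<in> C e \<Longrightarrow> \<exists>\<sigma>. bij \<sigma> \<and> tact A c = A \<circ> \<sigma> \<and> tact B c = B \<circ> \<sigma>"
  shows "\<exists>\<Psi>. good \<Psi> \<and> \<Phi> \<subseteq> \<Psi> \<and> finite (\<Psi> - \<Phi>) \<and> conn \<Psi> A B"
proof -
  let ?N = "range (\<lambda>i. (e, A i, B i))"
  have stab: "\<exists>c\<in>C e. tact A c = A \<circ> \<sigma> \<and> tact B c = B \<circ> \<sigma>" if "bij \<sigma>" "conn \<Phi> B (B \<circ> \<sigma>)" for \<sigma>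
    using that real central unfolding central_def realized_def by blast
  note join = good_join[OF good e A_triple B n A_sym fresh stab C_perm]
  have "good (\<Phi> \<union> ?N)" "conn (\<Phi> \<union> ?N) A B" by (rule join; assumption)+
  moreover have "finite (\<Phi> \<union> ?N - \<Phi>)" by (simp add: Un_Diff)
  ultimately show ?thesis by blast
qed

text \<open>The stabilizer is a subgroup of S_3, and asking for elements of order 3 and 2 tells
  which one. Elements of order 3 are treated first: once the triple is an orbit of \<open>a\<close>,
  its stabilizer is either <a> or all of S_3, and in the latter case the triple is already connected
  to \<open>A\<close>.\<close>

lemma join_triple_normal:
  assumes good: "good \<Phi>" and sub: "\<Phi>0 \<subseteq> \<Phi>" and small: "|\<Phi> - \<Phi>0| <o |R|"
    and \<tau>: "\<tau> \<in> triples" and cen: "central \<Phi> \<tau>"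
  shows "\<exists>\<Psi> \<pi>. \<exists>h\<in>carrier G0. bij \<pi> \<and> good \<Psi> \<and> \<Phi> \<subseteq> \<Psi> \<and> finite (\<Psi> - \<Phi>) \<and> conn \<Psi> A (tact \<tau> h \<circ> \<pi>)"
proof -
  have pm: "partial_maps \<Phi>" using good unfolding good_def by blast
  have norm: "tact \<tau> h \<circ> \<pi> \<in> triples" "central \<Phi> (tact \<tau> h \<circ> \<pi>)"
    if "h \<in> carrier G0" "bij \<pi>" for h \<pi>
    using triples_perm[OF tact_closed] central_perm[OF central_tact] \<tau> cen pm that by blast+
  have already: ?thesis if "conn \<Phi> A (tact \<tau> h \<circ> \<pi>)" "h \<in> carrier G0" "bij \<pi>" for h \<pi>
    using that good by (metis Diff_cancel finite.emptyI subset_refl)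
  consider (three) "has_order3 \<tau>" | (two) "\<not> has_order3 \<tau>" "has_order2 \<tau>"
    | (one) "\<not> has_order3 \<tau>" "\<not> has_order2 \<tau>" by blast
  then show ?thesis
  proof cases
    case three
    then obtain h \<pi> where h: "h \<in> carrier G0" "bij \<pi>"
      "tact (tact \<tau> h \<circ> \<pi>) a = tact \<tau> h \<circ> \<pi> \<circ> rot"
      using order3_normal_form[OF \<tau>] by blast
    define B where "B = tact \<tau> h \<circ> \<pi>"
    have B: "B \<in> triples" "central \<Phi> B" "tact B a = B \<circ> rot" unfolding B_def using norm h by auto
    have rr: "realized B rot" using B(3) a(1) unfolding realized_def by blast
    have tact_aa: "tact \<upsilon> (a \<otimes> a) = \<upsilon> \<circ> (rot \<circ> rot)" if "\<upsilon> \<in> triples" "tact \<upsilon> a = \<upsilon> \<circ> rot" for \<upsilon>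
      using that a(1) by (simp add: tact_mult tact_perm comp_assoc)
    show ?thesis
    proof (cases "conn \<Phi> A B")
      case True
      then show ?thesis using already h unfolding B_def by blast
    next
      case False
      \<comment> \<open>A transposition together with \<open>rot\<close> would realize all
        rearrangements; then \<open>full_stabilizer\<close> would make \<open>B\<close> a translate
        of \<open>A\<close>, hence connected to it.\<close>
      have not_swap: "\<not> realized B swap23"
      proof
        assume "realized B swap23"
        then have "\<exists>g\<in>carrier G0. tact A g = B"
          unfolding A_def using full_stabilizer[OF B(1)] realized_all[OF B(1) rr] unfolding realized_def by blast
        then show False using False conn_tact[OF A_triple, of _ \<Phi>] by blast
      qed
      obtain e where e: "e \<in> U" "\<And>x y. (e, x, y) \<in> \<Phi> \<Longrightarrow> (e, x, y) \<in> \<Phi>0"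
        using fresh_letter[OF small card_U(1)] by blast
      have fresh: "(e, x, y) \<notin> \<Phi>" for x y using e disj unfolding \<Phi>0_def by blast
      have Ce: "C e = {\<one>, a, a \<otimes> a}" using C_U e by blast
      have "\<exists>\<Psi>. good \<Psi> \<and> \<Phi> \<subseteq> \<Psi> \<and> finite (\<Psi> - \<Phi>) \<and> conn \<Psi> A B"
      proof (rule join_central[OF good B(1,2) False])
        show "e \<in> E" using e by blast
      next
        fix x y assume "(e, x, y) \<in> \<Phi>"
        then show "\<exists>i. x = A i \<and> y = B i" using fresh by blast
      next
        fix \<sigma> assume s: "bij \<sigma>" "realized B \<sigma>"
        have "realized B (rot \<circ> rot)" using realized_comp B(1) rr by blast
        \<comment> \<open>The other transpositions become \<open>swap23\<close> after composition
          with a rotation, and rotations are realized.\<close>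
        then have "\<sigma> \<noteq> swap23" "\<sigma> \<noteq> rot \<circ> swap23" "\<sigma> \<noteq> rot \<circ> rot \<circ> swap23"
          using not_swap s(2) realized_comp[OF B(1)] rr rot_swap23_relations(9,10) by metis+
        then consider "\<sigma> = id" | "\<sigma> = rot" | "\<sigma> = rot \<circ> rot" using bij_three_cases[OF s(1)] by blast
        then show "\<exists>c\<in>C e. tact A c = A \<circ> \<sigma> \<and> tact B c = B \<circ> \<sigma>"
        proof cases
          case 1
          then show ?thesis unfolding Ce using tact_one A_triple B(1) by simp
        next
          case 2
          then show ?thesis unfolding Ce using tact_A_a B(3) by simp
        next
          case 3
          then show ?thesis unfolding Ce using tact_aa[OF A_triple tact_A_a] tact_aa[OF B(1,3)] by simp
        qed
      next
        fix c assume "c \<in> C e"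
        then consider "c = \<one>" | "c = a" | "c = a \<otimes> a" unfolding Ce by blast
        then show "\<exists>\<sigma>. bij \<sigma> \<and> tact A c = A \<circ> \<sigma> \<and> tact B c = B \<circ> \<sigma>"
        proof cases
          case 1
          then show ?thesis using tact_one A_triple B(1) by (intro exI[of _ id]) simp
        next
          case 2
          then show ?thesis using tact_A_a B(3) bij_rot by blast
        next
          case 3
          then show ?thesis using tact_aa[OF A_triple tact_A_a] tact_aa[OF B(1,3)] bij_rot_rot by blast
        qed
      qed
      then show ?thesis using h unfolding B_def by blast
    qed
  next
    case two
    then obtain h \<pi> where h: "h \<in> carrier G0" "bij \<pi>" "(tact \<tau> h \<circ> \<pi>) I1 = x0"
      "tact (tact \<tau> h \<circ> \<pi>) t = tact \<tau> h \<circ> \<pi> \<circ> swap23"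
      using order2_normal_form[OF \<tau>] by blast
    define B where "B = tact \<tau> h \<circ> \<pi>"
    have B: "B \<in> triples" "central \<Phi> B" "tact B t = B \<circ> swap23" "B I1 = x0"
      unfolding B_def using norm h by auto
    have n3: "\<not> has_order3 B"
      using two(1) has_order3_perm[OF tact_closed[OF \<tau> h(1)] h(2)] has_order3_tact[OF \<tau> h(1)]
      unfolding B_def by blast
    have rs: "realized B swap23" using B(3) t(1) unfolding realized_def by blast
    show ?thesis
    proof (cases "conn \<Phi> A B")
      case True
      then show ?thesis using already h unfolding B_def by blast
    next
      case False
      obtain e where e: "e \<in> S" "\<And>x y. (e, x, y) \<in> \<Phi> \<Longrightarrow> (e, x, y) \<in> \<Phi>0"
        using fresh_letter[OF small card_S(1)] by blast
      have Ce: "C e = {\<one>, t}" using C_S e by blast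
      have "\<exists>\<Psi>. good \<Psi> \<and> \<Phi> \<subseteq> \<Psi> \<and> finite (\<Psi> - \<Phi>) \<and> conn \<Psi> A B"
      proof (rule join_central[OF good B(1,2) False])
        show "e \<in> E" using e by blast
      next
        fix x y assume "(e, x, y) \<in> \<Phi>"
        then have "x = A I1 \<and> y = B I1" using e B(4) unfolding \<Phi>0_def by auto
        then show "\<exists>i. x = A i \<and> y = B i" by blast
      next
        fix \<sigma> assume s: "bij \<sigma>" "realized B \<sigma>"
        have nr: "\<not> realized B rot" "\<not> realized B (rot \<circ> rot)"
          using n3 realized_order3[OF B(1)] bij_rot bij_rot_rot rot3 rot_swap23_relations by blast+
        \<comment> \<open>A second transposition, composed with \<open>swap23\<close>, would be a
          rotation and yield an element of order 3.\<close>
        then have "\<sigma> \<noteq> rot" "\<sigma> \<noteq> rot \<circ> rot" "\<sigma> \<noteq> rot \<circ> swap23" "\<sigma> \<noteq> rot \<circ> rot \<circ> swap23"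
          using s(2) realized_comp[OF B(1) _ rs] rot_swap23_relations(11,12) by metis+
        then consider "\<sigma> = id" | "\<sigma> = swap23" using bij_three_cases[OF s(1)] by blast
        then show "\<exists>c\<in>C e. tact A c = A \<circ> \<sigma> \<and> tact B c = B \<circ> \<sigma>"
        proof cases
          case 1
          then show ?thesis unfolding Ce using tact_one A_triple B(1) by simp
        next
          case 2
          then show ?thesis unfolding Ce using tact_A_t B(3) by simp
        qed
      next
        fix c assume "c \<in> C e"
        then consider "c = \<one>" | "c = t" unfolding Ce by blast
        then show "\<exists>\<sigma>. bij \<sigma> \<and> tact A c = A \<circ> \<sigma> \<and> tact B c = B \<circ> \<sigma>"
        proof cases
          case 1
          then show ?thesis using tact_one A_triple B(1) by (intro exI[of _ id]) simp
        next
          case 2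
          then show ?thesis using tact_A_t B(3) bij_swap23 by blast
        qed
      qed
      then show ?thesis using h unfolding B_def by blast
    qed
  next
    case one
    define B where "B = tact \<tau> \<one> \<circ> id"
    have B: "B = \<tau>" unfolding B_def using tact_one \<tau> by simp
    show ?thesis
    proof (cases "conn \<Phi> A \<tau>")
      case True
      then show ?thesis using already[of \<one> id] B unfolding B_def by simp
    next
      case False
      obtain e where e: "e \<in> R" "\<And>x y. (e, x, y) \<in> \<Phi> \<Longrightarrow> (e, x, y) \<in> \<Phi>0"
        using fresh_letter[OF small, of R] ordLeq_refl[OF card_of_Card_order] by blast
      have fresh: "(e, x, y) \<notin> \<Phi>" for x y using e disj unfolding \<Phi>0_def by blast
      have Ce: "C e = {\<one>}" using C_R e by blast
      have "\<exists>\<Psi>. good \<Psi> \<and> \<Phi> \<subseteq> \<Psi> \<and> finite (\<Psi> - \<Phi>) \<and> conn \<Psi> A \<tau>"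
      proof (rule join_central[OF good \<tau> cen False])
        show "e \<in> E" using e by blast
      next
        fix x y assume "(e, x, y) \<in> \<Phi>"
        then show "\<exists>i. x = A i \<and> y = \<tau> i" using fresh by blast
      next
        fix \<sigma> assume s: "bij \<sigma>" "realized \<tau> \<sigma>"
        have "\<sigma> = id"
        proof (rule ccontr)
          assume ni: "\<sigma> \<noteq> id"
          \<comment> \<open>Every permutation of three positions other than the identity has order 2
            or 3.\<close>
          have "\<sigma> \<circ> \<sigma> \<circ> \<sigma> \<noteq> id" "\<sigma> \<circ> \<sigma> \<noteq> id"
            using one realized_order3[OF \<tau> s(2,1)] realized_order2[OF \<tau> s(2,1)] ni by blast+
          then show False
            using bij_three_cases[OF s(1)] ni rot3 swap23_2 rot_swap23_relations(1,5,7) by auto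
        qed
        then show "\<exists>c\<in>C e. tact A c = A \<circ> \<sigma> \<and> tact \<tau> c = \<tau> \<circ> \<sigma>"
          unfolding Ce using tact_one A_triple \<tau> by simp
      next
        fix c assume "c \<in> C e"
        then show "\<exists>\<sigma>. bij \<sigma> \<and> tact A c = A \<circ> \<sigma> \<and> tact \<tau> c = \<tau> \<circ> \<sigma>"
          unfolding Ce using tact_one A_triple \<tau> by (intro exI[of _ id]) simp
      qed
      then show ?thesis using B unfolding B_def by (metis bij_id one_closed)
    qed
  qed
qed

text \<open>The given triple is exchanged for a central one of its class. That one is joined after a
  motion by \<open>G0\<close> and a rearrangement: the motion is itself a walk, and the symmetry of
  \<open>A\<close> absorbs the rearrangement.\<close>

lemma join_triple:
  assumes good: "good \<Phi>" and sub: "\<Phi>0 \<subseteq> \<Phi>" and small: "|\<Phi> - \<Phi>0| <o |R|" and \<tau>: "\<tau> \<in> triples"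
  shows "\<exists>\<Psi>. good \<Psi> \<and> \<Phi> \<subseteq> \<Psi> \<and> finite (\<Psi> - \<Phi>) \<and> conn \<Psi> A \<tau>"
proof -
  have pm: "partial_maps \<Phi>" using good unfolding good_def by blast
  obtain \<tau>' where t': "conn \<Phi> \<tau> \<tau>'" "central \<Phi> \<tau>'" using good \<tau> unfolding good_def by blast
  have T: "\<tau>' \<in> triples" using conn_triples[OF t'(1) pm] by blast
  obtain \<Psi> \<pi> h where h: "h \<in> carrier G0" "bij \<pi>" "good \<Psi>" "\<Phi> \<subseteq> \<Psi>" "finite (\<Psi> - \<Phi>)"
    "conn \<Psi> A (tact \<tau>' h \<circ> \<pi>)"
    using join_triple_normal[OF good sub small T t'(2)] by blast
  have pm': "partial_maps \<Psi>" using h(3) unfolding good_def by blast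
  have 1: "conn \<Psi> A (tact \<tau>' h)" using conn_A_perm[OF h(6,2) pm'] .
  have 2: "conn \<Psi> \<tau> (tact \<tau>' h)"
    using conn_trans[OF conn_mono[OF t'(1) h(4)] conn_tact[OF T h(1)] pm'] .
  show ?thesis using conn_trans[OF 1 conn_sym[OF 2 pm'] pm'] h(3-5) by blast
qed

section \<open>Bookkeeping: at most |R| tasks\<close>

definition task_done :: "('e \<times> bool \<times> 'y) + (three \<Rightarrow> 'y) \<Rightarrow> ('e \<times> 'y \<times> 'y) set \<Rightarrow> bool" where
  "task_done k \<Phi> = (case k of
      Inl (e, d, x) \<Rightarrow> (if d then \<exists>z. (e, x, z) \<in> \<Phi> else \<exists>z. (e, z, x) \<in> \<Phi>)
    | Inr \<tau> \<Rightarrow> conn \<Phi> A \<tau>)"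

lemma card_Times_R: "\<lbrakk>|P| \<le>o |R|; |Q| \<le>o |R|\<rbrakk> \<Longrightarrow> |P \<times> Q| \<le>o |R|"
  by (rule card_of_Times_ordLeq_infinite_Field) (use R_inf in \<open>auto simp: Field_card_of card_of_card_order_on\<close>)

lemma card_Un_R: "\<lbrakk>|P| \<le>o |R|; |Q| \<le>o |R|\<rbrakk> \<Longrightarrow> |P \<union> Q| \<le>o |R|"
  by (rule card_of_Un_ordLeq_infinite_Field) (use R_inf in \<open>auto simp: Field_card_of card_of_card_order_on\<close>)

lemma card_triples: "|triples| \<le>o |R|"
proof -
  have "inj_on (\<lambda>\<tau>. (\<tau> I1, \<tau> I2, \<tau> I3)) triples"
    by (auto simp: inj_on_def fun_eq_iff all_three)
  moreover have "(\<lambda>\<tau>. (\<tau> I1, \<tau> I2, \<tau> I3)) ` triples \<subseteq> Y \<times> Y \<times> Y"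
    using triplesD by auto
  ultimately have "|triples| \<le>o |Y \<times> Y \<times> Y|" using card_of_ordLeq by blast
  then show ?thesis by (rule ordLeq_transitive[OF _ card_Times_R[OF card_Y card_Times_R[OF card_Y card_Y]]])
qed

lemma card_tasks: "|Inl ` (E \<times> (UNIV :: bool set) \<times> Y) \<union> Inr ` triples| \<le>o |R|"
proof -
  have "|R| \<le>o |R|" using card_of_mono1 by blast
  then have E: "|E| \<le>o |R|" by (intro card_Un_R card_S card_U)
  have "|UNIV :: bool set| \<le>o |R|" using R_inf finite_less_infinite[OF finite] ordLess_imp_ordLeq by blast
  then have "|E \<times> (UNIV :: bool set) \<times> Y| \<le>o |R|" by (intro card_Times_R E card_Y)
  then show ?thesis
    by (intro card_Un_R ordLeq_transitive[OF card_of_image] card_triples)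
qed

theorem total_extension:
  "\<exists>\<Phi>. good \<Phi> \<and> (\<forall>e\<in>E. \<forall>x\<in>Y. (\<exists>z. (e, x, z) \<in> \<Phi>) \<and> (\<exists>z. (e, z, x) \<in> \<Phi>)) \<and>
    (\<forall>\<tau>\<in>triples. conn \<Phi> A \<tau>)"
proof -
  let ?T = "Inl ` (E \<times> (UNIV :: bool set) \<times> Y) \<union> Inr ` triples"
  have "\<exists>\<Phi>. good \<Phi> \<and> \<Phi>0 \<subseteq> \<Phi> \<and> (\<forall>k\<in>?T. task_done k \<Phi>)"
  proof (rule transfinite_tasks[OF good_\<Phi>0 good_Union_chain _ _ R_inf card_tasks])
    fix \<Phi> k assume \<Phi>: "good \<Phi>" "\<Phi>0 \<subseteq> \<Phi>" "|\<Phi> - \<Phi>0| <o |R|" and k: "k \<in> ?T"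
    from k consider e x where "k = Inl (e, True, x)" "e \<in> E" "x \<in> Y"
      | e x where "k = Inl (e, False, x)" "e \<in> E" "x \<in> Y" | \<tau> where "k = Inr \<tau>" "\<tau> \<in> triples"
      by (auto; metis (full_types))
    then show "\<exists>\<Psi>. good \<Psi> \<and> \<Phi> \<subseteq> \<Psi> \<and> finite (\<Psi> - \<Phi>) \<and> task_done k \<Psi>"
    proof cases
      case 1
      then show ?thesis using extend_forward[OF \<Phi> 1(2,3)] by (simp add: task_done_def)
    next
      case 2
      then show ?thesis using extend_backward[OF \<Phi> 2(2,3)] by (simp add: task_done_def)
    next
      case 3
      then show ?thesis using join_triple[OF \<Phi> 3(2)] by (simp add: task_done_def)
    qed
  next
    fix \<Phi> \<Psi> k assume "task_done k \<Phi>" "\<Phi> \<subseteq> \<Psi>"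
    then show "task_done k \<Psi>"
      unfolding task_done_def using conn_mono by (auto split: sum.splits if_splits)
  qed
  then obtain \<Phi> where \<Phi>: "good \<Phi>" and T: "\<And>k. k \<in> ?T \<Longrightarrow> task_done k \<Phi>" by blast
  have "\<exists>z. (e, x, z) \<in> \<Phi>" "\<exists>z. (e, z, x) \<in> \<Phi>" if "e \<in> E" "x \<in> Y" for e x
    using T[of "Inl (e, True, x)"] T[of "Inl (e, False, x)"] that by (auto simp: task_done_def)
  moreover have "conn \<Phi> A \<tau>" if "\<tau> \<in> triples" for \<tau>
    using T[of "Inr \<tau>"] that by (auto simp: task_done_def)
  ultimately show ?thesis using \<Phi> by blast
qed

end

section \<open>Generators and actions of the group of the theorem\<close>

definition left_gen :: "('g, 'm) monoid_scheme \<Rightarrow> 'g \<Rightarrow> 'b set \<Rightarrow> 'b \<Rightarrow> ('g, 'b) left_elt" where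
  "left_gen G0 a U u =
     amalgam_inl (cyclic_times_free G0 a U) G0 (carrier (subgroup_generated G0 {a}))
       (\<lambda>c. (c, \<one>\<^bsub>free_group U\<^esub>)) (\<lambda>c. c) (\<one>\<^bsub>G0\<^esub>, free_gen U u)"

text \<open>\<open>middle_incl\<close> is defined on \<open>G0\<close> alone, whereas the letters of
  \<open>U\<close> require the map on all of the left group.\<close>

definition middle_inl :: "('g, 'm) monoid_scheme \<Rightarrow> 'g \<Rightarrow> 'g \<Rightarrow> 'b set \<Rightarrow> 'b set \<Rightarrow>
    ('g, 'b) left_elt \<Rightarrow> ('g, 'b) middle_elt" where
  "middle_inl G0 a t S U =
     amalgam_inl (left_group G0 a U) (cyclic_times_free G0 t S)
       (carrier (subgroup_generated G0 {t}))
       (left_incl G0 a U) (\<lambda>c. (c, \<one>\<^bsub>free_group S\<^esub>))"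

definition middle_gen :: "('g, 'm) monoid_scheme \<Rightarrow> 'g \<Rightarrow> 'g \<Rightarrow> 'b set \<Rightarrow> 'b set \<Rightarrow>
    'b \<Rightarrow> ('g, 'b) middle_elt" where
  "middle_gen G0 a t S U s =
     amalgam_inr (left_group G0 a U) (cyclic_times_free G0 t S)
       (carrier (subgroup_generated G0 {t}))
       (left_incl G0 a U) (\<lambda>c. (c, \<one>\<^bsub>free_group S\<^esub>)) (\<one>\<^bsub>G0\<^esub>, free_gen S s)"

definition big_gen :: "('g, 'm) monoid_scheme \<Rightarrow> 'g \<Rightarrow> 'g \<Rightarrow> 'b set \<Rightarrow> 'b set \<Rightarrow> 'b set \<Rightarrow>
    'b \<Rightarrow> ('g, 'b) big_elt" where
  "big_gen G0 a t R S U e =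
     (if e \<in> R then amalgam_inr (middle_group G0 a t S U) (free_group R) {()}
        (\<lambda>_. \<one>\<^bsub>middle_group G0 a t S U\<^esub>) (\<lambda>_. \<one>\<^bsub>free_group R\<^esub>) (free_gen R e)
      else if e \<in> S then free_product_inl (middle_group G0 a t S U) (free_group R) (middle_gen G0 a t S U e)
      else free_product_inl (middle_group G0 a t S U) (free_group R)
        (middle_inl G0 a t S U (left_gen G0 a U e)))"

lemma middle_incl_eq: "middle_incl G0 a t S U g = middle_inl G0 a t S U (left_incl G0 a U g)"
  unfolding middle_incl_def middle_inl_def ..

context
  fixes G0 :: "('g, 'm) monoid_scheme" and a t :: 'g and R S U :: "'b set"
  assumes G0: "group G0" and a: "a \<in> carrier G0" and t: "t \<in> carrier G0"
begin

interpretation G0: group G0 by (rule G0)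

section \<open>The first amalgam: letters that commute with \<open>a\<close>\<close>

lemma left_group_group: "group (left_group G0 a U)"
  unfolding left_group_def by (intro amalgam_group cyclic_times_free_group G0)

lemma left_incl_hom: "left_incl G0 a U \<in> hom G0 (left_group G0 a U)"
  unfolding left_incl_def left_group_def by (rule amalgam_inr_hom[OF G0.is_monoid])

lemma left_inl_hom:
  "amalgam_inl (cyclic_times_free G0 a U) G0 (carrier (subgroup_generated G0 {a}))
     (\<lambda>c. (c, \<one>\<^bsub>free_group U\<^esub>)) (\<lambda>c. c) \<in> hom (cyclic_times_free G0 a U) (left_group G0 a U)"
  unfolding left_group_def
  by (rule amalgam_inl_hom[OF group.is_monoid[OF cyclic_times_free_group[OF G0]]])

lemma cyclic_times_free_one:
  assumes "c \<in> carrier (subgroup_generated G0 {x})"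
  shows "(c, \<one>\<^bsub>free_group V\<^esub>) \<in> carrier (cyclic_times_free G0 x V)"
proof -
  interpret F: group "free_group V" by (rule free_group_group)
  show ?thesis using assms by (simp add: cyclic_times_free_simps)
qed

lemma cyclic_times_free_gen_mem:
  assumes "x \<in> carrier G0" "s \<in> V"
  shows "(\<one>\<^bsub>G0\<^esub>, free_gen V s) \<in> carrier (cyclic_times_free G0 x V)"
    "(x, \<one>\<^bsub>free_group V\<^esub>) \<in> carrier (cyclic_times_free G0 x V)"
  using subgroup_generated_mem(2)[OF G0 assms(1)] free_gen_closed[OF assms(2)]
    cyclic_times_free_one[OF subgroup_generated_mem(1)[OF G0 assms(1)]]
  by (simp_all add: cyclic_times_free_simps)

lemma cyclic_times_free_gen_commute:
  assumes "x \<in> carrier G0" "s \<in> V"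
  shows "(x, \<one>\<^bsub>free_group V\<^esub>) \<otimes>\<^bsub>cyclic_times_free G0 x V\<^esub> (\<one>\<^bsub>G0\<^esub>, free_gen V s) =
    (\<one>\<^bsub>G0\<^esub>, free_gen V s) \<otimes>\<^bsub>cyclic_times_free G0 x V\<^esub> (x, \<one>\<^bsub>free_group V\<^esub>)"
proof -
  interpret F: group "free_group V" by (rule free_group_group)
  show ?thesis using assms free_gen_closed[OF assms(2)] by (simp add: cyclic_times_free_simps)
qed

lemma left_glue:
  assumes "c \<in> carrier (subgroup_generated G0 {a})"
  shows "amalgam_inl (cyclic_times_free G0 a U) G0 (carrier (subgroup_generated G0 {a}))
     (\<lambda>c. (c, \<one>\<^bsub>free_group U\<^esub>)) (\<lambda>c. c) (c, \<one>\<^bsub>free_group U\<^esub>) = left_incl G0 a U c"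
proof -
  have "(c, \<one>\<^bsub>free_group U\<^esub>) \<in> carrier (cyclic_times_free G0 a U)"
    using assms by (rule cyclic_times_free_one)
  moreover have "c \<in> carrier G0" using assms subgroup_generated_mem(3)[OF G0 a] by blast
  ultimately show ?thesis
    unfolding left_incl_def
    using amalgam_glue[of c "carrier (subgroup_generated G0 {a})" "\<lambda>c. (c, \<one>\<^bsub>free_group U\<^esub>)"
        "cyclic_times_free G0 a U" "\<lambda>c. c" G0] assms by simp
qed

lemma left_gen_closed: "u \<in> U \<Longrightarrow> left_gen G0 a U u \<in> carrier (left_group G0 a U)"
  unfolding left_gen_def using hom_in_carrier[OF left_inl_hom cyclic_times_free_gen_mem(1)[OF a]] .

text \<open>The direct factors commute, and gluing identifies \<open>a\<close> in the first factor
  with \<open>a\<close> in \<open>G0\<close>.\<close>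

lemma left_gen_commute:
  assumes u: "u \<in> U"
  shows "left_incl G0 a U a \<otimes>\<^bsub>left_group G0 a U\<^esub> left_gen G0 a U u =
    left_gen G0 a U u \<otimes>\<^bsub>left_group G0 a U\<^esub> left_incl G0 a U a"
  unfolding left_glue[OF subgroup_generated_mem(1)[OF G0 a], symmetric] left_gen_def
  by (simp only: hom_mult[OF left_inl_hom, symmetric] cyclic_times_free_gen_mem[OF a u]
      cyclic_times_free_gen_commute[OF a u])

text \<open>The generators that come from the cyclic factor are absorbed into the image of
  \<open>G0\<close> by gluing.\<close>

lemma left_generates:
  "generates (left_group G0 a U) (left_incl G0 a U ` carrier G0 \<union> left_gen G0 a U ` U)"
  unfolding generates_def
proof (intro allI impI)
  fix H assume H: "subgroup H (left_group G0 a U)" "left_incl G0 a U ` carrier G0 \<union> left_gen G0 a U ` U \<subseteq> H"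
  let ?C = "carrier (subgroup_generated G0 {a})"
  let ?X = "(\<lambda>c. (c, \<one>\<^bsub>free_group U\<^esub>)) ` ?C \<union> (\<lambda>s. (\<one>\<^bsub>G0\<^esub>, free_gen U s)) ` U"
  let ?l = "amalgam_inl (cyclic_times_free G0 a U) G0 ?C (\<lambda>c. (c, \<one>\<^bsub>free_group U\<^esub>)) (\<lambda>c. c)"
  have X: "?X \<subseteq> carrier (cyclic_times_free G0 a U)"
    using cyclic_times_free_gen_mem(1)[OF a] cyclic_times_free_one[of _ a U] by auto
  have gen: "generates (left_group G0 a U) (?l ` ?X \<union> left_incl G0 a U ` carrier G0)"
    unfolding left_group_def left_incl_def
    by (rule amalgam_generates[OF cyclic_times_free_group[OF G0] G0 cyclic_times_free_generates[OF G0 a] _ X])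
      (auto simp: generates_def)
  have "?l (c, \<one>\<^bsub>free_group U\<^esub>) \<in> H" if "c \<in> ?C" for c
    using left_glue[OF that] H(2) subgroup_generated_mem(3)[OF G0 a] that by auto
  moreover have "?l (\<one>\<^bsub>G0\<^esub>, free_gen U s) \<in> H" if "s \<in> U" for s
    using H(2) that unfolding left_gen_def by auto
  ultimately have "?l ` ?X \<union> left_incl G0 a U ` carrier G0 \<subseteq> H" using H(2) by auto
  then show "carrier (left_group G0 a U) \<subseteq> H" by (rule generates_subset[OF gen H(1)])
qed

text \<open>Restricted to the cyclic factor, the action of the direct product is
  \<open>\<alpha>\<close>, which is the compatibility that the amalgam asks for.\<close>

lemma left_action:
  assumes act: "right_action G0 Y \<alpha>"
    and bij: "\<forall>u\<in>U. bij_betw (\<phi> u) Y Y"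
    and comm: "\<forall>u\<in>U. \<forall>y\<in>Y. \<phi> u (\<alpha> y a) = \<alpha> (\<phi> u y) a"
  shows "\<exists>\<beta>. right_action (left_group G0 a U) Y \<beta> \<and>
    (\<forall>y\<in>Y. \<forall>g\<in>carrier G0. \<beta> y (left_incl G0 a U g) = \<alpha> y g) \<and>
    (\<forall>y\<in>Y. \<forall>u\<in>U. \<beta> y (left_gen G0 a U u) = \<phi> u y)"
proof -
  let ?C = "carrier (subgroup_generated G0 {a})"
  obtain \<delta> where d: "right_action (cyclic_times_free G0 a U) Y \<delta>"
    and dC: "\<forall>y\<in>Y. \<forall>c\<in>?C. \<delta> y (c, \<one>\<^bsub>free_group U\<^esub>) = \<alpha> y c"
    and dU: "\<forall>y\<in>Y. \<forall>s\<in>U. \<delta> y (\<one>\<^bsub>G0\<^esub>, free_gen U s) = \<phi> s y"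
    using cyclic_times_free_action[OF act a bij comm] by (elim exE conjE)
  have glue: "\<forall>c\<in>?C. \<forall>y\<in>Y. \<delta> y (c, \<one>\<^bsub>free_group U\<^esub>) = \<alpha> y c"
    using dC by blast
  obtain \<beta> where b: "right_action (left_group G0 a U) Y \<beta>"
    and bl: "\<forall>y\<in>Y. \<forall>x\<in>carrier (cyclic_times_free G0 a U). \<beta> y (amalgam_inl (cyclic_times_free G0 a U) G0 ?C
     (\<lambda>c. (c, \<one>\<^bsub>free_group U\<^esub>)) (\<lambda>c. c) x) = \<delta> y x"
    and br: "\<forall>y\<in>Y. \<forall>x\<in>carrier G0. \<beta> y (left_incl G0 a U x) = \<alpha> y x"
    using amalgam_action[where C = ?C and i = "\<lambda>c. (c, \<one>\<^bsub>free_group U\<^esub>)" and j = "\<lambda>c. c", OF d act glue]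
    unfolding left_group_def[symmetric] left_incl_def[symmetric] by (elim exE conjE)
  have "\<beta> y (left_gen G0 a U u) = \<phi> u y" if "y \<in> Y" "u \<in> U" for y u
    unfolding left_gen_def using bl dU that cyclic_times_free_gen_mem(1)[OF a that(2)] by simp
  then show ?thesis using b br by blast
qed

section \<open>The second amalgam: letters that commute with \<open>t\<close>\<close>

lemma middle_group_group: "group (middle_group G0 a t S U)"
  unfolding middle_group_def by (intro amalgam_group left_group_group cyclic_times_free_group G0)

lemma middle_inl_hom: "middle_inl G0 a t S U \<in> hom (left_group G0 a U) (middle_group G0 a t S U)"
  unfolding middle_inl_def middle_group_def by (rule amalgam_inl_hom[OF group.is_monoid[OF left_group_group]])

lemma middle_inr_hom:
  "amalgam_inr (left_group G0 a U) (cyclic_times_free G0 t S) (carrier (subgroup_generated G0 {t}))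
     (left_incl G0 a U) (\<lambda>c. (c, \<one>\<^bsub>free_group S\<^esub>)) \<in> hom (cyclic_times_free G0 t S) (middle_group G0 a t S U)"
  unfolding middle_group_def
  by (rule amalgam_inr_hom[OF group.is_monoid[OF cyclic_times_free_group[OF G0]]])

lemma middle_glue:
  assumes "c \<in> carrier (subgroup_generated G0 {t})"
  shows "amalgam_inr (left_group G0 a U) (cyclic_times_free G0 t S) (carrier (subgroup_generated G0 {t}))
     (left_incl G0 a U) (\<lambda>c. (c, \<one>\<^bsub>free_group S\<^esub>)) (c, \<one>\<^bsub>free_group S\<^esub>) = middle_incl G0 a t S U c"
proof -
  have "(c, \<one>\<^bsub>free_group S\<^esub>) \<in> carrier (cyclic_times_free G0 t S)"
    using assms by (rule cyclic_times_free_one)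
  moreover have "left_incl G0 a U c \<in> carrier (left_group G0 a U)"
    using hom_in_carrier[OF left_incl_hom] assms subgroup_generated_mem(3)[OF G0 t] by blast
  ultimately show ?thesis
    unfolding middle_incl_def
    using amalgam_glue[of c "carrier (subgroup_generated G0 {t})" "left_incl G0 a U" "left_group G0 a U"
        "\<lambda>c. (c, \<one>\<^bsub>free_group S\<^esub>)" "cyclic_times_free G0 t S"] assms by simp
qed

lemma middle_gen_closed: "s \<in> S \<Longrightarrow> middle_gen G0 a t S U s \<in> carrier (middle_group G0 a t S U)"
  unfolding middle_gen_def using hom_in_carrier[OF middle_inr_hom cyclic_times_free_gen_mem(1)[OF t]] .

lemma middle_gen_commute:
  assumes s: "s \<in> S"
  shows "middle_incl G0 a t S U t \<otimes>\<^bsub>middle_group G0 a t S U\<^esub> middle_gen G0 a t S U s =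
    middle_gen G0 a t S U s \<otimes>\<^bsub>middle_group G0 a t S U\<^esub> middle_incl G0 a t S U t"
  unfolding middle_glue[OF subgroup_generated_mem(1)[OF G0 t], symmetric] middle_gen_def
  by (simp only: hom_mult[OF middle_inr_hom, symmetric] cyclic_times_free_gen_mem[OF t s]
      cyclic_times_free_gen_commute[OF t s])

lemma middle_generates:
  "generates (middle_group G0 a t S U)
    (middle_inl G0 a t S U ` carrier (left_group G0 a U) \<union> middle_gen G0 a t S U ` S)"
  unfolding generates_def
proof (intro allI impI)
  fix H assume H: "subgroup H (middle_group G0 a t S U)"
    "middle_inl G0 a t S U ` carrier (left_group G0 a U) \<union> middle_gen G0 a t S U ` S \<subseteq> H"
  let ?C = "carrier (subgroup_generated G0 {t})"
  let ?X = "(\<lambda>c. (c, \<one>\<^bsub>free_group S\<^esub>)) ` ?C \<union> (\<lambda>s. (\<one>\<^bsub>G0\<^esub>, free_gen S s)) ` S"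
  let ?r = "amalgam_inr (left_group G0 a U) (cyclic_times_free G0 t S) ?C
     (left_incl G0 a U) (\<lambda>c. (c, \<one>\<^bsub>free_group S\<^esub>))"
  have X: "?X \<subseteq> carrier (cyclic_times_free G0 t S)"
    using cyclic_times_free_gen_mem(1)[OF t] cyclic_times_free_one[of _ t S] by auto
  have gen: "generates (middle_group G0 a t S U) (middle_inl G0 a t S U ` carrier (left_group G0 a U) \<union> ?r ` ?X)"
    unfolding middle_group_def middle_inl_def
    by (rule amalgam_generates[OF left_group_group cyclic_times_free_group[OF G0] _
          cyclic_times_free_generates[OF G0 t] _ X])
      (auto simp: generates_def)
  have "?r (c, \<one>\<^bsub>free_group S\<^esub>) \<in> H" if "c \<in> ?C" for c
    using middle_glue[OF that] H(2) subgroup_generated_mem(3)[OF G0 t] hom_in_carrier[OF left_incl_hom, of c] that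
    unfolding middle_incl_eq by auto
  moreover have "?r (\<one>\<^bsub>G0\<^esub>, free_gen S s) \<in> H" if "s \<in> S" for s
    using H(2) that unfolding middle_gen_def by auto
  ultimately have "middle_inl G0 a t S U ` carrier (left_group G0 a U) \<union> ?r ` ?X \<subseteq> H" using H(2) by auto
  then show "carrier (middle_group G0 a t S U) \<subseteq> H" by (rule generates_subset[OF gen H(1)])
qed

lemma middle_action:
  assumes act: "right_action G0 Y \<alpha>" and left: "right_action (left_group G0 a U) Y \<beta>"
    and ext: "\<forall>y\<in>Y. \<forall>g\<in>carrier G0. \<beta> y (left_incl G0 a U g) = \<alpha> y g"
    and bij: "\<forall>s\<in>S. bij_betw (\<phi> s) Y Y"
    and comm: "\<forall>s\<in>S. \<forall>y\<in>Y. \<phi> s (\<alpha> y t) = \<alpha> (\<phi> s y) t"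
  shows "\<exists>\<delta>. right_action (middle_group G0 a t S U) Y \<delta> \<and>
    (\<forall>y\<in>Y. \<forall>g\<in>carrier (left_group G0 a U). \<delta> y (middle_inl G0 a t S U g) = \<beta> y g) \<and>
    (\<forall>y\<in>Y. \<forall>s\<in>S. \<delta> y (middle_gen G0 a t S U s) = \<phi> s y)"
proof -
  let ?C = "carrier (subgroup_generated G0 {t})"
  obtain \<epsilon> where d: "right_action (cyclic_times_free G0 t S) Y \<epsilon>"
    and dC: "\<forall>y\<in>Y. \<forall>c\<in>?C. \<epsilon> y (c, \<one>\<^bsub>free_group S\<^esub>) = \<alpha> y c"
    and dS: "\<forall>y\<in>Y. \<forall>s\<in>S. \<epsilon> y (\<one>\<^bsub>G0\<^esub>, free_gen S s) = \<phi> s y"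
    using cyclic_times_free_action[OF act t bij comm] by (elim exE conjE)
  have glue: "\<forall>c\<in>?C. \<forall>y\<in>Y. \<beta> y (left_incl G0 a U c) = \<epsilon> y (c, \<one>\<^bsub>free_group S\<^esub>)"
    using dC ext subgroup_generated_mem(3)[OF G0 t] by auto
  obtain \<delta> where b: "right_action (middle_group G0 a t S U) Y \<delta>"
    and bl: "\<forall>y\<in>Y. \<forall>x\<in>carrier (left_group G0 a U). \<delta> y (middle_inl G0 a t S U x) = \<beta> y x"
    and br: "\<forall>y\<in>Y. \<forall>x\<in>carrier (cyclic_times_free G0 t S). \<delta> y (amalgam_inr (left_group G0 a U)
      (cyclic_times_free G0 t S) ?C (left_incl G0 a U) (\<lambda>c. (c, \<one>\<^bsub>free_group S\<^esub>)) x) = \<epsilon> y x"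
    using amalgam_action[where C = ?C and i = "left_incl G0 a U"
        and j = "\<lambda>c. (c, \<one>\<^bsub>free_group S\<^esub>)", OF left d glue]
    unfolding middle_group_def[symmetric] middle_inl_def[symmetric] by (elim exE conjE)
  have "\<delta> y (middle_gen G0 a t S U s) = \<phi> s y" if "y \<in> Y" "s \<in> S" for y s
    unfolding middle_gen_def using br dS that cyclic_times_free_gen_mem(1)[OF t that(2)] by simp
  then show ?thesis using b bl by blast
qed

section \<open>The free product with the free letters\<close>

lemma big_group_group: "group (big_group G0 a t R S U)"
  unfolding big_group_def free_product_def
  by (intro amalgam_group middle_group_group free_group_group)

lemma big_inl_hom: "free_product_inl (middle_group G0 a t S U) (free_group R)
    \<in> hom (middle_group G0 a t S U) (big_group G0 a t R S U)"
  unfolding free_product_inl_def big_group_def free_product_def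
  by (rule amalgam_inl_hom[OF group.is_monoid[OF middle_group_group]])

lemma big_inr_hom: "amalgam_inr (middle_group G0 a t S U) (free_group R) {()}
    (\<lambda>_. \<one>\<^bsub>middle_group G0 a t S U\<^esub>) (\<lambda>_. \<one>\<^bsub>free_group R\<^esub>)
    \<in> hom (free_group R) (big_group G0 a t R S U)"
  unfolding big_group_def free_product_def
  by (rule amalgam_inr_hom[OF group.is_monoid[OF free_group_group]])

lemma middle_incl_hom: "middle_incl G0 a t S U \<in> hom G0 (middle_group G0 a t S U)"
  using hom_compose[OF left_incl_hom middle_inl_hom] by (simp add: comp_def middle_incl_eq[abs_def])

lemma big_incl_hom: "big_incl G0 a t R S U \<in> hom G0 (big_group G0 a t R S U)"
  using hom_compose[OF middle_incl_hom big_inl_hom] by (simp add: comp_def big_incl_def[abs_def])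

lemma big_gen_closed:
  assumes "e \<in> R \<union> S \<union> U"
  shows "big_gen G0 a t R S U e \<in> carrier (big_group G0 a t R S U)"
  using assms hom_in_carrier[OF big_inr_hom free_gen_closed[of e R]]
    hom_in_carrier[OF big_inl_hom middle_gen_closed[of e]]
    hom_in_carrier[OF big_inl_hom hom_in_carrier[OF middle_inl_hom left_gen_closed[of e]]]
  unfolding big_gen_def by auto

lemma big_gen_commute_t:
  assumes "s \<in> S" "s \<notin> R"
  shows "big_incl G0 a t R S U t \<otimes>\<^bsub>big_group G0 a t R S U\<^esub> big_gen G0 a t R S U s =
    big_gen G0 a t R S U s \<otimes>\<^bsub>big_group G0 a t R S U\<^esub> big_incl G0 a t R S U t"
proof -
  note c = hom_in_carrier[OF middle_incl_hom t] middle_gen_closed[OF assms(1)]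
  show ?thesis
    using hom_mult[OF big_inl_hom c(1) c(2)] hom_mult[OF big_inl_hom c(2) c(1)] middle_gen_commute[OF assms(1)]
      assms unfolding big_gen_def big_incl_def by simp
qed

lemma big_gen_commute_a:
  assumes "u \<in> U" "u \<notin> R" "u \<notin> S"
  shows "big_incl G0 a t R S U a \<otimes>\<^bsub>big_group G0 a t R S U\<^esub> big_gen G0 a t R S U u =
    big_gen G0 a t R S U u \<otimes>\<^bsub>big_group G0 a t R S U\<^esub> big_incl G0 a t R S U a"
proof -
  note c = hom_in_carrier[OF left_incl_hom a] left_gen_closed[OF assms(1)]
  note m = hom_in_carrier[OF middle_inl_hom c(1)] hom_in_carrier[OF middle_inl_hom c(2)]
  show ?thesis
    using hom_mult[OF big_inl_hom m(1) m(2)] hom_mult[OF big_inl_hom m(2) m(1)]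
      hom_mult[OF middle_inl_hom c(1) c(2)] hom_mult[OF middle_inl_hom c(2) c(1)] left_gen_commute[OF assms(1)]
      assms unfolding big_gen_def big_incl_def middle_incl_eq by simp
qed

lemma big_generates:
  assumes disj: "R \<inter> S = {}" "R \<inter> U = {}" "S \<inter> U = {}"
  shows "generates (big_group G0 a t R S U)
    (big_incl G0 a t R S U ` carrier G0 \<union> big_gen G0 a t R S U ` (R \<union> S \<union> U))"
  unfolding generates_def
proof (intro allI impI)
  let ?G = "big_group G0 a t R S U" and ?M = "middle_group G0 a t S U" and ?L = "left_group G0 a U"
  let ?l = "free_product_inl ?M (free_group R)"
  let ?r = "amalgam_inr ?M (free_group R) {()} (\<lambda>_. \<one>\<^bsub>?M\<^esub>) (\<lambda>_. \<one>\<^bsub>free_group R\<^esub>)"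
  fix H assume H: "subgroup H ?G"
    and gens: "big_incl G0 a t R S U ` carrier G0 \<union> big_gen G0 a t R S U ` (R \<union> S \<union> U) \<subseteq> H"
  have gR: "?r (free_gen R e) \<in> H" if "e \<in> R" for e
    using gens that unfolding big_gen_def by auto
  have gS: "?l (middle_gen G0 a t S U e) \<in> H" if "e \<in> S" for e
  proof -
    have "big_gen G0 a t R S U e \<in> H" "e \<notin> R" using gens that disj by auto
    then show ?thesis using that unfolding big_gen_def by simp
  qed
  have gU: "?l (middle_inl G0 a t S U (left_gen G0 a U e)) \<in> H" if "e \<in> U" for e
  proof -
    have "big_gen G0 a t R S U e \<in> H" "e \<notin> R" "e \<notin> S" using gens that disj by auto
    then show ?thesis unfolding big_gen_def by simp
  qed
  have g0: "?l (middle_inl G0 a t S U (left_incl G0 a U g)) \<in> H" if "g \<in> carrier G0" for g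
    using gens that unfolding big_incl_def middle_incl_eq by auto
  \<comment> \<open>Membership in \<open>H\<close> climbs the tower: first the images of the left
    group, then those of the middle group.\<close>
  have L: "?l (middle_inl G0 a t S U x) \<in> H" if "x \<in> carrier ?L" for x
  proof -
    have "(?l \<circ> middle_inl G0 a t S U) x \<in> H"
      by (rule generates_image[OF left_group_group big_group_group hom_compose[OF middle_inl_hom big_inl_hom]
            left_generates _ H _ that])
        (use g0 gU left_gen_closed hom_in_carrier[OF left_incl_hom] in auto)
    then show ?thesis by simp
  qed
  have M: "?l x \<in> H" if "x \<in> carrier ?M" for x
    by (rule generates_image[OF middle_group_group big_group_group big_inl_hom middle_generates _ H _ that])
      (use L gS middle_gen_closed hom_in_carrier[OF middle_inl_hom] in auto)
  have gen: "generates ?G (?l ` carrier ?M \<union> ?r ` (free_gen R ` R))"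
    unfolding big_group_def free_product_def free_product_inl_def
    by (rule amalgam_generates[OF middle_group_group free_group_group _ free_group_generates])
      (use free_gen_closed in \<open>auto simp: generates_def\<close>)
  have "?l ` carrier ?M \<union> ?r ` (free_gen R ` R) \<subseteq> H" using M gR by auto
  then show "carrier ?G \<subseteq> H" by (rule generates_subset[OF gen H])
qed

text \<open>Here the freeness of the construction is used: permutations of \<open>Y\<close>, subject
  to nothing but the two commutation laws, define an action of the whole group.\<close>

lemma big_action:
  assumes disj: "R \<inter> S = {}" "R \<inter> U = {}" "S \<inter> U = {}"
    and act: "right_action G0 Y \<alpha>"
    and bij: "\<forall>e\<in>R \<union> S \<union> U. bij_betw (\<phi> e) Y Y"
    and comm_t: "\<forall>s\<in>S. \<forall>y\<in>Y. \<phi> s (\<alpha> y t) = \<alpha> (\<phi> s y) t"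
    and comm_a: "\<forall>u\<in>U. \<forall>y\<in>Y. \<phi> u (\<alpha> y a) = \<alpha> (\<phi> u y) a"
  shows "\<exists>\<delta>. right_action (big_group G0 a t R S U) Y \<delta> \<and>
    (\<forall>y\<in>Y. \<forall>g\<in>carrier G0. \<delta> y (big_incl G0 a t R S U g) = \<alpha> y g) \<and>
    (\<forall>y\<in>Y. \<forall>e\<in>R \<union> S \<union> U. \<delta> y (big_gen G0 a t R S U e) = \<phi> e y)"
proof -
  let ?M = "middle_group G0 a t S U" and ?L = "left_group G0 a U"
  have bU: "\<forall>u\<in>U. bij_betw (\<phi> u) Y Y" and bS: "\<forall>u\<in>S. bij_betw (\<phi> u) Y Y"
    and bR: "\<forall>u\<in>R. bij_betw (\<phi> u) Y Y" using bij by auto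
  obtain \<beta> where b: "right_action ?L Y \<beta>"
    and b0: "\<forall>y\<in>Y. \<forall>g\<in>carrier G0. \<beta> y (left_incl G0 a U g) = \<alpha> y g"
    and bU': "\<forall>y\<in>Y. \<forall>u\<in>U. \<beta> y (left_gen G0 a U u) = \<phi> u y"
    using left_action[OF act bU comm_a] by (elim exE conjE)
  obtain \<epsilon> where e: "right_action ?M Y \<epsilon>"
    and eL: "\<forall>y\<in>Y. \<forall>g\<in>carrier ?L. \<epsilon> y (middle_inl G0 a t S U g) = \<beta> y g"
    and eS: "\<forall>y\<in>Y. \<forall>s\<in>S. \<epsilon> y (middle_gen G0 a t S U s) = \<phi> s y"
    using middle_action[OF act b b0 bS comm_t] by (elim exE conjE)
  obtain \<rho> where r: "right_action (free_group R) Y \<rho>"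
    and rR: "\<forall>y\<in>Y. \<forall>s\<in>R. \<rho> y (free_gen R s) = \<phi> s y"
    using free_group_action[OF bR] by (elim exE conjE)
  have glue: "\<forall>c\<in>{()}. \<forall>y\<in>Y. \<epsilon> y \<one>\<^bsub>?M\<^esub> = \<rho> y \<one>\<^bsub>free_group R\<^esub>"
    using right_action.act_one[OF e] right_action.act_one[OF r] by simp
  obtain \<delta> where d: "right_action (big_group G0 a t R S U) Y \<delta>"
    and dM: "\<forall>y\<in>Y. \<forall>x\<in>carrier ?M. \<delta> y (free_product_inl ?M (free_group R) x) = \<epsilon> y x"
    and dR: "\<forall>y\<in>Y. \<forall>x\<in>carrier (free_group R). \<delta> y (amalgam_inr ?M (free_group R) {()}
      (\<lambda>_. \<one>\<^bsub>?M\<^esub>) (\<lambda>_. \<one>\<^bsub>free_group R\<^esub>) x) = \<rho> y x"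
    using amalgam_action[where C = "{()}" and i = "\<lambda>_. \<one>\<^bsub>?M\<^esub>" and j = "\<lambda>_. \<one>\<^bsub>free_group R\<^esub>", OF e r glue]
    unfolding big_group_def[symmetric] free_product_def[symmetric] free_product_inl_def[symmetric]
    by (elim exE conjE)
  have "\<delta> y (big_incl G0 a t R S U g) = \<alpha> y g" if "y \<in> Y" "g \<in> carrier G0" for y g
    using dM eL b0 that hom_in_carrier[OF left_incl_hom that(2)] hom_in_carrier[OF middle_incl_hom that(2)]
    unfolding big_incl_def middle_incl_eq by simp
  moreover have "\<delta> y (big_gen G0 a t R S U x) = \<phi> x y" if y: "y \<in> Y" and x: "x \<in> R \<union> S \<union> U" for y x
  proof -
    from x consider "x \<in> R" | "x \<in> S" "x \<notin> R" | "x \<in> U" "x \<notin> R" "x \<notin> S" by blast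
    then show ?thesis
    proof cases
      case 1
      then show ?thesis using dR rR y free_gen_closed[OF 1] unfolding big_gen_def by simp
    next
      case 2
      then show ?thesis using dM eS y middle_gen_closed[OF 2(1)] unfolding big_gen_def by simp
    next
      case 3
      then show ?thesis
        using dM eL bU' y left_gen_closed[OF 3(1)] hom_in_carrier[OF middle_inl_hom left_gen_closed[OF 3(1)]]
        unfolding big_gen_def by simp
    qed
  qed
  ultimately show ?thesis using d by blast
qed

end

section \<open>Proof of the theorem\<close>

text \<open>Serves to meet the hypothesis on triples with stabilizer S_3, which is an isomorphism
  with a group of permutations of \<open>{1..n}\<close>; hence the numbering \<open>e\<close> of the
  points of \<open>T\<close>.\<close>

lemma setwise_stabilizer_iso_sym_group:
  assumes act: "right_action G X act" and T: "T \<subseteq> X" and e: "bij_betw e {1..n} T"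
    and faithful: "\<And>g. g \<in> carrier G \<Longrightarrow> (\<And>x. x \<in> T \<Longrightarrow> act x g = x) \<Longrightarrow> g = \<one>\<^bsub>G\<^esub>"
    and full: "\<And>p. p permutes {1..n} \<Longrightarrow> \<exists>k\<in>carrier G. \<forall>i\<in>{1..n}. act (e i) k = e (p i)"
  shows "G\<lparr>carrier := setwise_stabilizer G act T\<rparr> \<cong> sym_group n"
proof -
  interpret right_action G X act by fact
  let ?S = "setwise_stabilizer G act T"
  let ?I = "inv_into {1..n} e"
  have eT: "e i \<in> T" "e i \<in> X" if "i \<in> {1..n}" for i using bij_betw_apply[OF e that] T by auto
  have S: "g \<in> carrier G" if "g \<in> ?S" for g using that unfolding setwise_stabilizer_def by blast
  have ST: "bij_betw (\<lambda>x. act x (inv\<^bsub>G\<^esub> g)) T T" if g: "g \<in> ?S" for g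
  proof -
    have im: "(\<lambda>x. act x g) ` T = T" using g unfolding setwise_stabilizer_def by blast
    have "(\<lambda>x. act x (inv\<^bsub>G\<^esub> g)) ` T = (\<lambda>x. act x (inv\<^bsub>G\<^esub> g)) ` (\<lambda>x. act x g) ` T" using im by simp
    also have "\<dots> = T" using T S[OF g] by (force simp: image_image)
    finally have "(\<lambda>x. act x (inv\<^bsub>G\<^esub> g)) ` T = T" .
    moreover have "inj_on (\<lambda>x. act x (inv\<^bsub>G\<^esub> g)) T"
      using act_cancel[OF _ _ inv_closed[OF S[OF g]]] T by (intro inj_onI) blast
    ultimately show ?thesis unfolding bij_betw_def by blast
  qed
  \<comment> \<open>The inverse turns the right action into composition of permutations.\<close>
  define h where "h g i = (if i \<in> {1..n} then ?I (act (e i) (inv\<^bsub>G\<^esub> g)) else i)" for g i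
  have h: "h g i \<in> {1..n}" "e (h g i) = act (e i) (inv\<^bsub>G\<^esub> g)" if "g \<in> ?S" "i \<in> {1..n}" for g i
    using bij_betw_apply[OF ST[OF that(1)] eT(1)[OF that(2)]] that(2) bij_betw_imp_surj_on[OF e]
      inv_into_into[of _ e "{1..n}"] f_inv_into_f[of _ e "{1..n}"]
    unfolding h_def by simp_all
  have e_eq: "i = j" if "e i = e j" "i \<in> {1..n}" "j \<in> {1..n}" for i j
    using bij_betw_imp_inj_on[OF e] that by (meson inj_onD)
  have perm: "h g permutes {1..n}" if g: "g \<in> ?S" for g
  proof (rule bij_imp_permutes)
    have "inj_on (h g) {1..n}"
    proof (rule inj_onI)
      fix i j assume ij: "i \<in> {1..n}" "j \<in> {1..n}" "h g i = h g j"
      then have "act (e i) (inv\<^bsub>G\<^esub> g) = act (e j) (inv\<^bsub>G\<^esub> g)" using h(2)[OF g] by metis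
      then have "e i = e j" using act_cancel eT ij inv_closed S[OF g] by blast
      then show "i = j" using e_eq ij by blast
    qed
    moreover have "h g ` {1..n} \<subseteq> {1..n}" using h(1)[OF g] by blast
    ultimately show "bij_betw (h g) {1..n} {1..n}"
      by (simp add: bij_betw_def endo_inj_surj)
  qed (simp only: h_def if_False)
  have S_mult: "g \<otimes>\<^bsub>G\<^esub> k \<in> ?S" if "g \<in> ?S" "k \<in> ?S" for g k
  proof -
    have "(\<lambda>x. act x (g \<otimes>\<^bsub>G\<^esub> k)) ` T = (\<lambda>x. act x k) ` (\<lambda>x. act x g) ` T"
      unfolding image_image using T S[OF that(1)] S[OF that(2)] act_mult by (intro image_cong) auto
    then show ?thesis using that unfolding setwise_stabilizer_def by auto
  qed
  have "h \<in> hom (G\<lparr>carrier := ?S\<rparr>) (sym_group n)"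
  proof (rule homI)
    fix g assume "g \<in> carrier (G\<lparr>carrier := ?S\<rparr>)"
    then show "h g \<in> carrier (sym_group n)" using perm by (simp add: sym_group_def)
  next
    fix g k assume "g \<in> carrier (G\<lparr>carrier := ?S\<rparr>)" "k \<in> carrier (G\<lparr>carrier := ?S\<rparr>)"
    then have gk: "g \<in> ?S" "k \<in> ?S" by auto
    have "h (g \<otimes>\<^bsub>G\<^esub> k) i = h g (h k i)" for i
    proof (cases "i \<in> {1..n}")
      case True
      have "e (h (g \<otimes>\<^bsub>G\<^esub> k) i) = act (e i) (inv\<^bsub>G\<^esub> k \<otimes>\<^bsub>G\<^esub> inv\<^bsub>G\<^esub> g)"
        using h(2)[OF S_mult[OF gk] True] S[OF gk(1)] S[OF gk(2)] by (simp add: inv_mult_group)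
      also have "\<dots> = e (h g (h k i))"
        using h(2)[OF gk(1) h(1)[OF gk(2) True]] h(2)[OF gk(2) True] S[OF gk(1)] S[OF gk(2)] eT(2)[OF True]
        by (simp add: act_mult)
      finally show ?thesis using e_eq h(1) S_mult gk True by blast
    next
      case False
      then show ?thesis by (simp only: h_def if_False)
    qed
    then show "h (g \<otimes>\<^bsub>G\<lparr>carrier := ?S\<rparr>\<^esub> k) = h g \<otimes>\<^bsub>sym_group n\<^esub> h k"
      by (simp add: sym_group_def fun_eq_iff)
  qed
  moreover have "bij_betw h ?S {p. p permutes {1..n}}"
    unfolding bij_betw_def
  proof
    show "inj_on h ?S"
    proof (rule inj_onI)
      fix g k assume gk: "g \<in> ?S" "k \<in> ?S" "h g = h k"
      have c: "g \<in> carrier G" "k \<in> carrier G" using gk S by auto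
      have "inv\<^bsub>G\<^esub> g \<otimes>\<^bsub>G\<^esub> k = \<one>\<^bsub>G\<^esub>"
      proof (rule faithful)
        fix x assume x: "x \<in> T"
        obtain i where i: "i \<in> {1..n}" "x = e i" using x bij_betw_imp_surj_on[OF e] by blast
        have "act x (inv\<^bsub>G\<^esub> g) = act x (inv\<^bsub>G\<^esub> k)"
          using h(2)[OF gk(1) i(1)] h(2)[OF gk(2) i(1)] gk(3) i(2) by simp
        then show "act x (inv\<^bsub>G\<^esub> g \<otimes>\<^bsub>G\<^esub> k) = x" using x T c by (auto simp: act_mult)
      qed (use c in simp)
      then show "g = k" using c by (metis inv_equality inv_inv inv_closed)
    qed
    show "h ` ?S = {p. p permutes {1..n}}"
    proof
      show "h ` ?S \<subseteq> {p. p permutes {1..n}}" using perm by blast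
      show "{p. p permutes {1..n}} \<subseteq> h ` ?S"
      proof
        fix p assume "p \<in> {p. p permutes {1..n}}"
        then have p: "p permutes {1..n}" by blast
        obtain k where k: "k \<in> carrier G" "\<forall>i\<in>{1..n}. act (e i) k = e (p i)" using full[OF p] by blast
        have "(\<lambda>x. act x k) ` T = (\<lambda>x. act x k) ` e ` {1..n}" using bij_betw_imp_surj_on[OF e] by simp
        also have "\<dots> = e ` p ` {1..n}" unfolding image_image using k(2) by (intro image_cong) auto
        also have "\<dots> = T" using permutes_image[OF p] bij_betw_imp_surj_on[OF e] by simp
        finally have "(\<lambda>x. act x k) ` T = T" .
        then have "k \<in> ?S" using k(1) unfolding setwise_stabilizer_def by blast
        then have "bij_betw (\<lambda>x. act x (inv\<^bsub>G\<^esub> k)) T T" by (rule ST)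
        then have ik: "inv\<^bsub>G\<^esub> k \<in> ?S"
          using k(1) bij_betw_imp_surj_on unfolding setwise_stabilizer_def by blast
        \<comment> \<open>The map \<open>h\<close> inverts its argument, so the element over
          \<open>p\<close> is the inverse of the one that moves the points as \<open>p\<close>
          does.\<close>
        have "h (inv\<^bsub>G\<^esub> k) i = p i" for i
        proof (cases "i \<in> {1..n}")
          case True
          have "p i \<in> {1..n}" using permutes_in_image[OF p] True by blast
          moreover have "e (h (inv\<^bsub>G\<^esub> k) i) = e (p i)" using h(2)[OF ik True] k True by simp
          ultimately show ?thesis using e_eq h(1)[OF ik True] by blast
        next
          case False
          then show ?thesis using permutes_not_in[OF p False] by (simp only: h_def if_False)
        qed
        then show "p \<in> h ` ?S" using ik by (metis ext image_eqI)
      qed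
    qed
  qed
  then have "bij_betw h (carrier (G\<lparr>carrier := ?S\<rparr>)) (carrier (sym_group n))"
    by (simp add: sym_group_def)
  ultimately show ?thesis unfolding is_iso_def iso_def by blast
qed

text \<open>For total maps, walks and group elements correspond: a walk with element
  \<open>g\<close> ends where \<open>g\<close> sends its start, and each \<open>g\<close> has a walk
  from each triple. Connectedness of the triples becomes transitivity, and freeness of walks becomes
  uniqueness.\<close>

lemma (in partial_extension) sharply_three_transitive_total:
  assumes good: "good \<Phi>" and total: "\<And>e x. e \<in> E \<Longrightarrow> x \<in> Y \<Longrightarrow> \<exists>z. (e, x, z) \<in> \<Phi>"
    and conn: "\<And>\<tau>. \<tau> \<in> triples \<Longrightarrow> conn \<Phi> \<tau>0 \<tau>"
    and act: "right_action G Y \<delta>"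
    and act_base: "\<And>y g. y \<in> Y \<Longrightarrow> g \<in> carrier G0 \<Longrightarrow> \<delta> y (\<iota> g) = act y g"
    and act_letter: "\<And>e x z. (e, x, z) \<in> \<Phi> \<Longrightarrow> \<delta> x (\<gamma> e) = z"
    and gen: "generates G (\<iota> ` carrier G0 \<union> \<gamma> ` E)"
  shows "sharply_three_transitive G Y \<delta>"
proof -
  interpret \<delta>: right_action G Y \<delta> by fact
  have pm: "partial_maps \<Phi>" and free: "free_on_triples \<Phi>" using good unfolding good_def by auto
  define dact where "dact \<tau> g = (\<lambda>i. \<delta> (\<tau> i) g)" for \<tau> :: "three \<Rightarrow> 'y" and g
  have dact_closed: "dact \<tau> g \<in> triples" if "\<tau> \<in> triples" "g \<in> carrier G" for \<tau> g
  proof -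
    have "inj (dact \<tau> g)"
    proof (rule injI)
      fix i j assume "dact \<tau> g i = dact \<tau> g j"
      then have "\<tau> i = \<tau> j"
        using \<delta>.act_cancel[OF triplesD[OF that(1)] triplesD[OF that(1)] that(2)] unfolding dact_def by blast
      then show "i = j" using that(1) unfolding triples_def by (auto dest: injD)
    qed
    then show ?thesis using \<delta>.act_closed[OF triplesD[OF that(1)] that(2)] unfolding triples_def dact_def by auto
  qed
  have dact_mult: "dact \<tau> (g \<otimes>\<^bsub>G\<^esub> h) = dact (dact \<tau> g) h"
    if "\<tau> \<in> triples" "g \<in> carrier G" "h \<in> carrier G" for \<tau> g h
    unfolding dact_def using that by (simp add: \<delta>.act_mult triplesD)
  have dact_one: "dact \<tau> \<one>\<^bsub>G\<^esub> = \<tau>" if "\<tau> \<in> triples" for \<tau>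
    unfolding dact_def using that by (simp add: \<delta>.act_one triplesD)
  have dact_\<iota>: "dact \<tau> (\<iota> h) = tact \<tau> h" if "\<tau> \<in> triples" "h \<in> carrier G0" for \<tau> h
    unfolding dact_def tact_def using that act_base triplesD by simp
  have dact_edge: "dact \<tau> (\<gamma> e) = \<tau>'" if "edge \<Phi> e \<tau> \<tau>'" for e \<tau> \<tau>'
    using that act_letter unfolding dact_def edge_def by (intro ext) blast
  have moves: "\<tau>' = dact \<tau> g" if "path \<Phi> \<tau> g \<tau>'" for \<tau> g \<tau>'
    using that
  proof (induction rule: path.induct)
    case start
    then show ?case using dact_one by simp
  next
    case (base g \<tau>' h)
    note q = path_triples[OF base.hyps(1) pm]
    show ?case using dact_mult[OF q(1,2) \<iota>_closed[OF base.hyps(2)]] dact_\<iota>[OF q(3) base.hyps(2)] base.IH by simp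
  next
    case (fwd g \<tau>' e \<tau>'')
    note q = path_triples[OF fwd.hyps(1) pm]
    show ?case using dact_mult[OF q(1,2) \<gamma>_closed[OF fwd.hyps(2)]] dact_edge[OF fwd.hyps(3)] fwd.IH by simp
  next
    case (bwd g \<tau>' e \<tau>'')
    note q = path_triples[OF bwd.hyps(1) pm]
    have t: "\<tau>'' \<in> triples" using edge_triples[OF pm bwd.hyps(3)] q(3) by blast
    have "dact \<tau>' (inv\<^bsub>G\<^esub> \<gamma> e) = \<tau>''"
      using dact_edge[OF bwd.hyps(3)] dact_mult[OF t \<gamma>_closed[OF bwd.hyps(2)], of "inv\<^bsub>G\<^esub> \<gamma> e"]
        dact_one[OF t] bwd.hyps(2) by simp
    then show ?case
      using dact_mult[OF q(1,2) G.inv_closed[OF \<gamma>_closed[OF bwd.hyps(2)]]] bwd.IH by simp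
  qed
  \<comment> \<open>The elements that can be walked from every triple. Totality puts the letters in
    here, and reversing and concatenating walks makes it a subgroup.\<close>
  let ?K = "{g \<in> carrier G. \<forall>\<tau>\<in>triples. path \<Phi> \<tau> g (dact \<tau> g)}"
  have "subgroup ?K G"
  proof (rule G.subgroupI)
    have "\<one>\<^bsub>G\<^esub> \<in> ?K" using path.start dact_one by simp
    then show "?K \<noteq> {}" by blast
  next
    fix g assume g: "g \<in> ?K"
    have "path \<Phi> \<tau> (inv\<^bsub>G\<^esub> g) (dact \<tau> (inv\<^bsub>G\<^esub> g))" if t: "\<tau> \<in> triples" for \<tau>
    proof -
      let ?u = "dact \<tau> (inv\<^bsub>G\<^esub> g)"
      have u: "?u \<in> triples" using dact_closed t g by simp
      have "dact ?u g = \<tau>" using dact_mult[OF t, of "inv\<^bsub>G\<^esub> g" g] dact_one[OF t] g by simp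
      then have "path \<Phi> ?u g \<tau>" using g u by force
      then show ?thesis by (rule path_sym[OF _ pm])
    qed
    then show "inv\<^bsub>G\<^esub> g \<in> ?K" using g by simp
  next
    fix g h assume g: "g \<in> ?K" and h: "h \<in> ?K"
    have "path \<Phi> \<tau> (g \<otimes>\<^bsub>G\<^esub> h) (dact \<tau> (g \<otimes>\<^bsub>G\<^esub> h))" if t: "\<tau> \<in> triples" for \<tau>
    proof -
      have "path \<Phi> (dact \<tau> g) h (dact (dact \<tau> g) h)" "path \<Phi> \<tau> g (dact \<tau> g)"
        using g h dact_closed t by auto
      then show ?thesis using path_trans[OF _ _ pm] dact_mult[OF t] g h by auto
    qed
    then show "g \<otimes>\<^bsub>G\<^esub> h \<in> ?K" using g h by simp
  qed blast
  moreover have "\<iota> h \<in> ?K" if "h \<in> carrier G0" for h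
    using path_base[OF _ that, of _ \<Phi>] dact_\<iota>[OF _ that] that by simp
  moreover have "\<gamma> e \<in> ?K" if e: "e \<in> E" for e
  proof -
    have "path \<Phi> \<tau> (\<gamma> e) (dact \<tau> (\<gamma> e))" if t: "\<tau> \<in> triples" for \<tau>
    proof -
      have "\<forall>i. \<exists>z. (e, \<tau> i, z) \<in> \<Phi>" using total[OF e triplesD[OF t]] by blast
      then obtain \<tau>' where "edge \<Phi> e \<tau> \<tau>'" unfolding edge_def by metis
      then show ?thesis using path_fwd[OF t e] dact_edge by blast
    qed
    then show ?thesis using e by simp
  qed
  ultimately have "carrier G \<subseteq> ?K" using generates_subset[OF gen] by blast
  then have walk: "path \<Phi> \<tau> g (dact \<tau> g)" if "g \<in> carrier G" "\<tau> \<in> triples" for g \<tau> using that by blast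
  show ?thesis
    unfolding sharply_three_transitive_def
  proof (intro ballI impI)
    fix y1 y2 y3 z1 z2 z3
    assume Y: "y1 \<in> Y" "y2 \<in> Y" "y3 \<in> Y" "z1 \<in> Y" "z2 \<in> Y" "z3 \<in> Y"
      and y: "y1 \<noteq> y2 \<and> y2 \<noteq> y3 \<and> y1 \<noteq> y3" and z: "z1 \<noteq> z2 \<and> z2 \<noteq> z3 \<and> z1 \<noteq> z3"
    let ?y = "case_three y1 y2 y3" and ?z = "case_three z1 z2 z3"
    have t: "?y \<in> triples" "?z \<in> triples"
      using Y y z unfolding triples_def by (auto simp: inj_three split: three.splits)
    have eq: "dact ?y g = ?z \<longleftrightarrow> \<delta> y1 g = z1 \<and> \<delta> y2 g = z2 \<and> \<delta> y3 g = z3" for g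
      by (simp add: dact_def fun_eq_iff all_three)
    have "conn \<Phi> ?y ?z" using conn_trans[OF conn_sym[OF conn[OF t(1)] pm] conn[OF t(2)] pm] .
    then obtain g where g: "path \<Phi> ?y g ?z" unfolding conn_def by blast
    show "\<exists>!g. g \<in> carrier G \<and> \<delta> y1 g = z1 \<and> \<delta> y2 g = z2 \<and> \<delta> y3 g = z3"
    proof (rule ex1I[of _ g])
      show "g \<in> carrier G \<and> \<delta> y1 g = z1 \<and> \<delta> y2 g = z2 \<and> \<delta> y3 g = z3"
        using path_triples(2)[OF g pm] moves[OF g] eq[of g] by simp
    next
      fix k assume k: "k \<in> carrier G \<and> \<delta> y1 k = z1 \<and> \<delta> y2 k = z2 \<and> \<delta> y3 k = z3"
      \<comment> \<open>A second solution also has a walk between the two triples, and walks with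
        the same ends carry the same element.\<close>
      then have "path \<Phi> ?y k ?z" using walk[of k ?y] t(1) eq[of k] by simp
      then show "k = g" using path_unique[OF pm free _ g] by blast
    qed
  qed
qed

section \<open>Cardinalities and orders of elements\<close>

lemma card_eq_max_aleph0_iso:
  assumes "card_eq_max_aleph0 R A" "card_eq_max_aleph0 S A"
  shows "|R| =o |S|"
proof (cases "|A| \<le>o natLeq")
  case True
  then have "|R| =o natLeq" "|S| =o natLeq" using assms unfolding card_eq_max_aleph0_def by auto
  then show ?thesis using ordIso_symmetric ordIso_transitive by blast
next
  case False
  then have "|R| =o |A|" "|S| =o |A|" using assms unfolding card_eq_max_aleph0_def by auto
  then show ?thesis using ordIso_symmetric ordIso_transitive by blast
qed

lemma card_eq_max_aleph0_bounds:
  assumes "card_eq_max_aleph0 R A"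
  shows "infinite R" "|A| \<le>o |R|"
proof -
  have "infinite R \<and> |A| \<le>o |R|"
  proof (cases "|A| \<le>o natLeq")
    case True
    then have R: "|R| =o natLeq" using assms unfolding card_eq_max_aleph0_def by auto
    then have "natLeq \<le>o |R|" using ordIso_symmetric ordIso_imp_ordLeq by blast
    then show ?thesis using True infinite_iff_natLeq_ordLeq ordLeq_transitive by blast
  next
    case False
    then have R: "|R| =o |A|" using assms unfolding card_eq_max_aleph0_def by auto
    have "natLeq \<le>o |A|"
      using False ordLeq_total[OF card_of_Well_order natLeq_Well_order, of A] by blast
    then have "infinite A" using infinite_iff_natLeq_ordLeq by blast
    then have "infinite R" using card_of_ordIso_finite[OF R] by blast
    then show ?thesis using R ordIso_symmetric ordIso_imp_ordLeq by blast
  qed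
  then show "infinite R" "|A| \<le>o |R|" by auto
qed

lemma (in group) ord_eq_2D: "\<lbrakk>x \<in> carrier G; ord x = 2\<rbrakk> \<Longrightarrow> x \<otimes> x = \<one> \<and> x \<noteq> \<one>"
  using pow_ord_eq_1[of x] ord_id by (auto simp: numeral_2_eq_2)

lemma (in group) ord_eq_3D: "\<lbrakk>x \<in> carrier G; ord x = 3\<rbrakk> \<Longrightarrow> x \<otimes> x \<otimes> x = \<one> \<and> x \<noteq> \<one>"
  using pow_ord_eq_1[of x] ord_id by (auto simp: numeral_3_eq_3)

lemma (in group) ord_eq_2I:
  assumes "x \<in> carrier G" "x \<otimes> x = \<one>" "x \<noteq> \<one>"
  shows "ord x = 2"
proof -
  have "x [^] (2::nat) = \<one>" using assms by (simp add: numeral_2_eq_2)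
  then have "ord x dvd 2" using pow_eq_id assms(1) by blast
  moreover have "ord x \<noteq> 1" using assms ord_eq_1 by blast
  moreover have "ord x \<le> 2" "ord x \<noteq> 0" using calculation(1) by (auto intro: dvd_imp_le intro!: Nat.gr0I)
  ultimately show ?thesis by linarith
qed

lemma (in group) ord_eq_3I:
  assumes "x \<in> carrier G" "x \<otimes> x \<otimes> x = \<one>" "x \<noteq> \<one>"
  shows "ord x = 3"
proof -
  have "x [^] (3::nat) = \<one>" using assms by (simp add: numeral_3_eq_3)
  then have "ord x dvd 3" using pow_eq_id assms(1) by blast
  moreover have "ord x \<noteq> 1" using assms ord_eq_1 by blast
  moreover have "ord x \<le> 3" "ord x \<noteq> 0" using calculation(1) by (auto intro: dvd_imp_le intro!: Nat.gr0I)
  moreover have "ord x \<noteq> 2" using calculation(1) by auto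
  ultimately show ?thesis by linarith
qed

text \<open>Any injection would do: its values serve as the points of the |R| regular orbits.\<close>

definition orbit_point :: "'b \<times> 'g \<Rightarrow> ('g, 'b) big_elt" where
  "orbit_point p = {[Inr {[(fst p, True)]}, Inl {[Inl {[Inr (snd p)]}]}]}"

lemma inj_orbit_point: "inj orbit_point"
  unfolding orbit_point_def by (rule injI) (simp add: prod_eq_iff)

lemma orbit_point_eq [simp]: "orbit_point p = orbit_point q \<longleftrightarrow> p = q"
  by (rule inj_eq[OF inj_orbit_point])

text \<open>New points are decoded into pairs, on which \<open>G0\<close> acts by right
  multiplication in the second component. Each index \<open>r\<close> thus contributes one regular
  orbit.\<close>

definition extended_act :: "('g, 'm) monoid_scheme \<Rightarrow> ('x \<Rightarrow> 'g \<Rightarrow> 'x) \<Rightarrow>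
    'x + ('g, 'b) big_elt \<Rightarrow> 'g \<Rightarrow> 'x + ('g, 'b) big_elt" where
  "extended_act G0 act y g = (case y of Inl x \<Rightarrow> Inl (act x g)
     | Inr z \<Rightarrow> (case inv_into UNIV orbit_point z of (r, h) \<Rightarrow> Inr (orbit_point (r, h \<otimes>\<^bsub>G0\<^esub> g))))"

lemma extended_act_simps [simp]:
  "extended_act G0 act (Inl x) g = Inl (act x g)"
  "extended_act G0 act (Inr (orbit_point (r, h))) g = Inr (orbit_point (r, h \<otimes>\<^bsub>G0\<^esub> g))"
  unfolding extended_act_def by (simp_all add: inv_into_f_f[OF inj_orbit_point])

definition extended_points :: "('g, 'm) monoid_scheme \<Rightarrow> 'x set \<Rightarrow> 'b set \<Rightarrow> ('x + ('g, 'b) big_elt) set" where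
  "extended_points G0 X0 R = Inl ` X0 \<union> Inr ` orbit_point ` (R \<times> carrier G0)"

lemma extended_pointsE:
  assumes "y \<in> extended_points G0 X0 R"
  obtains x where "x \<in> X0" "y = Inl x"
    | r h where "r \<in> R" "h \<in> carrier G0" "y = Inr (orbit_point (r, h))"
  using assms unfolding extended_points_def by auto

lemma extended_points_mem [simp]:
  "Inl x \<in> extended_points G0 X0 R \<longleftrightarrow> x \<in> X0"
  "Inr (orbit_point (r, h)) \<in> extended_points G0 X0 R \<longleftrightarrow> r \<in> R \<and> h \<in> carrier G0"
  unfolding extended_points_def by auto

lemma extended_action:
  assumes "right_action G0 X0 act"
  shows "right_action G0 (extended_points G0 X0 R) (extended_act G0 act)"
proof -
  interpret right_action G0 X0 act by fact
  show ?thesis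
  proof (rule right_action.intro[OF is_group], unfold_locales)
    fix x g assume "x \<in> extended_points G0 X0 R" "g \<in> carrier G0"
    then show "extended_act G0 act x g \<in> extended_points G0 X0 R"
      by (elim extended_pointsE) (auto simp: act_closed)
  next
    fix x assume "x \<in> extended_points G0 X0 R"
    then show "extended_act G0 act x \<one>\<^bsub>G0\<^esub> = x"
      by (elim extended_pointsE) (auto simp: act_one)
  next
    fix x g h assume "x \<in> extended_points G0 X0 R" "g \<in> carrier G0" "h \<in> carrier G0"
    then show "extended_act G0 act x (g \<otimes>\<^bsub>G0\<^esub> h) = extended_act G0 act (extended_act G0 act x g) h"
      by (elim extended_pointsE) (auto simp: act_mult m_assoc)
  qed
qed

lemma extended_act_fixes_new:
  assumes "group G0" "g \<in> carrier G0" "h \<in> carrier G0"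
    and "extended_act G0 act (Inr (orbit_point (r, h))) g = Inr (orbit_point (r, h))"
  shows "g = \<one>\<^bsub>G0\<^esub>"
proof -
  interpret group G0 by fact
  have "h \<otimes>\<^bsub>G0\<^esub> g = h" using assms(4) by simp
  then show ?thesis using assms(2,3) by simp
qed

text \<open>The bound on |X0| enters here: a recursion of length |R| must reach every point and
  every triple of \<open>Y\<close>.\<close>

lemma card_extended_points:
  assumes "|X0| \<le>o |R|" "|carrier G0| \<le>o |R|" "infinite R"
  shows "|extended_points G0 X0 R| \<le>o |R|"
proof -
  have inf: "infinite (Field |R| )" using assms(3) by (simp add: Field_card_of)
  have R: "|R| \<le>o |R|" using card_of_mono1 by blast
  have "|R \<times> carrier G0| \<le>o |R|"
    by (rule card_of_Times_ordLeq_infinite_Field[OF inf R assms(2) card_of_Card_order])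
  then have "|Inr ` orbit_point ` (R \<times> carrier G0)| \<le>o |R|"
    by (intro ordLeq_transitive[OF card_of_image] ordLeq_transitive[OF card_of_image])
  moreover have "|Inl ` X0| \<le>o |R|" by (rule ordLeq_transitive[OF card_of_image assms(1)])
  ultimately show ?thesis unfolding extended_points_def
    by (intro card_of_Un_ordLeq_infinite_Field[OF inf _ _ card_of_Card_order])
qed

section \<open>From \<open>{1..3}\<close> to the three positions\<close>

definition three_of_nat :: "nat \<Rightarrow> three" where
  "three_of_nat i = (if i = 1 then I1 else if i = 2 then I2 else I3)"

lemma bij_three_of_nat: "bij_betw three_of_nat {1..3} UNIV"
proof -
  have "{1..3::nat} = {1, 2, 3}" by auto
  then show ?thesis unfolding bij_betw_def by (auto simp: three_of_nat_def UNIV_three inj_on_def)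
qed

lemma permutation_of_three:
  assumes "p permutes {1..3}"
  shows "\<exists>\<sigma>. bij \<sigma> \<and> (\<forall>i\<in>{1..3}. \<sigma> (three_of_nat i) = three_of_nat (p i))"
proof (intro exI conjI ballI)
  let ?j = "inv_into {1..3} three_of_nat"
  show "bij (three_of_nat \<circ> p \<circ> ?j)"
    using bij_betw_trans[OF bij_betw_inv_into[OF bij_three_of_nat]
        bij_betw_trans[OF permutes_imp_bij[OF assms] bij_three_of_nat]] by (simp add: comp_assoc)
  show "(three_of_nat \<circ> p \<circ> ?j) (three_of_nat i) = three_of_nat (p i)" if "i \<in> {1..3}" for i
    using bij_betw_inv_into_left[OF bij_three_of_nat that] by simp
qed

text \<open>If a triple with all symmetries had a point in a regular orbit, the element that
  realizes such a transposition would fix this point and yet be nontrivial.\<close>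

lemma swap_fixing: "\<exists>\<sigma>. bij \<sigma> \<and> \<sigma> i = i \<and> \<sigma> \<noteq> (id :: three \<Rightarrow> three)"
proof -
  have b: "bij (case_three I3 I2 I1)" "bij (case_three I2 I1 I3)" "bij (case_three I1 I3 I2)"
    by (rule bij_three, simp add: inj_three)+
  have n: "case_three I3 I2 I1 \<noteq> id" "case_three I2 I1 I3 \<noteq> id" "case_three I1 I3 I2 \<noteq> id"
    by (simp_all add: fun_eq_iff ex_three)
  have f: "case_three I1 I3 I2 I1 = I1" "case_three I3 I2 I1 I2 = I2" "case_three I2 I1 I3 I3 = I3"
    by simp_all
  show ?thesis by (cases i) (use b n f in metis)+
qed

theorem theorem2p1:
  fixes G0 :: "('g, 'm) monoid_scheme"
    and a t :: 'g
    and X0 :: "'x set"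
    and act :: "'x \<Rightarrow> 'g \<Rightarrow> 'x"
    and x0 :: 'x
    and R S U :: "'b set"
  assumes G0: "group G0"
    and order3_conj: "\<And>g h. \<lbrakk>g \<in> carrier G0; h \<in> carrier G0; group.ord G0 g = 3; group.ord G0 h = 3\<rbrakk>
            \<Longrightarrow> conjugate_in G0 g h"
    and invol_conj: "\<And>g h. \<lbrakk>g \<in> carrier G0; h \<in> carrier G0; group.ord G0 g = 2; group.ord G0 h = 2\<rbrakk>
            \<Longrightarrow> conjugate_in G0 g h"
    and a: "a \<in> carrier G0" "group.ord G0 a = 3"
    and t: "t \<in> carrier G0" "group.ord G0 t = 2"
    and S3: "subgroup_generated G0 {a, t} \<cong> sym_group 3"
    and action: "right_action G0 X0 act"
    and sharp: "three_sharp G0 X0 act"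
    and x0: "x0 \<in> X0" "act x0 t = x0"
    and x0_unique: "\<And>x. \<lbrakk>x \<in> X0; act x t = x\<rbrakk> \<Longrightarrow> x = x0"
    and a_no_fix: "\<And>x. x \<in> X0 \<Longrightarrow> act x a \<noteq> x"
    and A: "(x0, act x0 a, act x0 (a [^]\<^bsub>G0\<^esub> (2::nat))) = (x0, act x0 a, act x0 (a \<otimes>\<^bsub>G0\<^esub> t))"
    and B: "\<And>x y z. \<lbrakk>x \<in> X0; y \<in> X0; z \<in> X0; x \<noteq> y; y \<noteq> z; x \<noteq> z;
              G0\<lparr>carrier := setwise_stabilizer G0 act {x, y, z}\<rparr> \<cong> sym_group 3\<rbrakk>
            \<Longrightarrow> \<exists>g\<in>carrier G0. (act x0 g, act (act x0 a) g, act (act x0 (a [^]\<^bsub>G0\<^esub> (2::nat))) g) = (x, y, z)"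
    and disjoint: "R \<inter> S = {}" "R \<inter> U = {}" "S \<inter> U = {}"
    and card_RSU: "card_eq_max_aleph0 R (carrier G0)" "card_eq_max_aleph0 S (carrier G0)"
      "card_eq_max_aleph0 U (carrier G0)"
    and card_X0: "|X0| \<le>o |R|"
  shows "\<exists>(Y :: ('x + ('g, 'b) big_elt) set) actY.
           Inl ` X0 \<subseteq> Y \<and>
           right_action (big_group G0 a t R S U) Y actY \<and>
           (\<forall>x\<in>X0. \<forall>g\<in>carrier G0. actY (Inl x) (big_incl G0 a t R S U g) = Inl (act x g)) \<and>
           sharply_three_transitive (big_group G0 a t R S U) Y actY"
proof -
  interpret X: right_action G0 X0 act by fact
  define Y :: "('x + ('g, 'b) big_elt) set" where "Y = extended_points G0 X0 R"
  define ya :: "'x + ('g, 'b) big_elt \<Rightarrow> 'g \<Rightarrow> 'x + ('g, 'b) big_elt" where "ya = extended_act G0 act"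
  define C where "C e = (if e \<in> R then {\<one>\<^bsub>G0\<^esub>} else if e \<in> S then {\<one>\<^bsub>G0\<^esub>, t}
    else {\<one>\<^bsub>G0\<^esub>, a, a \<otimes>\<^bsub>G0\<^esub> a})" for e
  have ya_Inl: "ya (Inl x) g = Inl (act x g)" for x g unfolding ya_def by simp
  have new_free: "g = \<one>\<^bsub>G0\<^esub>" if "g \<in> carrier G0" "h \<in> carrier G0"
    "ya (Inr (orbit_point (r, h))) g = Inr (orbit_point (r, h))" for g h r
    by (rule extended_act_fixes_new[OF G0 that(1,2) that(3)[unfolded ya_def]])
  let ?G = "big_group G0 a t R S U" and ?\<iota> = "big_incl G0 a t R S U" and ?\<gamma> = "big_gen G0 a t R S U"
  have aaa: "a \<otimes>\<^bsub>G0\<^esub> a \<otimes>\<^bsub>G0\<^esub> a = \<one>\<^bsub>G0\<^esub>" "a \<noteq> \<one>\<^bsub>G0\<^esub>" using X.ord_eq_3D[OF a] by auto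
  have tt: "t \<otimes>\<^bsub>G0\<^esub> t = \<one>\<^bsub>G0\<^esub>" "t \<noteq> \<one>\<^bsub>G0\<^esub>" using X.ord_eq_2D[OF t] by auto
  have a3: "a \<otimes>\<^bsub>G0\<^esub> (a \<otimes>\<^bsub>G0\<^esub> a) = \<one>\<^bsub>G0\<^esub>" using aaa(1) a(1) by (simp add: X.m_assoc)
  have inv_a: "inv\<^bsub>G0\<^esub> a = a \<otimes>\<^bsub>G0\<^esub> a" "inv\<^bsub>G0\<^esub> (a \<otimes>\<^bsub>G0\<^esub> a) = a" and inv_t: "inv\<^bsub>G0\<^esub> t = t"
    using X.inv_equality a(1) t(1) aaa(1) a3 tt(1) by auto
  have aaaa: "a \<otimes>\<^bsub>G0\<^esub> a \<otimes>\<^bsub>G0\<^esub> (a \<otimes>\<^bsub>G0\<^esub> a) = a" using a(1) a3 by (simp add: X.m_assoc)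
  have a_pow: "a [^]\<^bsub>G0\<^esub> (2::nat) = a \<otimes>\<^bsub>G0\<^esub> a" using a(1) by (simp add: numeral_2_eq_2)
  have iota: "?\<iota> \<in> hom G0 ?G" by (rule big_incl_hom[OF G0 a(1) t(1)])
  have gen_mem: "?\<gamma> e \<in> carrier ?G" if "e \<in> R \<union> S \<union> U" for e by (rule big_gen_closed[OF G0 a(1) t(1) that])
  interpret G: group ?G by (rule big_group_group[OF G0 a(1) t(1)])
  interpret P: partial_extension G0 Y ya ?G ?\<iota> ?\<gamma> "R \<union> S \<union> U" C
  proof (intro partial_extension.intro partial_extension_axioms.intro)
    show "right_action G0 Y ya" unfolding Y_def ya_def by (rule extended_action[OF action])
    show "group ?G" by (rule G.is_group)
    show "?\<iota> \<in> hom G0 ?G" by (rule iota)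
  next
    fix e assume "e \<in> R \<union> S \<union> U"
    then show "?\<gamma> e \<in> carrier ?G" by (rule gen_mem)
    show "subgroup (C e) G0"
      unfolding C_def using a(1) t(1) aaa(1) tt(1) a3 aaaa inv_a inv_t by (auto intro!: X.subgroupI)
  next
    fix e c assume e: "e \<in> R \<union> S \<union> U" and c: "c \<in> C e"
    have one: "?\<iota> \<one>\<^bsub>G0\<^esub> = \<one>\<^bsub>?G\<^esub>" using hom_one[OF iota G0 G.is_group] .
    note ga = hom_in_carrier[OF iota a(1)]
    have aa: "?\<iota> (a \<otimes>\<^bsub>G0\<^esub> a) = ?\<iota> a \<otimes>\<^bsub>?G\<^esub> ?\<iota> a" using hom_mult[OF iota a(1) a(1)] .
    from e consider "e \<in> R" | "e \<in> S" "e \<notin> R" | "e \<in> U" "e \<notin> R" "e \<notin> S" by blast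
    then show "?\<iota> c \<otimes>\<^bsub>?G\<^esub> ?\<gamma> e = ?\<gamma> e \<otimes>\<^bsub>?G\<^esub> ?\<iota> c"
    proof cases
      case 1
      then show ?thesis using c one gen_mem[OF e] unfolding C_def by simp
    next
      case 2
      then show ?thesis using c one gen_mem[OF e] big_gen_commute_t[OF G0 a(1) t(1) 2, of U]
        unfolding C_def by auto
    next
      case 3
      have comm: "?\<iota> a \<otimes>\<^bsub>?G\<^esub> ?\<gamma> e = ?\<gamma> e \<otimes>\<^bsub>?G\<^esub> ?\<iota> a" by (rule big_gen_commute_a[OF G0 a(1) t(1) 3])
      have "?\<iota> a \<otimes>\<^bsub>?G\<^esub> ?\<iota> a \<otimes>\<^bsub>?G\<^esub> ?\<gamma> e = ?\<iota> a \<otimes>\<^bsub>?G\<^esub> (?\<gamma> e \<otimes>\<^bsub>?G\<^esub> ?\<iota> a)"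
        using comm ga gen_mem[OF e] by (simp add: G.m_assoc)
      also have "\<dots> = ?\<gamma> e \<otimes>\<^bsub>?G\<^esub> (?\<iota> a \<otimes>\<^bsub>?G\<^esub> ?\<iota> a)"
        using comm ga gen_mem[OF e] by (simp flip: G.m_assoc)
      finally show ?thesis using 3 c one gen_mem[OF e] comm aa unfolding C_def by auto
    qed
  qed
  have triplesD: "\<tau> i \<in> extended_points G0 X0 R" if "\<tau> \<in> P.triples" for \<tau> i
    using P.triplesD[OF that] unfolding Y_def .
  \<comment> \<open>A single point in a new orbit already has trivial stabilizer; a triple without
    such points lies in \<open>X0\<close>.\<close>
  have sharp_Y: "g = \<one>\<^bsub>G0\<^esub>" if \<tau>: "\<tau> \<in> P.triples" and g: "g \<in> carrier G0" and fixed: "P.tact \<tau> g = \<tau>" for \<tau> g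
  proof (cases "\<exists>i r h. h \<in> carrier G0 \<and> \<tau> i = Inr (orbit_point (r, h))")
    case True
    then obtain i r h where i: "h \<in> carrier G0" "\<tau> i = Inr (orbit_point (r, h))" by blast
    have "ya (\<tau> i) g = \<tau> i" using fun_cong[OF fixed, of i] unfolding P.tact_def .
    then show ?thesis unfolding i(2) by (rule new_free[OF g i(1)])
  next
    case False
    have "\<exists>x\<in>X0. \<tau> i = Inl x" for i
      using triplesD[OF \<tau>, of i] False by (elim extended_pointsE) blast+
    then obtain f where f: "\<And>i. f i \<in> X0" "\<And>i. \<tau> i = Inl (f i)" by metis
    have "f i \<noteq> f j" if "i \<noteq> j" for i j using \<tau> that f(2) unfolding P.triples_def by (metis (mono_tags) injD mem_Collect_eq)
    moreover have "act (f i) g = f i" for i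
      using fun_cong[OF fixed, of i] by (simp add: P.tact_def f(2) ya_Inl)
    ultimately have "g \<in> {g \<in> carrier G0. act (f I1) g = f I1 \<and> act (f I2) g = f I2 \<and> act (f I3) g = f I3}"
      "f I1 \<noteq> f I2 \<and> f I2 \<noteq> f I3 \<and> f I1 \<noteq> f I3" using g by auto
    then show ?thesis using sharp f(1) unfolding three_sharp_def by blast
  qed
  let ?A = "case_three (Inl x0) (ya (Inl x0) a) (ya (ya (Inl x0) a) a)"
  \<comment> \<open>A triple with all symmetries has no point in a regular orbit, so it lies in
    \<open>X0\<close>. There its stabilizer is faithful and full on three points, hence isomorphic
    to S_3, and hypothesis \<open>B\<close> applies.\<close>
  have full: "\<exists>g\<in>carrier G0. P.tact ?A g = \<tau>"
    if \<tau>: "\<tau> \<in> P.triples" and real: "\<And>\<sigma>. bij \<sigma> \<Longrightarrow> \<exists>g\<in>carrier G0. P.tact \<tau> g = \<tau> \<circ> \<sigma>" for \<tau>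
  proof -
    have inj: "inj \<tau>" using \<tau> unfolding P.triples_def by blast
    have "\<exists>x\<in>X0. \<tau> i = Inl x" for i
    proof -
      from triplesD[OF \<tau>, of i] show ?thesis
      proof (cases rule: extended_pointsE)
        case (2 r h)
        obtain \<sigma> where s: "bij \<sigma>" "\<sigma> i = i" "\<sigma> \<noteq> id" using swap_fixing by blast
        obtain g where g: "g \<in> carrier G0" "P.tact \<tau> g = \<tau> \<circ> \<sigma>" using real s(1) by blast
        have "ya (\<tau> i) g = \<tau> i" using fun_cong[OF g(2), of i] s(2) by (simp add: P.tact_def)
        then have "g = \<one>\<^bsub>G0\<^esub>" unfolding 2(3) by (rule new_free[OF g(1) 2(2)])
        then have "\<tau> \<circ> \<sigma> = \<tau>" using g(2) P.tact_one[OF \<tau>] by simp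
        then have "\<sigma> = id" using inj by (auto simp: fun_eq_iff inj_eq)
        then show ?thesis using s(3) by blast
      qed blast
    qed
    then obtain f where f: "\<And>i. f i \<in> X0" "\<And>i. \<tau> i = Inl (f i)" by metis
    have injf: "inj f" using inj f(2) by (metis injD injI)
    let ?T = "{f I1, f I2, f I3}"
    have T: "?T = range f" by (simp add: UNIV_three)
    have iso: "G0\<lparr>carrier := setwise_stabilizer G0 act ?T\<rparr> \<cong> sym_group 3"
    proof (rule setwise_stabilizer_iso_sym_group[OF action])
      show "?T \<subseteq> X0" using f(1) by simp
      show "bij_betw (f \<circ> three_of_nat) {1..3} ?T"
        by (rule bij_betw_trans[OF bij_three_of_nat]) (simp add: bij_betw_def injf T del: insert_iff)
    next
      fix g assume g: "g \<in> carrier G0" and fixed: "\<And>x. x \<in> ?T \<Longrightarrow> act x g = x"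
      have "P.tact \<tau> g = \<tau>"
      proof
        fix i
        have "act (f i) g = f i" using fixed unfolding T by blast
        then show "P.tact \<tau> g i = \<tau> i" by (simp add: P.tact_def f(2) ya_Inl)
      qed
      then show "g = \<one>\<^bsub>G0\<^esub>" by (rule sharp_Y[OF \<tau> g])
    next
      fix p assume "p permutes {1..3::nat}"
      from permutation_of_three[OF this]
      obtain \<sigma> where s: "bij \<sigma>" "\<forall>i\<in>{1..3}. \<sigma> (three_of_nat i) = three_of_nat (p i)"
        by (elim exE conjE)
      obtain g where g: "g \<in> carrier G0" "P.tact \<tau> g = \<tau> \<circ> \<sigma>" using real s(1) by blast
      have "act (f j) g = f (\<sigma> j)" for j
        using fun_cong[OF g(2), of j] by (simp add: P.tact_def f(2) ya_Inl)
      then show "\<exists>k\<in>carrier G0. \<forall>i\<in>{1..3}. act ((f \<circ> three_of_nat) i) k = (f \<circ> three_of_nat) (p i)"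
        using g(1) s(2) by (intro bexI[of _ g]) auto
    qed
    have ne: "f I1 \<noteq> f I2" "f I2 \<noteq> f I3" "f I1 \<noteq> f I3" using injf by (auto simp: inj_three)
    obtain g where g: "g \<in> carrier G0"
      "(act x0 g, act (act x0 a) g, act (act x0 (a [^]\<^bsub>G0\<^esub> (2::nat))) g) = (f I1, f I2, f I3)"
      using B[OF f(1) f(1) f(1) ne iso] by blast
    have "P.tact ?A g = \<tau>"
      using g(2) f(2) x0(1) a(1) a_pow
      by (simp add: fun_eq_iff all_three P.tact_def ya_Inl X.act_mult)
    then show ?thesis using g(1) by blast
  qed
  have inf: "infinite R" and card_G0: "|carrier G0| \<le>o |R|" using card_eq_max_aleph0_bounds[OF card_RSU(1)] by auto
  interpret extension_setup G0 Y ya ?G ?\<iota> ?\<gamma> R S U C a t "Inl x0" "\<lambda>r. Inr (orbit_point (r, \<one>\<^bsub>G0\<^esub>))"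
  proof (unfold_locales)
    show "R \<inter> S = {}" "R \<inter> U = {}" "S \<inter> U = {}" by fact+
    show "e \<in> R \<Longrightarrow> C e = {\<one>\<^bsub>G0\<^esub>}" for e unfolding C_def by simp
    show "e \<in> S \<Longrightarrow> C e = {\<one>\<^bsub>G0\<^esub>, t}" for e using disjoint unfolding C_def by auto
    show "e \<in> U \<Longrightarrow> C e = {\<one>\<^bsub>G0\<^esub>, a, a \<otimes>\<^bsub>G0\<^esub> a}" for e using disjoint unfolding C_def by auto
    show "a \<in> carrier G0" "a \<otimes>\<^bsub>G0\<^esub> a \<otimes>\<^bsub>G0\<^esub> a = \<one>\<^bsub>G0\<^esub>" using a aaa by auto
    show "t \<in> carrier G0" "t \<otimes>\<^bsub>G0\<^esub> t = \<one>\<^bsub>G0\<^esub>" "t \<noteq> \<one>\<^bsub>G0\<^esub>" using t tt by auto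
  next
    fix g assume "g \<in> carrier G0" "g \<noteq> \<one>\<^bsub>G0\<^esub>" "g \<otimes>\<^bsub>G0\<^esub> g = \<one>\<^bsub>G0\<^esub>"
    then show "\<exists>h\<in>carrier G0. g = inv\<^bsub>G0\<^esub> h \<otimes>\<^bsub>G0\<^esub> t \<otimes>\<^bsub>G0\<^esub> h"
      using invol_conj[OF t(1) _ t(2)] X.ord_eq_2I unfolding conjugate_in_def by blast
  next
    fix g assume "g \<in> carrier G0" "g \<noteq> \<one>\<^bsub>G0\<^esub>" "g \<otimes>\<^bsub>G0\<^esub> g \<otimes>\<^bsub>G0\<^esub> g = \<one>\<^bsub>G0\<^esub>"
    then show "\<exists>h\<in>carrier G0. g = inv\<^bsub>G0\<^esub> h \<otimes>\<^bsub>G0\<^esub> a \<otimes>\<^bsub>G0\<^esub> h"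
      using order3_conj[OF a(1) _ a(2)] X.ord_eq_3I unfolding conjugate_in_def by blast
  next
    show "Inl x0 \<in> Y" "ya (Inl x0) t = Inl x0" using x0 by (simp_all add: Y_def ya_Inl)
  next
    fix y assume y: "y \<in> Y" "ya y t = y"
    from y(1) show "y = Inl x0" unfolding Y_def
    proof (cases rule: extended_pointsE)
      case (1 x)
      then show ?thesis using y(2) x0_unique by (simp add: ya_Inl)
    next
      case (2 r h)
      have "t = \<one>\<^bsub>G0\<^esub>" by (rule new_free[OF t(1) 2(2) y(2)[unfolded 2(3)]])
      then show ?thesis using tt(2) by blast
    qed
  next
    fix y assume y: "y \<in> Y"
    then show "ya y a \<noteq> y" unfolding Y_def
    proof (cases rule: extended_pointsE)
      case (1 x)
      then show ?thesis using a_no_fix by (simp add: ya_Inl)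
    next
      case (2 r h)
      then show ?thesis using new_free[OF a(1) 2(2), of r] aaa(2) by metis
    qed
  next
    show "ya (ya (Inl x0) a) t = ya (ya (Inl x0) a) a"
      using A x0(1) a(1) t(1) a_pow by (simp add: ya_Inl X.act_mult)
  next
    show "\<tau> \<in> P.triples \<Longrightarrow> g \<in> carrier G0 \<Longrightarrow> P.tact \<tau> g = \<tau> \<Longrightarrow> g = \<one>\<^bsub>G0\<^esub>" for \<tau> g by (rule sharp_Y)
    show "\<exists>g\<in>carrier G0. P.tact ?A g = \<tau>"
      if "\<tau> \<in> P.triples" "\<And>\<sigma>. bij \<sigma> \<Longrightarrow> \<exists>g\<in>carrier G0. P.tact \<tau> g = \<tau> \<circ> \<sigma>" for \<tau>
      using that by (rule full)
  next
    show "r \<in> R \<Longrightarrow> Inr (orbit_point (r, \<one>\<^bsub>G0\<^esub>)) \<in> Y" for r unfolding Y_def by simp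
    show "r = r' \<and> g = g'" if "g \<in> carrier G0" "g' \<in> carrier G0"
      "ya (Inr (orbit_point (r, \<one>\<^bsub>G0\<^esub>))) g = ya (Inr (orbit_point (r', \<one>\<^bsub>G0\<^esub>))) g'" for r r' g g'
      using that unfolding ya_def by simp
  next
    show "infinite R" by (rule inf)
    show "|R| \<le>o |S|" "|S| \<le>o |R|" "|R| \<le>o |U|" "|U| \<le>o |R|"
      using card_RSU card_eq_max_aleph0_iso ordIso_imp_ordLeq by blast+
    show "|Y| \<le>o |R|" unfolding Y_def by (rule card_extended_points[OF card_X0 card_G0 inf])
  qed
  obtain \<Phi> where good: "P.good \<Phi>" and total: "\<forall>e\<in>E. \<forall>x\<in>Y. (\<exists>z. (e, x, z) \<in> \<Phi>) \<and> (\<exists>z. (e, z, x) \<in> \<Phi>)"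
    and conn: "\<forall>\<tau>\<in>P.triples. P.conn \<Phi> A \<tau>"
    using total_extension by (elim exE conjE)
  have pm: "P.partial_maps \<Phi>" using good unfolding P.good_def by blast
  \<comment> \<open>Every letter now has exactly one value at each point, and every point is a
    value, so the partial maps have become permutations of \<open>Y\<close>.\<close>
  define \<phi> where "\<phi> e x = (THE z. (e, x, z) \<in> \<Phi>)" for e x
  have \<phi>: "\<phi> e x = z" if "(e, x, z) \<in> \<Phi>" for e x z
    unfolding \<phi>_def using that P.partial_mapsD(2)[OF pm] by (intro the_equality)
  have \<phi>': "(e, x, \<phi> e x) \<in> \<Phi>" if "e \<in> E" "x \<in> Y" for e x
    using total that \<phi> by metis
  have bij: "bij_betw (\<phi> e) Y Y" if e: "e \<in> E" for e
    unfolding bij_betw_def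
  proof
    show "inj_on (\<phi> e) Y"
      using \<phi>'[OF e] P.partial_mapsD(3)[OF pm] by (intro inj_onI) metis
    show "\<phi> e ` Y = Y"
    proof
      show "\<phi> e ` Y \<subseteq> Y" using \<phi>'[OF e] P.partial_mapsD(1)[OF pm] by blast
      show "Y \<subseteq> \<phi> e ` Y"
      proof
        fix y assume "y \<in> Y"
        then obtain z where z: "(e, z, y) \<in> \<Phi>" using total e by blast
        then show "y \<in> \<phi> e ` Y" using \<phi>[OF z] P.partial_mapsD(1)[OF pm z] by blast
      qed
    qed
  qed
  have comm: "\<phi> e (ya y c) = ya (\<phi> e y) c" if "e \<in> E" "c \<in> C e" "y \<in> Y" for e c y
    using \<phi>[OF P.partial_mapsD(4)[OF pm \<phi>'[OF that(1,3)] that(2)]] .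
  have "\<exists>\<delta>. right_action ?G Y \<delta> \<and> (\<forall>y\<in>Y. \<forall>g\<in>carrier G0. \<delta> y (?\<iota> g) = ya y g) \<and>
      (\<forall>y\<in>Y. \<forall>e\<in>R \<union> S \<union> U. \<delta> y (?\<gamma> e) = \<phi> e y)"
  proof (rule big_action[OF G0 a(1) t(1) disjoint P.right_action_axioms])
    show "\<forall>e\<in>E. bij_betw (\<phi> e) Y Y" using bij by blast
    show "\<forall>s\<in>S. \<forall>y\<in>Y. \<phi> s (ya y t) = ya (\<phi> s y) t" using comm C_S by blast
    show "\<forall>u\<in>U. \<forall>y\<in>Y. \<phi> u (ya y a) = ya (\<phi> u y) a" using comm C_U by blast
  qed
  then obtain \<delta> where \<delta>: "right_action ?G Y \<delta>"
    and \<delta>_base: "\<forall>y\<in>Y. \<forall>g\<in>carrier G0. \<delta> y (?\<iota> g) = ya y g"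
    and \<delta>_gen: "\<forall>y\<in>Y. \<forall>e\<in>R \<union> S \<union> U. \<delta> y (?\<gamma> e) = \<phi> e y"
    by (elim exE conjE)
  have "sharply_three_transitive ?G Y \<delta>"
  proof (rule P.sharply_three_transitive_total[OF good _ _ \<delta> _ _ big_generates[OF G0 a(1) t(1) disjoint]])
    show "\<exists>z. (e, x, z) \<in> \<Phi>" if "e \<in> E" "x \<in> Y" for e x using total that by blast
    show "P.conn \<Phi> A \<tau>" if "\<tau> \<in> P.triples" for \<tau> using conn that by blast
    show "\<delta> y (?\<iota> g) = ya y g" if "y \<in> Y" "g \<in> carrier G0" for y g using \<delta>_base that by blast
    show "\<delta> x (?\<gamma> e) = z" if "(e, x, z) \<in> \<Phi>" for e x z
      using \<delta>_gen \<phi>[OF that] P.partial_mapsD(1)[OF pm that] by simp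
  qed
  moreover have "Inl ` X0 \<subseteq> Y" unfolding Y_def by auto
  moreover have "\<forall>x\<in>X0. \<forall>g\<in>carrier G0. \<delta> (Inl x) (?\<iota> g) = Inl (act x g)"
    using \<delta>_base by (simp add: Y_def ya_Inl)
  ultimately show ?thesis using \<delta> by blast
qed

end
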